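(* Let $\rho_0\in \mathrm{BV}([0,L],[\rho_0^{\min},\rho_0^{\max}])$, $\mathrm{In}\in \mathrm{BV}([0,T],[f_{\min},f_{\max}])$ and $f^*\in \mathrm{BV}([0,T],[f_{\min},f_{\max}])$, where $0<\rho_0^{\min}\le\rho_0^{\max}\le\rho_{\mathrm{cr}}$, $0<f_{\min}\le f_{\max}$, $\rho_0^{\min}\le f_{\min}/v_{\max}$ and $\rho_0^{\max}\ge f_{\max}/v_{\min}$. For $v\in \mathrm{BV}([0,T],[v_{\min},v_{\max}])$ let $$J(v)=\int_0^T\big(\mathrm{Out}(t)-f^*(t)\big)^2\,dt,$$ where $\mathrm{Out}$ is the outflow associated with the control policy $v$. Then for every $K>0$ and $C>0$ the functional $J$ is Lipschitz continuous on $$\Omega=\{v\in \mathrm{BV}([0,T],[v_{\min},v_{\max}]):\ \mathrm{TV}(v)\le K\}\cap\{v\in L^\infty:\ \|v\|_\infty\le C\}$$ endowed with the norm $\|v\|_{L^1}$.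
   Context: Fix $L>0$, $T>0$, $0<v_{\min}\le v_{\max}$ and $0<\rho_{\mathrm{cr}}<\rho_{\max}$. The Newell–Daganzo flux $f:[0,\rho_{\max}]\times[v_{\min},v_{\max}]\to[0,\infty)$ is $$f(\rho,v)=\begin{cases}\rho v,&0\le\rho\le\rho_{\mathrm{cr}},\\ \dfrac{v\,\rho_{\mathrm{cr}}}{\rho_{\max}-\rho_{\mathrm{cr}}}(\rho_{\max}-\rho),&\rho_{\mathrm{cr}}<\rho\le\rho_{\max}.\end{cases}$$ $\mathrm{BV}(I,E)$ denotes the functions of bounded variation on the interval $I$ with values in $E$, and $\mathrm{TV}$ the total variation. For a control policy $v\in \mathrm{BV}([0,T],[v_{\min},v_{\max}])$, let $\rho$ be the unique (Kruzhkov) entropy solution on $[0,T]\times[0,L]$, with values in $[0,\rho_{\max}]$, of $$\rho_t+f(\rho,v(t))_x=0,\qquad \rho(0,x)=\rho_0(x),\qquad f_l(t)=\mathrm{In}(t),\qquad f_r(t)=\rho(t,L)\,v(t),$$ where the left flow condition is understood equivalently as the boundary condition $\rho(t,0)=\mathrm{In}(t)/v(t)$, and $f_r$ is the flow at the right end $x=L$ (Neumann/free outflow condition). This solution satisfies $\rho\le\rho_{\mathrm{cr}}$. The outflow is $\mathrm{Out}(t)=\rho(t,L)\,v(t)$ (trace at $x=L$ from inside). With $t_0$ defined by $\int_0^{t_0}v(s)\,ds=L$ and, for $t\ge t_0$, $\tau(t)$ defined by $\int_{\tau(t)}^tv(s)\,ds=L$, the outflow is $\mathrm{Out}(t)=\mathrm{In}(\tau(t))\,v(t)/v(\tau(t))$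 for (almost every) $t\in[t_0,T]$. *)

theory Defs
  imports "HOL-Analysis.Analysis" "HOL-Probability.Essential_Supremum"
begin

text \<open>
  Functions of bounded variation are treated pointwise: the variation over \<open>[a, b]\<close> is the
  supremum over all finite nondecreasing sequences of points \<open>s 0, \<dots>, s n\<close> of \<open>[a, b]\<close>.
  A function's values outside \<open>[a, b]\<close> are irrelevant.
\<close>

definition total_variation :: "real \<Rightarrow> real \<Rightarrow> (real \<Rightarrow> real) \<Rightarrow> ennreal" where
  "total_variation a b g =
    (SUP (n, s) \<in> {(n :: nat, s). mono_on {..n} s \<and> s ` {..n} \<subseteq> {a..b}}.
       \<Sum>i<n. ennreal \<bar>g (s (Suc i)) - g (s i)\<bar>)"

definition BV :: "real \<Rightarrow> real \<Rightarrow> real set \<Rightarrow> (real \<Rightarrow> real) set" where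
  "BV a b E = {g. g ` {a..b} \<subseteq> E \<and> total_variation a b g < \<infinity>}"

text \<open>The flux is only meaningful for densities \<open>\<rho> \<in> [0, \<rho>max]\<close>.\<close>

definition flux :: "real \<Rightarrow> real \<Rightarrow> real \<Rightarrow> real \<Rightarrow> real" where
  "flux \<rho>cr \<rho>max \<rho> v =
    (if \<rho> \<le> \<rho>cr then \<rho> * v else v * \<rho>cr / (\<rho>max - \<rho>cr) * (\<rho>max - \<rho>))"

text \<open>
  Nonnegative \<open>C\<^sup>1\<close> functions \<open>\<phi>\<close> of \<open>(t, x)\<close> with compact support in \<open>U\<close>;
  \<open>\<phi>t\<close> and \<open>\<phi>x\<close> are the partial derivatives of \<open>\<phi>\<close>.
\<close>

definition test_function ::
  "(real \<times> real) set \<Rightarrow> (real \<times> real \<Rightarrow> real) \<Rightarrow> (real \<times> real \<Rightarrow> real) \<Rightarrow> (real \<times> real \<Rightarrow> real) \<Rightarrow> bool"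
where
  "test_function U \<phi> \<phi>t \<phi>x \<longleftrightarrow>
    (\<forall>p. 0 \<le> \<phi> p) \<and>
    (\<forall>p. (\<phi> has_derivative (\<lambda>(s, y). \<phi>t p * s + \<phi>x p * y)) (at p)) \<and>
    continuous_on UNIV \<phi>t \<and> continuous_on UNIV \<phi>x \<and>
    compact (closure {p. \<phi> p \<noteq> 0}) \<and> closure {p. \<phi> p \<noteq> 0} \<subseteq> U"

text \<open>
  Kruzhkov's entropy condition with the initial datum included. The support of a test function
  may extend to negative times, so that its restriction to \<open>[0, T] \<times> [0, L]\<close> ranges over
  \<open>C\<^sup>1\<close> functions with compact support in \<open>[0, T) \<times> (0, L)\<close>.
\<close>

definition kruzhkov_entropy_solution ::
  "real \<Rightarrow> real \<Rightarrow> real \<Rightarrow> real \<Rightarrow> (real \<Rightarrow> real) \<Rightarrow> (real \<Rightarrow> real) \<Rightarrow> (real \<times> real \<Rightarrow> real) \<Rightarrow> bool"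
where
  "kruzhkov_entropy_solution T L \<rho>cr \<rho>max \<rho>0 v \<rho> \<longleftrightarrow>
    set_borel_measurable borel ({0..T} \<times> {0..L}) \<rho> \<and>
    \<rho> ` ({0..T} \<times> {0..L}) \<subseteq> {0..\<rho>max} \<and>
    (\<forall>k\<in>{0..\<rho>max}. \<forall>\<phi> \<phi>t \<phi>x. test_function ({..<T} \<times> {0<..<L}) \<phi> \<phi>t \<phi>x \<longrightarrow>
      0 \<le> (LINT p : {0..T} \<times> {0..L} | lborel.
             \<bar>\<rho> p - k\<bar> * \<phi>t p +
             sgn (\<rho> p - k) * (flux \<rho>cr \<rho>max (\<rho> p) (v (fst p)) - flux \<rho>cr \<rho>max k (v (fst p))) * \<phi>x p) +
          (LINT x : {0..L} | lborel. \<bar>\<rho>0 x - k\<bar> * \<phi> (0, x)))"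

text \<open>
  Strong (\<open>L\<^sup>1\<close>) trace of \<open>\<rho>\<close> along the line \<open>x = x0\<close>, taken from inside \<open>[0, T] \<times> [0, L]\<close>.
  For \<open>x0 \<in> {0, L}\<close> and small \<open>\<epsilon>\<close> the strip has width \<open>\<epsilon>\<close>; averaging over it makes
  the notion independent of the representative of \<open>\<rho>\<close>.
\<close>

definition has_trace ::
  "real \<Rightarrow> real \<Rightarrow> (real \<times> real \<Rightarrow> real) \<Rightarrow> real \<Rightarrow> (real \<Rightarrow> real) \<Rightarrow> bool"
where
  "has_trace T L \<rho> x0 g \<longleftrightarrow>
    set_integrable lborel {0..T} g \<and>
    ((\<lambda>\<epsilon>. (LINT p : {0..T} \<times> ({0..L} \<inter> cball x0 \<epsilon>) | lborel. \<bar>\<rho> p - g (fst p)\<bar>) / \<epsilon>)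
       \<longlongrightarrow> 0) (at_right 0)"

text \<open>
  Entropy solution \<open>\<rho>\<close> of the initial-boundary value problem, with trace \<open>r\<close> at \<open>x = L\<close>.
  On the left, \<open>\<rho>(t, 0) = In(t) / v(t)\<close>. On the right, the flow \<open>flux (r t) (v t)\<close> through
  \<open>x = L\<close> has to equal \<open>r t * v t\<close>; this is a genuine condition, since the two differ for
  \<open>r t > \<rho>cr\<close>.
\<close>

definition traffic_solution ::
  "real \<Rightarrow> real \<Rightarrow> real \<Rightarrow> real \<Rightarrow> (real \<Rightarrow> real) \<Rightarrow> (real \<Rightarrow> real) \<Rightarrow> (real \<Rightarrow> real) \<Rightarrow>
   (real \<times> real \<Rightarrow> real) \<Rightarrow> (real \<Rightarrow> real) \<Rightarrow> bool"
where
  "traffic_solution T L \<rho>cr \<rho>max \<rho>0 In v \<rho> r \<longleftrightarrow>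
    kruzhkov_entropy_solution T L \<rho>cr \<rho>max \<rho>0 v \<rho> \<and>
    has_trace T L \<rho> 0 (\<lambda>t. In t / v t) \<and>
    has_trace T L \<rho> L r \<and>
    (AE t in lborel. t \<in> {0..T} \<longrightarrow> flux \<rho>cr \<rho>max (r t) (v t) = r t * v t)"

text \<open>The outflow is determined only almost everywhere on \<open>[0, T]\<close>; a representative is chosen.\<close>

definition outflow ::
  "real \<Rightarrow> real \<Rightarrow> real \<Rightarrow> real \<Rightarrow> (real \<Rightarrow> real) \<Rightarrow> (real \<Rightarrow> real) \<Rightarrow> (real \<Rightarrow> real) \<Rightarrow> real \<Rightarrow> real"
where
  "outflow T L \<rho>cr \<rho>max \<rho>0 In v =
    (SOME q. \<exists>\<rho> r. traffic_solution T L \<rho>cr \<rho>max \<rho>0 In v \<rho> r \<and> q = (\<lambda>t. r t * v t))"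

definition cost ::
  "real \<Rightarrow> real \<Rightarrow> real \<Rightarrow> real \<Rightarrow> (real \<Rightarrow> real) \<Rightarrow> (real \<Rightarrow> real) \<Rightarrow> (real \<Rightarrow> real) \<Rightarrow> (real \<Rightarrow> real) \<Rightarrow> real"
where
  "cost T L \<rho>cr \<rho>max \<rho>0 In fstar v =
    (LINT t : {0..T} | lborel. (outflow T L \<rho>cr \<rho>max \<rho>0 In v t - fstar t)\<^sup>2)"

definition Linf_norm :: "real \<Rightarrow> (real \<Rightarrow> real) \<Rightarrow> ereal" where
  "Linf_norm T v = esssup (restrict_space lborel {0..T}) (\<lambda>t. ereal \<bar>v t\<bar>)"

definition L1_norm :: "real \<Rightarrow> (real \<Rightarrow> real) \<Rightarrow> real" where
  "L1_norm T v = (LINT t : {0..T} | lborel. \<bar>v t\<bar>)"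

definition admissible_controls :: "real \<Rightarrow> real \<Rightarrow> real \<Rightarrow> real \<Rightarrow> real \<Rightarrow> (real \<Rightarrow> real) set" where
  "admissible_controls T vmin vmax K C =
    {v \<in> BV 0 T {vmin..vmax}. total_variation 0 T v \<le> ennreal K} \<inter> {v. Linf_norm T v \<le> ereal C}"

end

theory Submission
  imports Defs
begin

text \<open>
  Below the critical density the flux is \<open>\<rho> v\<close>, so the density is transported along the
  characteristics \<open>dx/dt = v(t)\<close>. With \<open>V(t) = \<integral>\<^sub>0\<^sup>t v\<close>, the characteristic through \<open>(t, x)\<close> crosses
  \<open>x = 0\<close> at the time \<open>entry t x\<close> that solves \<open>V(entry t x) = V(t) - x\<close>. The initial data are
  absorbed into the inflow: for negative times the speed is set to \<open>vmin\<close>, and an inflow is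
  prescribed that fills the road with \<open>\<rho>0\<close> by time \<open>0\<close>. The outflow is then
  \<open>Out(t) = In(\<tau>) v(t) / v(\<tau>)\<close> with \<open>\<tau> = entry t L\<close> for all \<open>t\<close> in \<open>[0, T]\<close>, without a
  distinction of cases at \<open>t\<^sub>0\<close>.

  Lipschitz continuity rests on three observations. Two speeds at \<open>L\<^sup>1\<close> distance \<open>D\<close> have
  travelled distances that differ by at most \<open>D\<close>, hence entry times that differ by at most
  \<open>2 D / vmin\<close> (\<open>entry_difference\<close>). A shift of the argument by at most \<open>d\<close> changes a function of
  variation \<open>K\<close> by at most \<open>2 d K\<close> in \<open>L\<^sup>1\<close> (\<open>variation_bound_shift_integral\<close>); this is where the
  bounds on the total variations of \<open>v\<close>, \<open>In\<close> and \<open>\<rho>0\<close> enter. And the map from exit times to entry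
  times distorts lengths by at most \<open>vmax / vmin\<close>, so that \<open>v - w\<close> at the entry times is controlled
  by \<open>D\<close> (\<open>entry_composition_integral\<close>).

  The outflow is defined by a choice among all entropy solutions. The formula therefore has to
  be justified twice. The transported density is an entropy solution with the prescribed traces
  (\<open>transported_traffic_solution\<close>). Conversely, all solutions have the same trace at \<open>x = L\<close>
  (\<open>outflow_unique\<close>). There, the excess \<open>(\<rho> - \<rho>cr)\<^sup>+\<close> of any solution travels to the left and is
  zero initially and on the right side, so it vanishes (\<open>free_flow\<close>). Hence the difference of two
  solutions solves the linear equation with zero initial and left boundary values, and it is
  tested with functions \<open>\<alpha>(t) \<beta>(x - V(t))\<close> whose support meets \<open>x = L\<close> only before a given time
  \<open>S\<close>: this leaves the integral of the difference of the outflows over \<open>[0, S]\<close>.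
\<close>

section \<open>Functions of bounded variation on the line\<close>

text \<open>The function \<open>W\<close> plays the part of the variation of \<open>g\<close> up to \<open>t\<close>. Having it on the whole line
  makes the notion stable under monotone substitutions, gluing and quotients.\<close>

definition variation_bound :: "real \<Rightarrow> (real \<Rightarrow> real) \<Rightarrow> bool" where
  "variation_bound K g \<longleftrightarrow>
    (\<exists>W. (\<forall>t. 0 \<le> W t \<and> W t \<le> K) \<and> (\<forall>s t. s \<le> t \<longrightarrow> \<bar>g t - g s\<bar> \<le> W t - W s))"

lemma variation_boundI:
  assumes "\<And>t. 0 \<le> W t" "\<And>t. W t \<le> K" "\<And>s t. s \<le> t \<Longrightarrow> \<bar>g t - g s\<bar> \<le> W t - W s"
  shows "variation_bound K g"
  using assms unfolding variation_bound_def by blast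

lemma variation_bound_dominator:
  assumes "variation_bound K g"
  shows "\<exists>W. (\<forall>t. 0 \<le> W t) \<and> (\<forall>t. W t \<le> K) \<and> (\<forall>s t. s \<le> t \<longrightarrow> \<bar>g t - g s\<bar> \<le> W t - W s) \<and> mono W"
proof -
  obtain W where W: "\<forall>t. 0 \<le> W t \<and> W t \<le> K" "\<forall>s t. s \<le> t \<longrightarrow> \<bar>g t - g s\<bar> \<le> W t - W s"
    using assms unfolding variation_bound_def by blast
  have "W s \<le> W t" if "s \<le> t" for s t
    using W(2) that abs_ge_zero[of "g t - g s"] by (meson diff_ge_0_iff_ge order_trans)
  then have "mono W" by (rule monoI)
  with W show ?thesis by blast
qed

lemma variation_bound_nonneg: "variation_bound K g \<Longrightarrow> 0 \<le> K"
  unfolding variation_bound_def by (meson order_trans)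

text \<open>A sequence of points is continued by the two points \<open>s\<close> and \<open>t\<close>: its last point may lie
  before \<open>s\<close>.\<close>

lemma total_variation_append:
  assumes "a \<le> s" "s \<le> t"
  shows "total_variation a s g + ennreal \<bar>g t - g s\<bar> \<le> total_variation a t g"
proof -
  let ?P = "\<lambda>b. {(n :: nat, \<sigma> :: nat \<Rightarrow> real). mono_on {..n} \<sigma> \<and> \<sigma> ` {..n} \<subseteq> {a..b}}"
  let ?S = "\<lambda>(n :: nat, \<sigma>). \<Sum>i<n. ennreal \<bar>g (\<sigma> (Suc i)) - g (\<sigma> i)\<bar>"
  have "?S p + ennreal \<bar>g t - g s\<bar> \<le> total_variation a t g" if p: "p \<in> ?P s" for p
  proof -
    obtain n \<sigma> where [simp]: "p = (n, \<sigma>)" by (cases p)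
    have m: "mono_on {..n} \<sigma>" and r: "\<sigma> ` {..n} \<subseteq> {a..s}" using p by auto
    define \<sigma>' where "\<sigma>' i = (if i \<le> n then \<sigma> i else if i = Suc n then s else t)" for i
    have \<sigma>n: "\<sigma> i \<le> s" "a \<le> \<sigma> i" if "i \<le> n" for i using r that by auto
    have "mono_on {..Suc (Suc n)} \<sigma>'"
    proof (rule mono_onI)
      fix i j assume "i \<in> {..Suc (Suc n)}" "j \<in> {..Suc (Suc n)}" "i \<le> j"
      then show "\<sigma>' i \<le> \<sigma>' j"
        using mono_onD[OF m, of i j] \<sigma>n(1)[of i] assms(2) by (auto simp: \<sigma>'_def)
    qed
    moreover have "\<sigma>' ` {..Suc (Suc n)} \<subseteq> {a..t}"
    proof -
      have "a \<le> \<sigma>' i \<and> \<sigma>' i \<le> t" for i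
        using \<sigma>n[of i] assms by (auto simp: \<sigma>'_def)
      then show ?thesis by auto
    qed
    ultimately have "?S (Suc (Suc n), \<sigma>') \<le> total_variation a t g"
      unfolding total_variation_def by (intro SUP_upper) auto
    moreover have "?S p \<le> (\<Sum>i<Suc n. ennreal \<bar>g (\<sigma>' (Suc i)) - g (\<sigma>' i)\<bar>)"
    proof -
      have "?S p = (\<Sum>i<n. ennreal \<bar>g (\<sigma>' (Suc i)) - g (\<sigma>' i)\<bar>)"
        by (auto simp: \<sigma>'_def intro!: sum.cong)
      then show ?thesis by simp
    qed
    moreover have "?S (Suc (Suc n), \<sigma>') =
        (\<Sum>i<Suc n. ennreal \<bar>g (\<sigma>' (Suc i)) - g (\<sigma>' i)\<bar>) + ennreal \<bar>g t - g s\<bar>"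
      by (simp add: \<sigma>'_def)
    ultimately show ?thesis
      by (metis (no_types, lifting) add_right_mono order_trans)
  qed
  moreover have "(0, \<lambda>_. a) \<in> ?P s" using assms by (auto simp: mono_on_def)
  ultimately have "(SUP p\<in>?P s. ?S p + ennreal \<bar>g t - g s\<bar>) \<le> total_variation a t g" "?P s \<noteq> {}"
    by (blast intro: SUP_least, blast)
  then show ?thesis
    unfolding total_variation_def by (subst (asm) ennreal_SUP_add_left) auto
qed

text \<open>The variation up to \<open>t\<close> dominates the increments. Clipping the argument makes the extension
  constant on both sides of the interval.\<close>

lemma variation_bound_clip:
  assumes "a \<le> b" and fin: "total_variation a b g \<le> ennreal K" and "0 \<le> K"
  shows "variation_bound K (\<lambda>t. g (max a (min b t)))"
proof -
  define c where "c t = max a (min b t)" for t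
  have c: "a \<le> c t" "c t \<le> b" for t using assms(1) by (auto simp: c_def)
  have cm: "c s \<le> c t" if "s \<le> t" for s t using that by (auto simp: c_def)
  have up: "total_variation a (c t) g \<le> ennreal K" for t
    using total_variation_append[OF c(1)[of t] c(2)[of t], where g=g] fin
    by (meson order_trans le_iff_add add_increasing2 order_refl zero_le)
  then have lt: "total_variation a (c t) g < \<infinity>" for t
    by (metis ennreal_less_top infinity_ennreal_def le_less_trans)
  define W where "W t = enn2real (total_variation a (c t) g)" for t
  have W: "ennreal (W t) = total_variation a (c t) g" for t
    using lt[of t] by (simp add: W_def)
  have W0: "0 \<le> W t" for t by (simp add: W_def)
  show ?thesis
  proof (rule variation_boundI[of W])
    show "0 \<le> W t" for t by (rule W0)
    show "W t \<le> K" for t using up[of t] \<open>0 \<le> K\<close> unfolding W[symmetric] by simp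
    fix s t :: real assume "s \<le> t"
    from total_variation_append[OF c(1)[of s] cm[OF this], where g=g]
    have "ennreal (W s + \<bar>g (c t) - g (c s)\<bar>) \<le> ennreal (W t)"
      unfolding W[symmetric] using W0 by simp
    then have "W s + \<bar>g (c t) - g (c s)\<bar> \<le> W t" using W0 by (subst (asm) ennreal_le_iff) auto
    then show "\<bar>g (max a (min b t)) - g (max a (min b s))\<bar> \<le> W t - W s" by (simp add: c_def)
  qed
qed

lemma variation_bound_compose:
  assumes "variation_bound K g" "mono m \<or> antimono m"
  shows "variation_bound K (g \<circ> m)"
proof -
  obtain W where W: "\<And>t. 0 \<le> W t" "\<And>t. W t \<le> K"
    "\<And>s t. s \<le> t \<Longrightarrow> \<bar>g t - g s\<bar> \<le> W t - W s" "mono W"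
    using variation_bound_dominator[OF assms(1)] by blast
  from assms(2) show ?thesis
  proof
    assume "mono m"
    then show ?thesis
      by (intro variation_boundI[of "W \<circ> m"]) (auto simp: W(1,2) intro: W(3) dest: monoD)
  next
    assume m: "antimono m"
    have "\<bar>g (m t) - g (m s)\<bar> \<le> W (m s) - W (m t)" if "s \<le> t" for s t
      using W(3)[OF antimonoD[OF m that]] by (simp add: abs_minus_commute)
    then show ?thesis
      by (intro variation_boundI[of "\<lambda>t. K - W (m t)"]) (auto simp: W(1,2))
  qed
qed

text \<open>The constant \<open>B\<close> pays for the jump at \<open>c\<close>.\<close>

lemma variation_bound_glue:
  assumes "variation_bound K g" "variation_bound K' g'" and B: "\<And>s t. \<bar>g' t - g s\<bar> \<le> B"
  shows "variation_bound (K + K' + B) (\<lambda>t. if t < c then g t else g' t)"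
proof -
  obtain W where W: "\<And>t. 0 \<le> W t" "\<And>t. W t \<le> K"
    "\<And>s t. s \<le> t \<Longrightarrow> \<bar>g t - g s\<bar> \<le> W t - W s" "mono W"
    using variation_bound_dominator[OF assms(1)] by blast
  obtain W' where W': "\<And>t. 0 \<le> W' t" "\<And>t. W' t \<le> K'"
    "\<And>s t. s \<le> t \<Longrightarrow> \<bar>g' t - g' s\<bar> \<le> W' t - W' s" "mono W'"
    using variation_bound_dominator[OF assms(2)] by blast
  have B0: "0 \<le> B" using B[of 0 0] by linarith
  show ?thesis
  proof (rule variation_boundI[of "\<lambda>t. W t + W' t + (if t < c then 0 else B)"])
    show "0 \<le> W t + W' t + (if t < c then 0 else B)" for t using W(1)[of t] W'(1)[of t] B0 by auto
    show "W t + W' t + (if t < c then 0 else B) \<le> K + K' + B" for t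
      using W(2)[of t] W'(2)[of t] B0 by auto
    fix s t :: real assume st: "s \<le> t"
    then show "\<bar>(if t < c then g t else g' t) - (if s < c then g s else g' s)\<bar>
      \<le> (W t + W' t + (if t < c then 0 else B)) - (W s + W' s + (if s < c then 0 else B))"
      using W(3)[OF st] W'(3)[OF st] monoD[OF W(4) st] monoD[OF W'(4) st] B[of t s] by auto
  qed
qed

lemma variation_bound_const: "variation_bound 0 (\<lambda>_. c)"
  by (rule variation_boundI[of "\<lambda>_. 0"]) auto

lemma variation_bound_mult_const:
  assumes "variation_bound K g" shows "variation_bound (\<bar>c\<bar> * K) (\<lambda>t. g t * c)"
proof -
  obtain W where W: "\<And>t. 0 \<le> W t" "\<And>t. W t \<le> K"
    "\<And>s t. s \<le> t \<Longrightarrow> \<bar>g t - g s\<bar> \<le> W t - W s" "mono W"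
    using variation_bound_dominator[OF assms] by blast
  have "\<bar>g t * c - g s * c\<bar> \<le> \<bar>c\<bar> * W t - \<bar>c\<bar> * W s" if "s \<le> t" for s t
    using mult_left_mono[OF W(3)[OF that] abs_ge_zero[of c]]
    by (simp add: abs_mult[symmetric] algebra_simps)
  then show ?thesis
    by (intro variation_boundI[of "\<lambda>t. \<bar>c\<bar> * W t"]) (auto simp: W(1,2) intro: mult_left_mono)
qed

lemma abs_quotient_diff_le:
  fixes a b c d :: real
  assumes "0 < m" "m \<le> b" "m \<le> d" "\<bar>c\<bar> \<le> B"
  shows "\<bar>a / b - c / d\<bar> \<le> \<bar>a - c\<bar> / m + B / m\<^sup>2 * \<bar>b - d\<bar>"
proof -
  have "a / b - c / d = (a - c) / b + c * (d - b) / (b * d)"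
    using assms by (simp add: field_simps)
  also have "\<bar>\<dots>\<bar> \<le> \<bar>(a - c) / b\<bar> + \<bar>c * (d - b) / (b * d)\<bar>" by (rule abs_triangle_ineq)
  also have "\<bar>(a - c) / b\<bar> \<le> \<bar>a - c\<bar> / m"
    using assms by (simp add: abs_divide frac_le)
  also have "\<bar>c * (d - b) / (b * d)\<bar> \<le> B * \<bar>b - d\<bar> / (m * m)"
    unfolding abs_divide abs_mult using assms
    by (intro frac_le mult_mono) (auto simp: abs_minus_commute)
  finally show ?thesis by (simp add: power2_eq_square)
qed

lemma variation_bound_divide:
  assumes "variation_bound K g" "variation_bound K' w" "0 < m" "\<And>t. m \<le> w t" "\<And>t. \<bar>g t\<bar> \<le> B"
  shows "variation_bound (K / m + B / m\<^sup>2 * K') (\<lambda>t. g t / w t)"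
proof -
  obtain W where W: "\<And>t. 0 \<le> W t" "\<And>t. W t \<le> K"
    "\<And>s t. s \<le> t \<Longrightarrow> \<bar>g t - g s\<bar> \<le> W t - W s" "mono W"
    using variation_bound_dominator[OF assms(1)] by blast
  obtain W' where W': "\<And>t. 0 \<le> W' t" "\<And>t. W' t \<le> K'"
    "\<And>s t. s \<le> t \<Longrightarrow> \<bar>w t - w s\<bar> \<le> W' t - W' s" "mono W'"
    using variation_bound_dominator[OF assms(2)] by blast
  have B0: "0 \<le> B" using assms(5)[of 0] by linarith
  have Bm: "0 \<le> B / m\<^sup>2" using B0 by simp
  show ?thesis
  proof (rule variation_boundI[of "\<lambda>t. W t / m + B / m\<^sup>2 * W' t"])
    show "0 \<le> W t / m + B / m\<^sup>2 * W' t" for t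
      using W(1)[of t] mult_nonneg_nonneg[OF Bm W'(1)[of t]] assms(3)
      by (intro add_nonneg_nonneg divide_nonneg_pos) auto
    show "W t / m + B / m\<^sup>2 * W' t \<le> K / m + B / m\<^sup>2 * K'" for t
      using W(2)[of t] mult_left_mono[OF W'(2)[of t] Bm] assms(3)
      by (intro add_mono divide_right_mono) auto
    fix s t :: real assume "s \<le> t"
    note W(3)[OF this] and W'(3)[OF this]
    then have "\<bar>g t - g s\<bar> / m + B / m\<^sup>2 * \<bar>w t - w s\<bar> \<le> (W t - W s) / m + B / m\<^sup>2 * (W' t - W' s)"
      using Bm assms(3) by (intro add_mono divide_right_mono mult_left_mono) auto
    also have "\<dots> = (W t / m + B / m\<^sup>2 * W' t) - (W s / m + B / m\<^sup>2 * W' s)"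
      by (simp add: algebra_simps diff_divide_distrib)
    finally show "\<bar>g t / w t - g s / w s\<bar> \<le> \<dots>"
      using abs_quotient_diff_le[OF assms(3), of "w t" "w s" "g s" B "g t"] assms(4,5) by (auto intro: order_trans)
  qed
qed

lemma variation_bound_borel_measurable:
  assumes "variation_bound K g" shows "g \<in> borel_measurable borel"
proof -
  obtain W where W: "\<And>t. 0 \<le> W t" "\<And>t. W t \<le> K"
    "\<And>s t. s \<le> t \<Longrightarrow> \<bar>g t - g s\<bar> \<le> W t - W s" "mono W"
    using variation_bound_dominator[OF assms] by blast
  have "mono (\<lambda>t. W t + g t)"
    by (rule monoI) (use W(3) in \<open>smt (verit)\<close>)
  then have "(\<lambda>t. (W t + g t) - W t) \<in> borel_measurable borel"
    using W(4) by (intro borel_measurable_diff borel_measurable_mono)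
  then show ?thesis by simp
qed

text \<open>Where the monotone function \<open>W\<close> is continuous, so is \<open>g\<close>; and \<open>W\<close> has countably many jumps.\<close>

lemma variation_bound_countable_discont:
  assumes "variation_bound K g" shows "countable {t. \<not> isCont g t}"
proof -
  obtain W where W: "\<And>t. 0 \<le> W t" "\<And>t. W t \<le> K"
    "\<And>s t. s \<le> t \<Longrightarrow> \<bar>g t - g s\<bar> \<le> W t - W s" "mono W"
    using variation_bound_dominator[OF assms] by blast
  have "isCont g t" if "isCont W t" for t
  proof -
    have "((\<lambda>s. \<bar>W s - W t\<bar>) \<longlongrightarrow> 0) (at t)"
      using that unfolding isCont_def by (intro tendsto_rabs_zero) (simp add: LIM_zero)
    moreover have "norm (g s - g t) \<le> \<bar>W s - W t\<bar>" for s
      using W(3)[of s t] W(3)[of t s] by (cases "s \<le> t") auto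
    ultimately have "((\<lambda>s. g s - g t) \<longlongrightarrow> 0) (at t)"
      by - (rule Lim_null_comparison[where g="\<lambda>s. \<bar>W s - W t\<bar>", OF always_eventually], auto)
    then show ?thesis unfolding isCont_def by (rule LIM_zero_cancel)
  qed
  then have "{t. \<not> isCont g t} \<subseteq> {t. \<not> isCont W t}" by auto
  then show ?thesis using mono_ctble_discont[OF W(4)] countable_subset by blast
qed

lemma AE_not_in_countable:
  fixes E :: "real set" assumes "countable E" shows "AE t in lborel. t \<notin> E"
  using assms by (intro AE_not_in countable_imp_null_set_lborel)

lemma set_integral_mult_limit:
  fixes e :: "'a :: euclidean_space \<Rightarrow> real"
  assumes e: "set_integrable lborel S e"
    and c: "\<And>n. c n \<in> borel_measurable borel" "d \<in> borel_measurable borel" "\<And>n x. \<bar>c n x\<bar> \<le> 1"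
    and lim: "AE x in lborel. x \<in> S \<longrightarrow> (\<lambda>n. c n x) \<longlonglongrightarrow> d x"
  shows "(\<lambda>n. LBINT x:S. e x * c n x) \<longlonglongrightarrow> (LBINT x:S. e x * d x)"
  unfolding set_lebesgue_integral_def
proof (rule integral_dominated_convergence[where w="\<lambda>x. \<bar>indicator S x *\<^sub>R e x\<bar>"])
  have int: "integrable lborel (\<lambda>x. indicator S x *\<^sub>R e x)" using e unfolding set_integrable_def .
  then show "integrable lborel (\<lambda>x. \<bar>indicator S x *\<^sub>R e x\<bar>)" by (rule integrable_abs)
  have "(\<lambda>x. (indicator S x *\<^sub>R e x) * g x) \<in> borel_measurable lborel" if "g \<in> borel_measurable borel" for g
    using borel_measurable_integrable[OF int] that by (intro borel_measurable_times) simp_all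
  then show "(\<lambda>x. indicator S x *\<^sub>R (e x * d x)) \<in> borel_measurable lborel"
    "(\<lambda>x. indicator S x *\<^sub>R (e x * c n x)) \<in> borel_measurable lborel" for n
    using c(1,2) by (simp_all add: mult.assoc)
  show "AE x in lborel. norm (indicator S x *\<^sub>R (e x * c n x)) \<le> \<bar>indicator S x *\<^sub>R e x\<bar>" for n
    using mult_left_mono[OF c(3) abs_ge_zero] by (intro AE_I2) (auto simp: indicator_def abs_mult)
  show "AE x in lborel. (\<lambda>n. indicator S x *\<^sub>R (e x * c n x)) \<longlonglongrightarrow> indicator S x *\<^sub>R (e x * d x)"
    using lim by eventually_elim (auto simp: indicator_def intro: tendsto_mult_left)
qed

lemma bounded_set_integrable_Icc:
  fixes g :: "real \<Rightarrow> real"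
  assumes [measurable]: "g \<in> borel_measurable borel" and "\<And>t. t \<in> {a..b} \<Longrightarrow> \<bar>g t\<bar> \<le> B"
  shows "set_integrable lborel {a..b} g"
proof (rule set_integrable_bound)
  show "set_integrable lborel {a..b} (\<lambda>_. B)"
    by (rule borel_integrable_atLeastAtMost') (rule continuous_on_const)
  show "set_borel_measurable lborel {a..b} g" unfolding set_borel_measurable_def by measurable
  show "AE t in lborel. t \<in> {a..b} \<longrightarrow> norm (g t) \<le> norm B"
    using assms(2) by (intro AE_I2 impI) (metis abs_ge_self order_trans real_norm_def)
qed

lemma set_integrable_Icc_const: "set_integrable lborel {a..b :: real} (\<lambda>_. c :: real)"
  by (rule borel_integrable_atLeastAtMost') (rule continuous_on_const)

lemma set_integral_Icc_split:
  fixes f :: "real \<Rightarrow> real"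
  assumes "set_integrable lborel {a..c} f" "a \<le> b" "b \<le> c"
  shows "(LBINT t:{a..c}. f t) = (LBINT t:{a..b}. f t) + (LBINT t:{b..c}. f t)"
proof -
  have 1: "set_integrable lborel {a..b} f" "set_integrable lborel {b..c} f"
    by (rule set_integrable_subset[OF assms(1)]; use assms in simp)+
  have 2: "AE t in lborel. \<not> (t \<in> {a..b} \<and> t \<in> {b..c})"
    using AE_not_in_countable[of "{b}", simplified] by eventually_elim auto
  have "{a..c} = {a..b} \<union> {b..c}" using assms by auto
  then show ?thesis
    using set_integral_Un_AE[OF 2 _ _ 1] by simp
qed

lemma set_integral_translate_Icc:
  fixes f :: "real \<Rightarrow> real"
  shows "(LBINT t:{a..b}. f (t + d)) = (LBINT t:{a+d..b+d}. f t)"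
proof -
  have "(LBINT t:{a+d..b+d}. f t) = (LBINT t. indicator {a+d..b+d} (d + 1 * t) *\<^sub>R f (d + 1 * t))"
    unfolding set_lebesgue_integral_def
    using lborel_integral_real_affine[of 1 "\<lambda>t. indicator {a+d..b+d} t *\<^sub>R f t" d] by simp
  also have "\<dots> = (LBINT t:{a..b}. f (t + d))"
    unfolding set_lebesgue_integral_def
    by (intro Bochner_Integration.integral_cong) (auto simp: indicator_def add.commute)
  finally show ?thesis by simp
qed

lemma set_integral_Icc_const:
  "a \<le> b \<Longrightarrow> (LBINT t:{a..b}. (c::real)) = c * (b - a)"
  by (subst set_integral_const) (auto simp: mult.commute)

lemma set_integral_Icc_le_const:
  assumes "a \<le> b" "\<And>t. t \<in> {a..b} \<Longrightarrow> f t \<le> c" "0 \<le> (c::real)"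
  shows "(LBINT t:{a..b}. f t) \<le> c * (b - a)"
proof -
  have "(LBINT t:{a..b}. f t) \<le> (LBINT t:{a..b}. c)"
    unfolding set_lebesgue_integral_def
    by (rule integral_mono') (use assms bounded_set_integrable_Icc[of "\<lambda>_. c" a b c] in
        \<open>auto simp: set_integrable_def indicator_def\<close>)
  then show ?thesis using assms by (simp add: set_integral_Icc_const)
qed

lemma set_integral_Icc_abs_le_const:
  fixes f :: "real \<Rightarrow> real"
  assumes "a \<le> b" "\<And>t. t \<in> {a..b} \<Longrightarrow> \<bar>f t\<bar> \<le> c" "0 \<le> (c::real)"
  shows "\<bar>LBINT t:{a..b}. f t\<bar> \<le> c * (b - a)"
proof -
  have "\<bar>LBINT t:{a..b}. f t\<bar> \<le> (LBINT t. \<bar>indicator {a..b} t *\<^sub>R f t\<bar>)"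
    unfolding set_lebesgue_integral_def by (rule integral_abs_bound)
  also have "\<dots> = (LBINT t:{a..b}. \<bar>f t\<bar>)"
    unfolding set_lebesgue_integral_def by (simp add: abs_mult)
  finally show ?thesis using set_integral_Icc_le_const[of a b "\<lambda>t. \<bar>f t\<bar>" c] assms by simp
qed

text \<open>The integrand is at most \<open>W (t + d) - W (t - d)\<close>. Its integral telescopes to integrals of
  \<open>W\<close> over intervals of length \<open>2 d\<close> at the two ends.\<close>

lemma variation_bound_shift_integral:
  assumes g: "variation_bound K g" and ab: "a \<le> b" and d: "0 \<le> d"
    and \<alpha>: "\<And>t. t \<in> {a..b} \<Longrightarrow> \<bar>\<alpha> t - t\<bar> \<le> d"
  shows "(LBINT t:{a..b}. \<bar>g (\<alpha> t) - g t\<bar>) \<le> 2 * d * K"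
proof -
  obtain W where W: "\<And>t. 0 \<le> W t" "\<And>t. W t \<le> K"
    "\<And>s t. s \<le> t \<Longrightarrow> \<bar>g t - g s\<bar> \<le> W t - W s" "mono W"
    using variation_bound_dominator[OF g] by blast
  have [measurable]: "W \<in> borel_measurable borel" by (rule borel_measurable_mono[OF W(4)])
  have K: "0 \<le> K" using g by (rule variation_bound_nonneg)
  have Wabs: "\<bar>W t\<bar> \<le> K" for t using W(1,2)[of t] by simp
  have int: "set_integrable lborel {x..y} W" "set_integrable lborel {x..y} (\<lambda>t. W (t + e))" for x y e
    by (rule bounded_set_integrable_Icc[where B=K]; use Wabs in measurable)+
  have "\<bar>g (\<alpha> t) - g t\<bar> \<le> W (t + d) - W (t + - d)" if "t \<in> {a..b}" for t
  proof (cases "\<alpha> t \<le> t")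
    case True
    then have "W (t + - d) \<le> W (\<alpha> t)" "W t \<le> W (t + d)"
      using \<alpha>[OF that] d by (auto intro!: monoD[OF W(4)])
    then show ?thesis using W(3)[OF True] by (simp add: abs_minus_commute)
  next
    case False
    then have "W (\<alpha> t) \<le> W (t + d)" "W (t + - d) \<le> W t"
      using \<alpha>[OF that] d by (auto intro!: monoD[OF W(4)])
    then show ?thesis using W(3)[of t "\<alpha> t"] False by simp
  qed
  then have "(LBINT t:{a..b}. \<bar>g (\<alpha> t) - g t\<bar>) \<le> (LBINT t:{a..b}. W (t + d) - W (t + - d))"
    unfolding set_lebesgue_integral_def using set_integral_diff(1)[OF int(2) int(2), of a b d "- d"] d
    by (intro integral_mono') (auto simp: set_integrable_def indicator_def intro!: monoD[OF W(4)])
  also have "\<dots> = (LBINT t:{a+d..b+d}. W t) - (LBINT t:{a + - d..b + - d}. W t)"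
    by (subst set_integral_diff(2)[OF int(2) int(2)]) (simp only: set_integral_translate_Icc)
  also have "\<dots> = (LBINT t:{b + - d..b+d}. W t) - (LBINT t:{a + - d..a+d}. W t)"
    using set_integral_Icc_split[OF int(1), of "a + - d" "a + d" "b + d"]
      set_integral_Icc_split[OF int(1), of "a + - d" "b + - d" "b + d"] ab d by simp
  also have "\<dots> \<le> K * (2 * d) - 0"
  proof (rule diff_mono)
    show "(LBINT t:{b + - d..b+d}. W t) \<le> K * (2 * d)"
      using set_integral_Icc_le_const[of "b + - d" "b + d" W K] W(1,2) K d by auto
    show "0 \<le> (LBINT t:{a + - d..a+d}. W t)"
      unfolding set_lebesgue_integral_def by (intro Bochner_Integration.integral_nonneg) (auto simp: W(1))
  qed
  finally show ?thesis by (simp add: mult_ac)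
qed

text \<open>The difference quotients of \<open>f\<close> converge to \<open>f'\<close> boundedly off \<open>E\<close>, and their integrals
  telescope to two averages of \<open>f\<close> over short intervals. Countable exceptional sets have to be
  admitted because \<open>f\<close> will be built from primitives of functions of bounded variation.\<close>

lemma set_integral_derivative_Lipschitz:
  fixes f :: "real \<Rightarrow> real"
  assumes Lip: "\<And>s t. \<bar>f s - f t\<bar> \<le> C * \<bar>s - t\<bar>"
    and E: "countable E" and der: "\<And>t. t \<notin> E \<Longrightarrow> (f has_real_derivative f' t) (at t)"
    and [measurable]: "f' \<in> borel_measurable borel" and ab: "a \<le> b"
  shows "(LBINT t:{a..b}. f' t) = f b - f a"
proof -
  have cont: "continuous_on UNIV f"
  proof (rule continuous_at_imp_continuous_on, safe)
    fix t
    have "((\<lambda>s. C * \<bar>s - t\<bar>) \<longlongrightarrow> C * \<bar>t - t\<bar>) (at t)" by (intro tendsto_intros)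
    then have "((\<lambda>s. f s - f t) \<longlongrightarrow> 0) (at t)"
      using Lip by - (rule Lim_null_comparison[where g="\<lambda>s. C * \<bar>s - t\<bar>", OF always_eventually], auto)
    then show "isCont f t" unfolding isCont_def by (rule LIM_zero_cancel)
  qed
  then have [measurable]: "f \<in> borel_measurable borel" by (rule borel_measurable_continuous_onI)
  have int: "set_integrable lborel {x..y} f" for x y
    by (rule borel_integrable_atLeastAtMost') (use cont continuous_on_subset in blast)
  have int': "set_integrable lborel {x..y} (\<lambda>t. f (t + e))" for x y e
    by (rule borel_integrable_atLeastAtMost') (intro continuous_intros continuous_on_compose2[OF cont]; auto)
  define e where "e n = 1 / real (Suc n)" for n
  have e: "0 < e n" for n by (simp add: e_def)
  have e0: "e \<longlonglongrightarrow> 0" unfolding e_def by (rule LIMSEQ_Suc[OF lim_1_over_n])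
  have at0: "filterlim e (at 0) sequentially"
    using e0 e by (auto simp: filterlim_at intro!: always_eventually less_imp_neq[symmetric])
  define q where "q n t = (f (t + e n) - f t) / e n" for n t
  have avg: "(\<lambda>n. (LBINT t:{x..x + e n}. f t) / e n) \<longlonglongrightarrow> f x" for x
  proof -
    have "\<bar>(LBINT t:{x..x + e n}. f t) / e n - f x\<bar> \<le> C * e n" for n
    proof -
      have "(LBINT t:{x..x + e n}. f t) - f x * e n = (LBINT t:{x..x + e n}. f t - f x)"
        using e[of n] by (subst set_integral_diff(2)) (auto simp: int set_integral_Icc_const intro: bounded_set_integrable_Icc[where B="\<bar>f x\<bar>"])
      moreover have "\<bar>LBINT t:{x..x + e n}. f t - f x\<bar> \<le> C * e n * e n"
      proof -
        have C0: "0 \<le> C" using Lip[of 1 0] by simp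
        have bd: "\<bar>f t - f x\<bar> \<le> C * e n" if "t \<in> {x..x + e n}" for t
          using order_trans[OF Lip[of t x] mult_left_mono[OF _ C0, of "\<bar>t - x\<bar>" "e n"]] that by auto
        then have "\<bar>LBINT t:{x..x + e n}. f t - f x\<bar> \<le> C * e n * (x + e n - x)"
          using e[of n] C0 by (intro set_integral_Icc_abs_le_const) auto
        then show ?thesis by simp
      qed
      moreover have "(LBINT t:{x..x + e n}. f t) / e n - f x = ((LBINT t:{x..x + e n}. f t) - f x * e n) / e n"
        using e[of n] by (simp add: field_simps)
      ultimately show ?thesis using e[of n] by (simp add: abs_divide divide_le_eq)
    qed
    moreover have "(\<lambda>n. C * e n) \<longlonglongrightarrow> 0" using tendsto_mult_left[OF e0, of C] by simp
    ultimately have "(\<lambda>n. (LBINT t:{x..x + e n}. f t) / e n - f x) \<longlonglongrightarrow> 0"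
      by - (rule Lim_null_comparison[where g="\<lambda>n. C * e n", OF always_eventually], auto)
    then show ?thesis by (rule LIM_zero_cancel)
  qed
  have tele: "(LBINT t:{a..b}. q n t)
      = (LBINT t:{b..b + e n}. f t) / e n - (LBINT t:{a..a + e n}. f t) / e n" for n
  proof -
    have "(LBINT t:{a..b}. q n t) = (LBINT t:{a..b}. f (t + e n) - f t) / e n"
      unfolding q_def by simp
    also have "(LBINT t:{a..b}. f (t + e n) - f t)
        = (LBINT t:{a + e n..b + e n}. f t) - (LBINT t:{a..b}. f t)"
      by (subst set_integral_diff(2)[OF int' int]) (simp only: set_integral_translate_Icc)
    also have "\<dots> = (LBINT t:{b..b + e n}. f t) - (LBINT t:{a..a + e n}. f t)"
      using set_integral_Icc_split[OF int, of a "a + e n" "b + e n"]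
        set_integral_Icc_split[OF int, of a b "b + e n"] ab e[of n] by simp
    finally show ?thesis by (simp add: diff_divide_distrib)
  qed
  have "(\<lambda>n. LBINT t:{a..b}. q n t) \<longlonglongrightarrow> (LBINT t:{a..b}. f' t)"
    unfolding set_lebesgue_integral_def
  proof (rule integral_dominated_convergence[where w="\<lambda>t. indicator {a..b} t * C"])
    show "integrable lborel (\<lambda>t. indicator {a..b} t * C)"
      using bounded_set_integrable_Icc[of "\<lambda>_. C" a b "\<bar>C\<bar>"] by (simp add: set_integrable_def)
    show "AE t in lborel. norm (indicator {a..b} t *\<^sub>R q n t) \<le> indicator {a..b} t * C" for n
      using Lip e[of n] by (auto simp: indicator_def q_def abs_divide divide_le_eq intro!: AE_I2 order_trans[OF Lip])
    show "AE t in lborel. (\<lambda>n. indicator {a..b} t *\<^sub>R q n t) \<longlonglongrightarrow> indicator {a..b} t *\<^sub>R f' t"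
      using AE_not_in_countable[OF E]
    proof eventually_elim
      fix t assume "t \<notin> E"
      have "(\<lambda>n. (f (t + e n) - f t) / e n) \<longlonglongrightarrow> f' t"
        using DERIV_D[OF der[OF \<open>t \<notin> E\<close>]] at0 by (rule filterlim_compose)
      then show "(\<lambda>n. indicator {a..b} t *\<^sub>R q n t) \<longlonglongrightarrow> indicator {a..b} t *\<^sub>R f' t"
        unfolding q_def by (intro tendsto_intros)
    qed
  qed (unfold q_def, measurable)
  moreover have "(\<lambda>n. LBINT t:{a..b}. q n t) \<longlonglongrightarrow> f b - f a"
    unfolding tele by (intro tendsto_intros avg)
  ultimately show ?thesis by (rule LIMSEQ_unique)
qed

section \<open>Characteristics\<close>

locale bv_speed =
  fixes v :: "real \<Rightarrow> real" and vmin vmax K :: real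
  assumes vmin_pos: "0 < vmin" and v_ge: "\<And>t. vmin \<le> v t" and v_le: "\<And>t. v t \<le> vmax"
    and v_var: "variation_bound K v"
begin

definition V :: "real \<Rightarrow> real" where
  "V t = (if 0 \<le> t then LBINT s:{0..t}. v s else - (LBINT s:{t..0}. v s))"

text \<open>The time at which the characteristic through \<open>(t, x)\<close> crosses \<open>x = 0\<close>.\<close>

definition entry :: "real \<Rightarrow> real \<Rightarrow> real" where
  "entry t x = (THE s. V s = V t - x)"

lemma v_measurable [measurable]: "v \<in> borel_measurable borel"
  using v_var by (rule variation_bound_borel_measurable)

lemma v_pos: "0 < v t"
  using v_ge[of t] vmin_pos by simp

lemma v_abs_le: "\<bar>v t\<bar> \<le> vmax"
  using v_le[of t] v_pos[of t] by simp

lemma vmax_pos: "0 < vmax"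
  using v_pos[of 0] v_le[of 0] by simp

lemma v_integrable: "set_integrable lborel {a..b} v"
  by (rule bounded_set_integrable_Icc[where B=vmax]) (use v_abs_le in auto)

lemma V_0: "V 0 = 0"
proof -
  have "\<bar>LBINT s:{0..0}. v s\<bar> \<le> vmax * (0 - 0)"
    by (rule set_integral_Icc_abs_le_const) (use v_abs_le vmax_pos in auto)
  then show ?thesis by (simp add: V_def)
qed

lemma V_diff:
  assumes "s \<le> t" shows "V t - V s = (LBINT r:{s..t}. v r)"
proof -
  consider "0 \<le> s" | "s < 0" "0 \<le> t" | "t < 0" using assms by linarith
  then show ?thesis
  proof cases
    case 1
    then show ?thesis using set_integral_Icc_split[OF v_integrable, of 0 s t] assms by (simp add: V_def)
  next
    case 2
    then show ?thesis using set_integral_Icc_split[OF v_integrable, of s 0 t] assms by (simp add: V_def)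
  next
    case 3
    then show ?thesis using set_integral_Icc_split[OF v_integrable, of s t 0] assms by (simp add: V_def)
  qed
qed

text \<open>Both the bounds on the increments of \<open>V\<close> and its differentiability at points of continuity
  of \<open>v\<close> are special cases.\<close>

lemma V_deviation:
  assumes "\<And>r. r \<in> {min s t..max s t} \<Longrightarrow> \<bar>v r - c\<bar> \<le> e" "0 \<le> e"
  shows "\<bar>V t - V s - c * (t - s)\<bar> \<le> e * \<bar>t - s\<bar>"
proof -
  have *: "\<bar>V t - V s - c * (t - s)\<bar> \<le> e * (t - s)"
    if "s \<le> t" "\<And>r. r \<in> {s..t} \<Longrightarrow> \<bar>v r - c\<bar> \<le> e" for s t
  proof -
    have "V t - V s - c * (t - s) = (LBINT r:{s..t}. v r - c)"
      using that(1) bounded_set_integrable_Icc[of "\<lambda>_. c" s t "\<bar>c\<bar>"]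
      by (subst set_integral_diff(2)[OF v_integrable]) (simp_all add: V_diff set_integral_Icc_const)
    then show ?thesis
      using set_integral_Icc_abs_le_const[OF that(1), of "\<lambda>r. v r - c" e] that(2) assms(2) by simp
  qed
  show ?thesis
  proof (cases "s \<le> t")
    case True
    then show ?thesis using *[of s t] assms(1) by simp
  next
    case False
    then have "\<bar>V s - V t - c * (s - t)\<bar> \<le> e * (s - t)"
      using *[of t s] assms(1) by (simp add: min_def max_def split: if_splits)
    moreover have "V s - V t - c * (s - t) = - (V t - V s - c * (t - s))" by (simp add: algebra_simps)
    ultimately show ?thesis using False by simp
  qed
qed

lemma V_bounds:
  assumes "s \<le> t" shows "vmin * (t - s) \<le> V t - V s" "V t - V s \<le> vmax * (t - s)"
proof -
  have "\<bar>v r - (vmin + vmax) / 2\<bar> \<le> (vmax - vmin) / 2" for r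
    using v_ge[of r] v_le[of r] by (simp add: abs_le_iff field_simps)
  moreover have "0 \<le> (vmax - vmin) / 2" using v_ge[of 0] v_le[of 0] by simp
  ultimately have "\<bar>V t - V s - (vmin + vmax) / 2 * (t - s)\<bar> \<le> (vmax - vmin) / 2 * \<bar>t - s\<bar>"
    by (intro V_deviation)
  then have *: "\<bar>V t - V s - (vmin + vmax) / 2 * (t - s)\<bar> \<le> (vmax - vmin) / 2 * (t - s)"
    by (subst (asm) abs_of_nonneg[of "t - s"]) (use assms in auto)
  have "(vmin + vmax) / 2 * (t - s) - (vmax - vmin) / 2 * (t - s) = vmin * (t - s)"
    "(vmin + vmax) / 2 * (t - s) + (vmax - vmin) / 2 * (t - s) = vmax * (t - s)"
    by (simp_all add: field_simps)
  moreover have "l \<le> X \<and> X \<le> u" if "\<bar>X - A\<bar> \<le> B" "A - B = l" "A + B = u" for X A B l u :: real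
    using that by linarith
  ultimately show "vmin * (t - s) \<le> V t - V s" "V t - V s \<le> vmax * (t - s)" using * by blast+
qed

lemma V_Lipschitz: "\<bar>V t - V s\<bar> \<le> vmax * \<bar>t - s\<bar>"
proof -
  have *: "\<bar>V t - V s\<bar> \<le> vmax * (t - s)" if "s \<le> t" for s t
  proof -
    have "0 \<le> vmin * (t - s)" using vmin_pos that by simp
    then have "0 \<le> V t - V s" using V_bounds(1)[OF that] by (rule order_trans)
    then show ?thesis using V_bounds(2)[OF that] by simp
  qed
  show ?thesis
  proof (cases "s \<le> t")
    case True
    then show ?thesis using *[OF True] by simp
  next
    case False
    then show ?thesis using *[of t s] by (simp add: abs_minus_commute)
  qed
qed

lemma V_expansive: "vmin * \<bar>t - s\<bar> \<le> \<bar>V t - V s\<bar>"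
  using V_bounds(1)[of s t] V_bounds(1)[of t s] by (cases "s \<le> t") auto

lemma V_strict_mono: "V s < V t \<longleftrightarrow> s < t"
proof -
  have "V s < V t" if "s < t" for s t
    using V_bounds(1)[of s t] that mult_pos_pos[OF vmin_pos, of "t - s"] by linarith
  then show ?thesis by (metis less_irrefl linorder_cases order_less_trans)
qed

lemma V_le_iff: "V s \<le> V t \<longleftrightarrow> s \<le> t"
  using V_strict_mono[of t s] by linarith

lemma V_eq_iff: "V s = V t \<longleftrightarrow> s = t"
  using V_strict_mono[of s t] V_strict_mono[of t s] by force

lemma continuous_on_V: "continuous_on A V"
proof -
  have "vmax-lipschitz_on UNIV V"
    using vmax_pos V_Lipschitz by (intro lipschitz_onI) (auto simp: dist_real_def)
  then show ?thesis using lipschitz_on_continuous_on continuous_on_subset by blast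
qed

lemma V_measurable [measurable]: "V \<in> borel_measurable borel"
  by (rule borel_measurable_continuous_onI[OF continuous_on_V])

lemma V_surj: "\<exists>s. V s = y"
proof -
  define r where "r = \<bar>y\<bar> / vmin"
  have r: "0 \<le> r" "vmin * r = \<bar>y\<bar>" using vmin_pos by (auto simp: r_def)
  have "V (- r) \<le> y" "y \<le> V r"
    using V_bounds(1)[of "- r" 0] V_bounds(1)[of 0 r] r by (auto simp: V_0)
  then show ?thesis
    using IVT'[of V "- r" y r, OF _ _ _ continuous_on_V] r by force
qed

lemma V_entry: "V (entry t x) = V t - x"
proof -
  obtain s where "V s = V t - x" using V_surj by blast
  then show ?thesis unfolding entry_def by (rule theI) (use V_eq_iff \<open>V s = V t - x\<close> in metis)
qed

lemma entry_eqI: "V s = V t - x \<Longrightarrow> entry t x = s"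
  using V_entry[of t x] V_eq_iff by metis

lemma entry_0: "entry t 0 = t"
  by (rule entry_eqI) simp

text \<open>Characteristics are translates of each other, so entry times compose additively. Through this
  law a displacement in space becomes a displacement in time.\<close>

lemma entry_entry: "entry (entry t x) y = entry t (x + y)"
  by (rule entry_eqI[symmetric, THEN sym]) (simp add: V_entry)

lemma entry_le: "V t - x \<le> V t' - x' \<Longrightarrow> entry t x \<le> entry t' x'"
  using V_le_iff[of "entry t x" "entry t' x'"] by (simp add: V_entry)

lemma entry_mono: "mono (\<lambda>t. entry t x)"
  by (rule monoI, rule entry_le) (simp add: V_le_iff)

lemma entry_near: "\<bar>entry t x - t\<bar> \<le> \<bar>x\<bar> / vmin"
  using V_expansive[of "entry t x" t] vmin_pos by (simp add: V_entry field_simps)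

lemma entry_Lipschitz: "\<bar>entry t x - entry t' x\<bar> \<le> vmax / vmin * \<bar>t - t'\<bar>"
proof -
  have "vmin * \<bar>entry t x - entry t' x\<bar> \<le> \<bar>V t - V t'\<bar>"
    using V_expansive[of "entry t x" "entry t' x"] by (simp add: V_entry)
  also have "\<dots> \<le> vmax * \<bar>t - t'\<bar>" by (rule V_Lipschitz)
  finally show ?thesis using vmin_pos by (simp add: field_simps)
qed

lemma continuous_on_entry: "continuous_on UNIV (\<lambda>p. entry (fst p) (snd p))"
proof -
  have "\<exists>s. V s = y" for y by (rule V_surj)
  then obtain U where U: "\<And>y. V (U y) = y" by metis
  have "(1 / vmin)-lipschitz_on UNIV U"
    using V_expansive[of "U _" "U _"] vmin_pos
    by (intro lipschitz_onI) (auto simp: dist_real_def U field_simps)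
  then have "continuous_on UNIV U" by (rule lipschitz_on_continuous_on)
  then have "continuous_on UNIV (\<lambda>p::real \<times> real. U (V (fst p) - snd p))"
    by (rule continuous_on_compose2)
      (auto intro!: continuous_intros continuous_on_compose2[OF continuous_on_V[of UNIV]])
  moreover have "entry t x = U (V t - x)" for t x
    by (rule entry_eqI) (rule U)
  ultimately show ?thesis by simp
qed

lemma V_deriv:
  assumes "isCont v t" shows "(V has_real_derivative v t) (at t)"
  unfolding has_field_derivative_iff
proof (rule LIM_I)
  fix e :: real assume "0 < e"
  then obtain d where d: "0 < d" "\<And>r. \<bar>r - t\<bar> < d \<Longrightarrow> \<bar>v r - v t\<bar> < e / 2"
    using assms[unfolded continuous_at_eps_delta, rule_format, of "e/2"] by (auto simp: dist_real_def)
  have "norm ((V s - V t) / (s - t) - v t) < e" if s: "s \<noteq> t" "norm (s - t) < d" for s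
  proof -
    have "\<bar>V s - V t - v t * (s - t)\<bar> \<le> e / 2 * \<bar>s - t\<bar>"
    proof (rule V_deviation)
      fix r assume "r \<in> {min t s..max t s}"
      then have "\<bar>r - t\<bar> < d" using s by (auto simp: min_def max_def split: if_splits)
      then show "\<bar>v r - v t\<bar> \<le> e / 2" by (rule less_imp_le[OF d(2)])
    qed (use \<open>0 < e\<close> in simp)
    also have "\<dots> < e * \<bar>s - t\<bar>" using \<open>0 < e\<close> s by simp
    finally have "\<bar>(V s - V t - v t * (s - t)) / (s - t)\<bar> < e"
      using s by (simp add: abs_divide divide_less_eq)
    moreover have "(V s - V t - v t * (s - t)) / (s - t) = (V s - V t) / (s - t) - v t"
      using s by (simp add: diff_divide_distrib)
    ultimately show ?thesis by simp
  qed
  then show "\<exists>d>0. \<forall>s. s \<noteq> t \<and> norm (s - t) < d \<longrightarrow> norm ((V s - V t) / (s - t) - v t) < e"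
    using d(1) by blast
qed

text \<open>Test functions of \<open>x - V t\<close> would fail to be continuously differentiable where \<open>v\<close> jumps.
  The sliding averages of \<open>V\<close> over intervals of length \<open>1 / (n + 1)\<close> replace it there; their
  derivatives are the difference quotients of \<open>V\<close>.\<close>

definition Vn :: "nat \<Rightarrow> real \<Rightarrow> real" where
  "Vn n t = real (Suc n) * (LBINT s:{0..1 / real (Suc n)}. V (t + s))"

definition vn :: "nat \<Rightarrow> real \<Rightarrow> real" where
  "vn n t = (V (t + 1 / real (Suc n)) - V t) * real (Suc n)"

lemma continuous_on_vn: "continuous_on A (vn n)"
  unfolding vn_def by (intro continuous_intros continuous_on_compose2[OF continuous_on_V[of UNIV]]) auto

lemma vn_abs_le: "\<bar>vn n t\<bar> \<le> vmax"
  using V_Lipschitz[of "t + 1 / real (Suc n)" t]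
  by (simp add: vn_def abs_mult pos_le_divide_eq del: of_nat_Suc)

lemma vn_tendsto:
  assumes "isCont v t" shows "(\<lambda>n. vn n t) \<longlonglongrightarrow> v t"
proof -
  have "filterlim (\<lambda>n. 1 / real (Suc n)) (at 0) sequentially"
    using LIMSEQ_Suc[OF lim_1_over_n] by (auto simp: filterlim_at)
  then have "(\<lambda>n. (V (t + 1 / real (Suc n)) - V t) / (1 / real (Suc n))) \<longlonglongrightarrow> v t"
    using DERIV_D[OF V_deriv[OF assms]] by (rule filterlim_compose[rotated])
  then show ?thesis by (simp add: vn_def)
qed

lemma Vn_deriv: "(Vn n has_real_derivative vn n t) (at t)"
proof -
  define e where "e = 1 / real (Suc n)"
  have e: "0 < e" by (simp add: e_def)
  have int: "V integrable_on {a..b}" for a b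
    by (rule integrable_continuous_real[OF continuous_on_V])
  have eq: "Vn n s = real (Suc n) * (integral {t - 2 * e..s + e} V - integral {t - 2 * e..s} V)"
    if "s \<in> {t - e<..<t + e}" for s
  proof -
    have "(LBINT r:{0..e}. V (s + r)) = (LBINT r:{s..s + e}. V r)"
      using set_integral_translate_Icc[of 0 e V s] by (simp add: add.commute)
    also have "\<dots> = integral {s..s + e} V"
      by (rule set_borel_integral_eq_integral(2)) (rule borel_integrable_atLeastAtMost'[OF continuous_on_V])
    also have "\<dots> = integral {t - 2 * e..s + e} V - integral {t - 2 * e..s} V"
      using Henstock_Kurzweil_Integration.integral_combine[OF _ _ int, of "t - 2 * e" s "s + e"] that e by auto
    finally show ?thesis by (simp add: Vn_def e_def)
  qed
  have F: "((\<lambda>s. integral {t - 2 * e..s} V) has_real_derivative V r) (at r)" if "t - e < r" "r < t + 2 * e" for r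
  proof -
    have "((\<lambda>s. integral {t - 2 * e..s} V) has_real_derivative V r) (at r within {t - 2 * e..t + 3 * e})"
      using that e by (intro integral_has_real_derivative continuous_on_V) auto
    then show ?thesis using that e by (subst (asm) at_within_interior) auto
  qed
  have "((\<lambda>s. real (Suc n) * (integral {t - 2 * e..s + e} V - integral {t - 2 * e..s} V))
     has_real_derivative real (Suc n) * (V (t + e) * 1 - V t)) (at t)"
  proof (intro DERIV_cmult DERIV_diff)
    show "((\<lambda>s. integral {t - 2 * e..s + e} V) has_real_derivative V (t + e) * 1) (at t)"
      by (rule DERIV_chain'[where f="\<lambda>s. s + e" and g="\<lambda>r. integral {t - 2 * e..r} V"])
        (use e F[of "t + e"] in \<open>auto intro!: derivative_eq_intros\<close>)
    show "((\<lambda>s. integral {t - 2 * e..s} V) has_real_derivative V t) (at t)" using F[of t] e by simp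
  qed
  then show ?thesis
    by (rule has_field_derivative_transform_within_open[of _ _ _ "{t - e<..<t + e}", THEN DERIV_cong])
      (use e eq in \<open>auto simp: vn_def e_def\<close>)
qed

lemma Vn_near: "\<bar>Vn n t - V t\<bar> \<le> vmax / real (Suc n)"
proof -
  define e where "e = 1 / real (Suc n)"
  have e: "0 < e" "real (Suc n) * e = 1" by (simp_all add: e_def)
  have "Vn n t - V t = real (Suc n) * ((LBINT s:{0..e}. V (t + s)) - V t * (e - 0))"
    unfolding Vn_def e_def[symmetric] right_diff_distrib using e(2) by (simp add: mult.left_commute del: of_nat_Suc)
  also have "(LBINT s:{0..e}. V (t + s)) - V t * (e - 0) = (LBINT s:{0..e}. V (t + s) - V t)"
    using e bounded_set_integrable_Icc[of "\<lambda>_. V t" 0 e "\<bar>V t\<bar>"]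
    by (subst set_integral_diff(2)[OF borel_integrable_atLeastAtMost'])
      (auto intro!: continuous_intros continuous_on_compose2[OF continuous_on_V[of UNIV]] simp: set_integral_Icc_const)
  finally have "\<bar>Vn n t - V t\<bar> = real (Suc n) * \<bar>LBINT s:{0..e}. V (t + s) - V t\<bar>"
    by (simp add: abs_mult)
  also have "\<dots> \<le> real (Suc n) * (vmax * e * (e - 0))"
  proof (intro mult_left_mono set_integral_Icc_abs_le_const)
    fix s assume "s \<in> {0..e}"
    then show "\<bar>V (t + s) - V t\<bar> \<le> vmax * e"
      using V_Lipschitz[of "t + s" t] vmax_pos by (auto intro: order_trans[OF _ mult_left_mono])
  qed (use e vmax_pos in auto)
  also have "\<dots> = (real (Suc n) * e) * (vmax * e)" by simp
  also have "\<dots> = vmax * e" by (simp only: e(2) mult_1)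
  finally show ?thesis by (simp add: e_def)
qed

lemma Vn_tendsto: "(\<lambda>n. Vn n t) \<longlonglongrightarrow> V t"
proof -
  have "(\<lambda>n. vmax * (1 / real (Suc n))) \<longlonglongrightarrow> vmax * 0"
    by (intro tendsto_intros LIMSEQ_Suc[OF lim_1_over_n])
  then have "(\<lambda>n. Vn n t - V t) \<longlonglongrightarrow> 0"
    by - (rule Lim_null_comparison[where g="\<lambda>n. vmax * (1 / real (Suc n))", OF always_eventually],
        use Vn_near in auto)
  then show ?thesis by (rule LIM_zero_cancel)
qed

end

section \<open>Test functions\<close>

lemma fst_borel [measurable]: "fst \<in> borel_measurable (borel :: (real \<times> real) measure)"
  by (rule borel_measurable_continuous_onI[OF continuous_on_fst[OF continuous_on_id]])

lemma snd_borel [measurable]: "snd \<in> borel_measurable (borel :: (real \<times> real) measure)"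
  by (rule borel_measurable_continuous_onI[OF continuous_on_snd[OF continuous_on_id]])

definition pos_square :: "real \<Rightarrow> real" where
  "pos_square x = (max 0 x)\<^sup>2"

lemma pos_square_deriv: "(pos_square has_real_derivative 2 * max 0 x) (at x)"
proof -
  consider "x < 0" | "x = 0" | "0 < x" by linarith
  then show ?thesis
  proof cases
    case 1
    have "((\<lambda>_. 0) has_real_derivative 2 * max 0 x) (at x)" using 1 by simp
    then show ?thesis
      by (rule has_field_derivative_transform_within_open[where S="{..<0}"])
        (use 1 in \<open>auto simp: pos_square_def\<close>)
  next
    case 2
    have "((\<lambda>y. max 0 y) \<longlongrightarrow> max 0 0) (at (0::real))" by (intro tendsto_intros)
    moreover have "\<forall>\<^sub>F y in at (0::real). max 0 y = (pos_square y - pos_square 0) / (y - 0)"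
      by (auto simp: eventually_at pos_square_def max_def power2_eq_square intro!: exI[of _ 1])
    ultimately have "((\<lambda>y. (pos_square y - pos_square 0) / (y - 0)) \<longlongrightarrow> 0) (at 0)"
      by (simp add: tendsto_cong)
    then show ?thesis using 2 by (simp add: has_field_derivative_iff)
  next
    case 3
    have "((\<lambda>y. y\<^sup>2) has_real_derivative 2 * max 0 x) (at x)"
      using 3 by (auto intro!: derivative_eq_intros)
    then show ?thesis
      by (rule has_field_derivative_transform_within_open[where S="{0<..}"])
        (use 3 in \<open>auto simp: pos_square_def\<close>)
  qed
qed

text \<open>A continuously differentiable transition from \<open>0\<close> to \<open>1\<close> on the unit interval.\<close>

definition ramp :: "real \<Rightarrow> real" where
  "ramp x = pos_square x / (pos_square x + pos_square (1 - x))"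

definition ramp' :: "real \<Rightarrow> real" where
  "ramp' x = 2 * (max 0 x * pos_square (1 - x) + pos_square x * max 0 (1 - x)) /
     (pos_square x + pos_square (1 - x))\<^sup>2"

lemma ramp_denominator_pos: "0 < pos_square x + pos_square (1 - x)"
  by (cases "x \<le> 0") (auto simp: pos_square_def max_def add_nonneg_pos add_pos_nonneg)

lemma ramp_deriv: "(ramp has_real_derivative ramp' x) (at x)"
proof -
  have 1: "((\<lambda>x. pos_square (1 - x)) has_real_derivative 2 * max 0 (1 - x) * (- 1)) (at x)"
    by (rule DERIV_chain'[where f="\<lambda>x. 1 - x" and g=pos_square, OF _ pos_square_deriv])
      (auto intro!: derivative_eq_intros)
  show ?thesis
    unfolding ramp_def[abs_def]
    by (rule DERIV_cong[OF DERIV_divide[OF pos_square_deriv DERIV_add[OF pos_square_deriv 1]]])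
      (use ramp_denominator_pos[of x] in \<open>auto simp: ramp'_def power2_eq_square algebra_simps\<close>)
qed

lemma ramp_0: "x \<le> 0 \<Longrightarrow> ramp x = 0"
  by (simp add: ramp_def pos_square_def)

lemma ramp_1: "1 \<le> x \<Longrightarrow> ramp x = 1"
  by (simp add: ramp_def pos_square_def)

lemma ramp_nonneg: "0 \<le> ramp x"
  using ramp_denominator_pos[of x] by (simp add: ramp_def pos_square_def)

lemma ramp_le_1: "ramp x \<le> 1"
  using ramp_denominator_pos[of x] by (simp add: ramp_def pos_square_def divide_le_eq)

lemma ramp'_nonneg: "0 \<le> ramp' x"
  using ramp_denominator_pos[of x] by (simp add: ramp'_def pos_square_def)

lemma ramp'_pos: "0 < x \<Longrightarrow> x < 1 \<Longrightarrow> 0 < ramp' x"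
  using ramp_denominator_pos[of x] by (auto simp: ramp'_def pos_square_def intro!: divide_pos_pos add_pos_pos)

lemma ramp'_0: "x \<le> 0 \<or> 1 \<le> x \<Longrightarrow> ramp' x = 0"
  by (auto simp: ramp'_def pos_square_def)

lemma continuous_on_ramp: "continuous_on A ramp"
  using ramp_deriv DERIV_isCont by (blast intro: continuous_at_imp_continuous_on)

lemma continuous_on_ramp': "continuous_on A ramp'"
proof -
  have "pos_square x + pos_square (1 - x) \<noteq> 0" for x using ramp_denominator_pos[of x] by simp
  then show ?thesis
    unfolding ramp'_def pos_square_def by (intro continuous_intros) (auto simp: pos_square_def)
qed

lemma ramp'_bounded: "\<exists>B>0. \<forall>x. ramp' x \<le> B"
proof -
  have "compact (ramp' ` {0..1})" by (intro compact_continuous_image continuous_on_ramp') simp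
  then have "bounded (ramp' ` {0..1})" by (rule compact_imp_bounded)
  then obtain B where B: "\<And>x. x \<in> {0..1} \<Longrightarrow> \<bar>ramp' x\<bar> \<le> B"
    unfolding bounded_iff by (metis image_eqI real_norm_def)
  have "ramp' x \<le> max B 1" for x
    using B[of x] ramp'_0[of x] by (cases "x \<in> {0..1}") auto
  then show ?thesis by (intro exI[of _ "max B 1"]) auto
qed

lemma ramp_measurable [measurable]: "ramp \<in> borel_measurable borel" "ramp' \<in> borel_measurable borel"
  by (intro borel_measurable_continuous_onI continuous_on_ramp continuous_on_ramp')+

lemma ramp'_rescaled:
  assumes "c \<noteq> 0"
  shows "integrable lborel (\<lambda>x. ramp' (t + c * x) * \<bar>c\<bar>)" "(LBINT x. ramp' (t + c * x) * \<bar>c\<bar>) = 1"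
proof -
  have "isCont ramp' x" for x
    using continuous_on_ramp'[of UNIV] by (simp add: continuous_on_eq_continuous_at)
  then have "has_bochner_integral lborel (\<lambda>x. ramp' x * indicator {0..1} x) (ramp 1 - ramp 0)"
    using ramp_deriv by (intro has_bochner_integral_FTC_Icc_real) auto
  moreover have "ramp' x * indicator {0..1} x = ramp' x" for x
    by (cases "x \<le> 0 \<or> 1 \<le> x") (auto simp: indicator_def ramp'_0)
  ultimately have "integrable lborel ramp'" "(LBINT x. ramp' x) = 1"
    by (simp_all add: has_bochner_integral_iff ramp_0 ramp_1)
  then show "integrable lborel (\<lambda>x. ramp' (t + c * x) * \<bar>c\<bar>)" "(LBINT x. ramp' (t + c * x) * \<bar>c\<bar>) = 1"
    using lborel_integrable_real_affine[OF _ assms, of ramp' t] lborel_integral_real_affine[OF assms, of ramp' t]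
    by (simp_all add: mult.commute)
qed

definition plateau :: "real \<Rightarrow> real \<Rightarrow> real \<Rightarrow> real \<Rightarrow> real" where
  "plateau a b d x = ramp ((x - a) / d) * ramp ((b - x) / d)"

text \<open>The derivative of \<open>plateau\<close> as long as the two ramps do not overlap. It has the form of
  a kernel of mass one near \<open>a\<close> minus a kernel of mass one near \<open>b\<close>.\<close>

definition plateau' :: "real \<Rightarrow> real \<Rightarrow> real \<Rightarrow> real \<Rightarrow> real" where
  "plateau' a b d x = ramp' ((x - a) / d) / d - ramp' ((b - x) / d) / d"

context
  fixes a b d :: real
  assumes d: "0 < d" and ab: "a + 2 * d \<le> b"
begin

lemma plateau_deriv: "(plateau a b d has_real_derivative plateau' a b d x) (at x)"
proof -
  have 1: "((\<lambda>x. ramp ((x - a) / d)) has_real_derivative ramp' ((x - a) / d) * (1 / d)) (at x)"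
    by (rule DERIV_chain'[where f="\<lambda>x. (x - a) / d" and g=ramp, OF _ ramp_deriv])
      (use d in \<open>auto intro!: derivative_eq_intros\<close>)
  have 2: "((\<lambda>x. ramp ((b - x) / d)) has_real_derivative ramp' ((b - x) / d) * (- 1 / d)) (at x)"
    by (rule DERIV_chain'[where f="\<lambda>x. (b - x) / d" and g=ramp, OF _ ramp_deriv])
      (use d in \<open>auto intro!: derivative_eq_intros\<close>)
  (* the two ramps do not overlap: where one of them moves, the other one equals 1 *)
  have "ramp' ((x - a) / d) * ramp ((b - x) / d) = ramp' ((x - a) / d)"
    using d ab ramp_1[of "(b - x) / d"] ramp'_0[of "(x - a) / d"]
    by (cases "x \<le> a + d") (auto simp: field_simps)
  moreover have "ramp ((x - a) / d) * ramp' ((b - x) / d) = ramp' ((b - x) / d)"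
    using d ab ramp_1[of "(x - a) / d"] ramp'_0[of "(b - x) / d"]
    by (cases "a + d \<le> x") (auto simp: field_simps)
  ultimately have *: "ramp ((x - a) / d) * (ramp' ((b - x) / d) * (- 1 / d))
      + ramp' ((x - a) / d) * (1 / d) * ramp ((b - x) / d) = plateau' a b d x"
    by (auto simp: plateau'_def)
  show ?thesis
    unfolding plateau_def[abs_def] by (rule DERIV_cong[OF DERIV_mult'[OF 1 2] *])
qed

lemma plateau_0: "x \<le> a \<or> b \<le> x \<Longrightarrow> plateau a b d x = 0"
  using d by (auto simp: plateau_def ramp_0 divide_nonpos_pos)

lemma plateau_1: "a + d \<le> x \<Longrightarrow> x \<le> b - d \<Longrightarrow> plateau a b d x = 1"
  using d by (simp add: plateau_def ramp_1 le_divide_eq)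

lemma plateau'_0: "x \<le> a \<or> (a + d \<le> x \<and> x \<le> b - d) \<or> b \<le> x \<Longrightarrow> plateau' a b d x = 0"
  using d ab by (auto simp: plateau'_def ramp'_0 divide_le_eq le_divide_eq)

lemma plateau'_neg: "b - d < x \<Longrightarrow> x < b \<Longrightarrow> plateau' a b d x < 0"
  using d ab ramp'_pos[of "(b - x) / d"] ramp'_0[of "(x - a) / d"]
  by (auto simp: plateau'_def divide_le_eq le_divide_eq field_simps)

lemma continuous_on_plateau': "continuous_on A (plateau' a b d)"
  unfolding plateau'_def using d
  by (intro continuous_intros continuous_on_compose2[OF continuous_on_ramp'[of UNIV]]) auto

end

lemma plateau_nonneg: "0 \<le> plateau a b d x"
  by (simp add: plateau_def ramp_nonneg)

lemma plateau_le_1: "plateau a b d x \<le> 1"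
  unfolding plateau_def by (intro mult_le_one ramp_le_1 ramp_nonneg)

lemma plateau_measurable [measurable]:
  "plateau a b d \<in> borel_measurable borel" "plateau' a b d \<in> borel_measurable borel"
  unfolding plateau_def plateau'_def by measurable

text \<open>The factors are cutoffs in time and in the coordinate \<open>x - m t\<close> that is constant along curves
  of speed \<open>m'\<close>; for \<open>m = 0\<close> this is an ordinary product.\<close>

lemma test_function_transported_product:
  assumes \<alpha>: "\<And>t. (\<alpha> has_real_derivative \<alpha>' t) (at t)" "continuous_on UNIV \<alpha>'" "\<And>t. 0 \<le> \<alpha> t"
    and \<beta>: "\<And>x. (\<beta> has_real_derivative \<beta>' x) (at x)" "continuous_on UNIV \<beta>'" "\<And>x. 0 \<le> \<beta> x"
    and m: "\<And>t. (m has_real_derivative m' t) (at t)" "continuous_on UNIV m'"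
    and supp: "\<And>t. t \<notin> {a..b} \<Longrightarrow> \<alpha> t = 0" "\<And>x. x \<notin> {c..d} \<Longrightarrow> \<beta> x = 0"
    and U: "\<And>t x. t \<in> {a..b} \<Longrightarrow> x - m t \<in> {c..d} \<Longrightarrow> (t, x) \<in> U"
  shows "test_function U (\<lambda>(t, x). \<alpha> t * \<beta> (x - m t))
    (\<lambda>(t, x). \<alpha>' t * \<beta> (x - m t) - \<alpha> t * \<beta>' (x - m t) * m' t) (\<lambda>(t, x). \<alpha> t * \<beta>' (x - m t))"
proof -
  have cont: "continuous_on UNIV \<alpha>" "continuous_on UNIV \<beta>" "continuous_on UNIV m"
    using \<alpha>(1) \<beta>(1) m(1) DERIV_isCont by (blast intro: continuous_at_imp_continuous_on)+
  let ?\<phi> = "\<lambda>p. \<alpha> (fst p) * \<beta> (snd p - m (fst p))"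
  have der: "(?\<phi> has_derivative (\<lambda>(s, y).
      (\<alpha>' (fst p) * \<beta> (snd p - m (fst p)) - \<alpha> (fst p) * \<beta>' (snd p - m (fst p)) * m' (fst p)) * s
      + \<alpha> (fst p) * \<beta>' (snd p - m (fst p)) * y)) (at p)" for p
  proof -
    have 1: "((\<lambda>p. \<alpha> (fst p)) has_derivative (\<lambda>h. \<alpha>' (fst p) * fst h)) (at p)"
      by (rule has_derivative_compose[where f=fst and g=\<alpha>])
        (use \<alpha>(1) in \<open>auto intro!: derivative_intros simp: has_field_derivative_def\<close>)
    have 2: "((\<lambda>p. m (fst p)) has_derivative (\<lambda>h. m' (fst p) * fst h)) (at p)"
      by (rule has_derivative_compose[where f=fst and g=m])
        (use m(1) in \<open>auto intro!: derivative_intros simp: has_field_derivative_def\<close>)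
    have 3: "((\<lambda>p. snd p - m (fst p)) has_derivative (\<lambda>h. snd h - m' (fst p) * fst h)) (at p)"
      by (intro has_derivative_diff has_derivative_snd has_derivative_ident 2)
    have 4: "((\<lambda>p. \<beta> (snd p - m (fst p))) has_derivative
        (\<lambda>h. \<beta>' (snd p - m (fst p)) * (snd h - m' (fst p) * fst h))) (at p)"
      by (rule has_derivative_compose[where g=\<beta>, OF 3])
        (use \<beta>(1) in \<open>auto simp: has_field_derivative_def\<close>)
    show ?thesis
      by (rule has_derivative_eq_rhs[OF has_derivative_mult[OF 1 4]])
        (auto simp: fun_eq_iff algebra_simps)
  qed
  define S where "S = {p. fst p \<in> {a..b} \<and> snd p - m (fst p) \<in> {c..d}}"
  have S: "closed S"
    unfolding S_def by (auto intro!: closed_Collect_conj closed_Collect_le continuous_intros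
        continuous_on_compose2[OF cont(3)])
  have "bounded (m ` {a..b})"
    by (intro compact_imp_bounded compact_continuous_image continuous_on_subset[OF cont(3)]) auto
  then obtain M where M: "\<And>t. t \<in> {a..b} \<Longrightarrow> \<bar>m t\<bar> \<le> M"
    unfolding bounded_iff by (metis image_eqI real_norm_def)
  have "S \<subseteq> {a..b} \<times> {c - M..d + M}"
    using M by (fastforce simp: S_def abs_le_iff)
  then have "bounded S"
    by (rule bounded_subset[rotated]) (intro bounded_Times bounded_closed_interval)
  with S have cS: "compact S" by (simp add: compact_eq_bounded_closed)
  have "{p. ?\<phi> p \<noteq> 0} \<subseteq> S" using supp by (force simp: S_def)
  then have clo: "closure {p. ?\<phi> p \<noteq> 0} \<subseteq> S" using S by (rule closure_minimal)
  then have "compact (closure {p. ?\<phi> p \<noteq> 0})"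
    by (subst Int_absorb1[OF clo, symmetric]) (rule compact_Int_closed[OF cS closed_closure])
  moreover have "S \<subseteq> U" using U by (auto simp: S_def)
  ultimately show ?thesis
    unfolding test_function_def case_prod_unfold
    using der clo \<alpha>(3) \<beta>(3)
    by (auto simp: case_prod_unfold intro!: continuous_intros continuous_on_compose2[OF cont(1)]
        continuous_on_compose2[OF cont(2)] continuous_on_compose2[OF cont(3)] continuous_on_compose2[OF \<alpha>(2)]
        continuous_on_compose2[OF \<beta>(2)] continuous_on_compose2[OF m(2)])
qed

lemma test_function_mult_cutoff:
  assumes \<phi>: "test_function ({..<T} \<times> UNIV) \<phi> \<phi>t \<phi>x"
    and \<kappa>: "\<And>x. (\<kappa> has_real_derivative \<kappa>' x) (at x)" "continuous_on UNIV \<kappa>'" "\<And>x. 0 \<le> \<kappa> x"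
    and supp: "\<And>x. x \<notin> {c..d} \<Longrightarrow> \<kappa> x = 0" "{c..d} \<subseteq> I"
  shows "test_function ({..<T} \<times> I) (\<lambda>p. \<phi> p * \<kappa> (snd p)) (\<lambda>p. \<phi>t p * \<kappa> (snd p))
    (\<lambda>p. \<phi>x p * \<kappa> (snd p) + \<phi> p * \<kappa>' (snd p))"
proof -
  note tf = \<phi>[unfolded test_function_def]
  have cont: "continuous_on UNIV \<kappa>"
    using \<kappa>(1) DERIV_isCont by (blast intro: continuous_at_imp_continuous_on)
  have cont\<phi>: "continuous_on UNIV \<phi>"
    using tf has_derivative_continuous by (blast intro: continuous_at_imp_continuous_on)
  have der: "((\<lambda>p. \<phi> p * \<kappa> (snd p)) has_derivative
    (\<lambda>(s, y). \<phi>t p * \<kappa> (snd p) * s + (\<phi>x p * \<kappa> (snd p) + \<phi> p * \<kappa>' (snd p)) * y)) (at p)" for p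
  proof -
    have 1: "(\<phi> has_derivative (\<lambda>(s, y). \<phi>t p * s + \<phi>x p * y)) (at p)" using tf by blast
    have 2: "((\<lambda>p. \<kappa> (snd p)) has_derivative (\<lambda>h. \<kappa>' (snd p) * snd h)) (at p)"
      by (rule has_derivative_compose[where f=snd and g=\<kappa>])
        (use \<kappa>(1) in \<open>auto intro!: derivative_intros simp: has_field_derivative_def\<close>)
    show ?thesis
      by (rule has_derivative_eq_rhs[OF has_derivative_mult[OF 1 2]])
        (auto simp: fun_eq_iff algebra_simps)
  qed
  let ?S = "closure {p. \<phi> p \<noteq> 0} \<inter> (UNIV \<times> {c..d})"
  have cS: "compact ?S"
    using tf by (intro compact_Int_closed closed_Times) auto
  have "{p. \<phi> p * \<kappa> (snd p) \<noteq> 0} \<subseteq> {p. \<phi> p \<noteq> 0} \<inter> (UNIV \<times> {c..d})"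
    using supp(1) by force
  also have "\<dots> \<subseteq> ?S" by (rule Int_mono[OF closure_subset order_refl])
  finally have clo: "closure {p. \<phi> p * \<kappa> (snd p) \<noteq> 0} \<subseteq> ?S"
    using compact_imp_closed[OF cS] by (rule closure_minimal)
  then have "compact (closure {p. \<phi> p * \<kappa> (snd p) \<noteq> 0})"
    by (subst Int_absorb1[OF clo, symmetric]) (rule compact_Int_closed[OF cS closed_closure])
  moreover have "?S \<subseteq> {..<T} \<times> I" using tf supp(2) by auto
  ultimately show ?thesis
    unfolding test_function_def using der clo tf \<kappa>(3)
    by (auto intro!: continuous_intros cont\<phi> continuous_on_compose2[OF cont] continuous_on_compose2[OF \<kappa>(2)])
qed

text \<open>Outside the closure of its support \<open>\<phi>\<close> vanishes in a neighbourhood, and so do its derivatives.\<close>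

lemma test_function_zero:
  assumes "test_function U \<phi> \<phi>t \<phi>x" "p \<notin> U"
  shows "\<phi> p = 0" "\<phi>t p = 0" "\<phi>x p = 0"
proof -
  note tf = assms(1)[unfolded test_function_def]
  have nin: "p \<in> - closure {p. \<phi> p \<noteq> 0}" using tf assms(2) by auto
  then show "\<phi> p = 0" using closure_subset[of "{p. \<phi> p \<noteq> 0}"] by auto
  have "((\<lambda>_. 0) has_derivative (\<lambda>(s, y). \<phi>t p * s + \<phi>x p * y)) (at p)"
  proof (rule has_derivative_transform_within_open)
    show "(\<phi> has_derivative (\<lambda>(s, y). \<phi>t p * s + \<phi>x p * y)) (at p)" using tf by blast
    show "open (- closure {p. \<phi> p \<noteq> 0})" by (rule open_Compl[OF closed_closure])
    show "q \<in> - closure {p. \<phi> p \<noteq> 0} \<Longrightarrow> \<phi> q = 0" for q using closure_subset[of "{p. \<phi> p \<noteq> 0}"] by auto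
  qed (rule nin)
  then have "(\<lambda>(s, y). \<phi>t p * s + \<phi>x p * y) = (\<lambda>_. 0)"
    using has_derivative_unique has_derivative_const by blast
  then have "(\<lambda>(s, y). \<phi>t p * s + \<phi>x p * y) (1, 0) = 0" "(\<lambda>(s, y). \<phi>t p * s + \<phi>x p * y) (0, 1) = 0"
    by metis+
  then show "\<phi>t p = 0" "\<phi>x p = 0" by auto
qed

lemma test_function_continuous:
  assumes "test_function U \<phi> \<phi>t \<phi>x"
  shows "continuous_on A \<phi>" "continuous_on A \<phi>t" "continuous_on A \<phi>x"
proof -
  note tf = assms[unfolded test_function_def]
  show "continuous_on A \<phi>"
    using tf has_derivative_continuous by (blast intro: continuous_at_imp_continuous_on)
  show "continuous_on A \<phi>t" "continuous_on A \<phi>x" using tf continuous_on_subset by blast+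
qed

lemma test_function_measurable:
  assumes "test_function U \<phi> \<phi>t \<phi>x"
  shows "\<phi> \<in> borel_measurable borel" "\<phi>t \<in> borel_measurable borel" "\<phi>x \<in> borel_measurable borel"
  using test_function_continuous[OF assms] by (auto intro: borel_measurable_continuous_onI)

lemma test_function_bounded:
  assumes "test_function U \<phi> \<phi>t \<phi>x"
  obtains B where "0 < B" "\<And>p. \<bar>\<phi> p\<bar> \<le> B" "\<And>p. \<bar>\<phi>t p\<bar> \<le> B" "\<And>p. \<bar>\<phi>x p\<bar> \<le> B"
proof -
  let ?S = "closure {p. \<phi> p \<noteq> 0}"
  note tf = assms[unfolded test_function_def]
  have S: "compact ?S" using tf by blast
  have tfS: "test_function ?S \<phi> \<phi>t \<phi>x" using tf unfolding test_function_def by blast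
  have ex: "\<exists>B. \<forall>p. \<bar>g p\<bar> \<le> B" if g: "continuous_on ?S g" "\<And>p. p \<notin> ?S \<Longrightarrow> g p = 0" for g :: "real \<times> real \<Rightarrow> real"
  proof -
    have "bounded (g ` ?S)" by (intro compact_imp_bounded compact_continuous_image g(1) S)
    then obtain B where B: "\<And>p. p \<in> ?S \<Longrightarrow> \<bar>g p\<bar> \<le> B"
      unfolding bounded_iff by (metis image_eqI real_norm_def)
    have "\<bar>g p\<bar> \<le> max B 0" for p using B[of p] g(2)[of p] by (cases "p \<in> ?S") auto
    then show ?thesis by blast
  qed
  obtain B1 B2 B3 where "\<And>p. \<bar>\<phi> p\<bar> \<le> B1" "\<And>p. \<bar>\<phi>t p\<bar> \<le> B2" "\<And>p. \<bar>\<phi>x p\<bar> \<le> B3"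
    using ex[OF test_function_continuous(1)[OF assms] test_function_zero(1)[OF tfS]]
      ex[OF test_function_continuous(2)[OF assms] test_function_zero(2)[OF tfS]]
      ex[OF test_function_continuous(3)[OF assms] test_function_zero(3)[OF tfS]] by auto
  then have "\<bar>\<phi> p\<bar> \<le> max (max B1 B2) (max B3 1)" "\<bar>\<phi>t p\<bar> \<le> max (max B1 B2) (max B3 1)"
    "\<bar>\<phi>x p\<bar> \<le> max (max B1 B2) (max B3 1)" for p
    by (auto simp: le_max_iff_disj)
  then show thesis by (intro that[of "max (max B1 B2) (max B3 1)"]) auto
qed

lemma test_function_Lipschitz:
  assumes "test_function U \<phi> \<phi>t \<phi>x" "\<And>p. \<bar>\<phi>t p\<bar> \<le> B" "\<And>p. \<bar>\<phi>x p\<bar> \<le> B"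
  shows "\<bar>\<phi> p - \<phi> q\<bar> \<le> B * (\<bar>fst p - fst q\<bar> + \<bar>snd p - snd q\<bar>)"
proof -
  define g where "g r = \<phi> (q + r *\<^sub>R (p - q))" for r :: real
  let ?g' = "\<lambda>r. \<phi>t (q + r *\<^sub>R (p - q)) * fst (p - q) + \<phi>x (q + r *\<^sub>R (p - q)) * snd (p - q)"
  have der: "(g has_real_derivative ?g' r) (at r)" for r
  proof -
    have "((\<lambda>r. q + r *\<^sub>R (p - q)) has_derivative (\<lambda>h. h *\<^sub>R (p - q))) (at r)"
      by (auto intro!: derivative_eq_intros)
    moreover have "(\<phi> has_derivative (\<lambda>(s, y). \<phi>t (q + r *\<^sub>R (p - q)) * s + \<phi>x (q + r *\<^sub>R (p - q)) * y))
      (at (q + r *\<^sub>R (p - q)))"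
      using assms(1) unfolding test_function_def by blast
    ultimately have "(g has_derivative (\<lambda>h. (\<lambda>(s, y). \<phi>t (q + r *\<^sub>R (p - q)) * s + \<phi>x (q + r *\<^sub>R (p - q)) * y)
       (h *\<^sub>R (p - q)))) (at r)"
      unfolding g_def by (rule has_derivative_compose)
    then show ?thesis
      unfolding has_field_derivative_def
      by (rule has_derivative_eq_rhs) (auto simp: fun_eq_iff case_prod_unfold algebra_simps)
  qed
  obtain z where "g 1 - g 0 = (1 - 0) * ?g' z"
    using MVT2[of 0 1 g ?g'] der by auto
  then have "\<phi> p - \<phi> q = ?g' z" by (simp add: g_def)
  also have "\<bar>\<dots>\<bar> \<le> B * \<bar>fst (p - q)\<bar> + B * \<bar>snd (p - q)\<bar>"
    by (rule order_trans[OF abs_triangle_ineq]) (auto simp: abs_mult intro!: add_mono mult_right_mono assms)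
  finally show ?thesis by (simp add: algebra_simps)
qed

lemma bounded_set_integrable:
  fixes f :: "real \<times> real \<Rightarrow> real"
  assumes "set_borel_measurable borel Q f" "Q \<subseteq> {a..b} \<times> {c..d}" "Q \<in> sets borel"
    and "\<And>p. p \<in> Q \<Longrightarrow> \<bar>f p\<bar> \<le> B"
  shows "set_integrable lborel Q f"
proof (rule set_integrable_bound)
  have "{a..b} \<times> {c..d} = cbox (a, c) (b, d)" by (simp add: cbox_Pair_eq)
  then have "set_integrable lborel ({a..b} \<times> {c..d}) (\<lambda>_. B)"
    using borel_integrable_compact[of "{a..b} \<times> {c..d}" "\<lambda>_. B"]
    by (simp add: set_integrable_def compact_Times scaleR_conv_of_real indicator_def if_distrib cong: if_cong)
  then show "set_integrable lborel Q (\<lambda>_. B)"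
    by (rule set_integrable_subset) (use assms in auto)
  show "set_borel_measurable lborel Q f" using assms(1) by (simp add: set_borel_measurable_def)
  show "AE p in lborel. p \<in> Q \<longrightarrow> norm (f p) \<le> norm B"
    using assms(4) by (intro AE_I2 impI) (metis abs_ge_self order_trans real_norm_def)
qed

section \<open>The transported density is an entropy solution\<close>

text \<open>In the coordinate \<open>y = x - m t\<close> the factor \<open>G\<close> no longer depends on time, and \<open>\<phi>t + w \<phi>x\<close> becomes
  the time derivative of \<open>\<phi>\<close> along the curve \<open>t \<mapsto> y + m t\<close>. After an exchange of the integrals
  the fundamental theorem leaves the value at \<open>t = 0\<close>, the one at \<open>T\<close> being zero.\<close>

lemma transported_test_integral:
  fixes m w G :: "real \<Rightarrow> real"
  assumes \<phi>: "test_function ({..<T} \<times> {0<..<L}) \<phi> \<phi>t \<phi>x" and T: "0 \<le> T"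
    and m: "\<And>s t. \<bar>m s - m t\<bar> \<le> C * \<bar>s - t\<bar>" "m 0 = 0"
    and E: "countable E" "\<And>t. t \<notin> E \<Longrightarrow> (m has_real_derivative w t) (at t)"
    and w [measurable]: "w \<in> borel_measurable borel" and wC: "\<And>t. \<bar>w t\<bar> \<le> C"
    and G [measurable]: "G \<in> borel_measurable borel" and GD: "\<And>x. \<bar>G x\<bar> \<le> D"
  shows "set_integrable lborel ({0..T} \<times> {0..L}) (\<lambda>p. G (snd p - m (fst p)) * (\<phi>t p + w (fst p) * \<phi>x p))" (is ?int)
    and "(LBINT p:{0..T} \<times> {0..L}. G (snd p - m (fst p)) * (\<phi>t p + w (fst p) * \<phi>x p))
      = - (LBINT x:{0..L}. G x * \<phi> (0, x))" (is ?eq)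
proof -
  note [measurable] = test_function_measurable[OF \<phi>]
  obtain B where B: "0 < B" "\<And>p. \<bar>\<phi> p\<bar> \<le> B" "\<And>p. \<bar>\<phi>t p\<bar> \<le> B" "\<And>p. \<bar>\<phi>x p\<bar> \<le> B"
    using test_function_bounded[OF \<phi>] by metis
  have C0: "0 \<le> C" using wC[of 0] by linarith
  have D0: "0 \<le> D" using GD[of 0] by linarith
  have "continuous_on UNIV m"
  proof -
    have "C-lipschitz_on UNIV m" using m C0 by (intro lipschitz_onI) (auto simp: dist_real_def)
    then show ?thesis by (rule lipschitz_on_continuous_on)
  qed
  then have [measurable]: "m \<in> borel_measurable borel" by (rule borel_measurable_continuous_onI)
  let ?f = "\<lambda>p. G (snd p - m (fst p)) * (\<phi>t p + w (fst p) * \<phi>x p)"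
  have [measurable]: "?f \<in> borel_measurable borel" by measurable
  have fb: "\<bar>?f p\<bar> \<le> D * (B + C * B)" for p
  proof -
    have "\<bar>\<phi>t p + w (fst p) * \<phi>x p\<bar> \<le> B + C * B"
      using B(3)[of p] mult_mono[OF wC[of "fst p"] B(4)[of p]] C0
      by (intro order_trans[OF abs_triangle_ineq] add_mono) (auto simp: abs_mult)
    then show ?thesis unfolding abs_mult by (intro mult_mono GD D0) auto
  qed
  show int: ?int
    by (rule bounded_set_integrable[where B="D * (B + C * B)"])
      (use fb in \<open>auto simp: set_borel_measurable_def intro!: borel_measurable_times borel_measurable_indicator closed_Times borel_closed\<close>)
  define H where "H t y = indicator {0..T} t * (G y * (\<phi>t (t, y + m t) + w t * \<phi>x (t, y + m t)))" for t y
  have [measurable]: "case_prod H \<in> borel_measurable borel"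
  proof -
    have "(\<lambda>p::real \<times> real. (fst p, snd p + m (fst p))) \<in> borel_measurable borel" by measurable
    from measurable_compose[OF this test_function_measurable(2)[OF \<phi>]]
      measurable_compose[OF this test_function_measurable(3)[OF \<phi>]]
    show ?thesis unfolding H_def case_prod_unfold by measurable
  qed
  have mT: "\<bar>m t\<bar> \<le> C * T" if "t \<in> {0..T}" for t
    using order_trans[OF m(1)[of t 0] mult_left_mono[OF _ C0, of "\<bar>t - 0\<bar>" T]] that m(2) by auto
  have Hsupp: "H t y = 0" if "(t, y) \<notin> {0..T} \<times> {- (C * T)..L + C * T}" for t y
  proof (cases "t \<in> {0..T}")
    case True
    then have "y + m t \<notin> {0<..<L}" using that mT[of t] by auto
    then have "\<phi>t (t, y + m t) = 0" "\<phi>x (t, y + m t) = 0"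
      using test_function_zero(2,3)[OF \<phi>, of "(t, y + m t)"] by auto
    then show ?thesis by (simp add: H_def)
  qed (simp add: H_def)
  have Hf: "H t y = indicator {0..T} t * ?f (t, y + m t)" for t y by (simp add: H_def)
  have Hint: "integrable (lborel \<Otimes>\<^sub>M lborel) (case_prod H)"
  proof -
    have "set_integrable lborel ({0..T} \<times> {- (C * T)..L + C * T}) (case_prod H)"
    proof (rule bounded_set_integrable[where B="D * (B + C * B)"])
      show "\<bar>case_prod H p\<bar> \<le> D * (B + C * B)" for p
        using fb[of "(fst p, snd p + m (fst p))"] D0 B(1) C0
        by (auto simp: case_prod_unfold Hf indicator_def)
    qed (auto simp: set_borel_measurable_def intro!: borel_measurable_times borel_measurable_indicator closed_Times borel_closed)
    moreover have "indicator ({0..T} \<times> {- (C * T)..L + C * T}) p *\<^sub>R case_prod H p = case_prod H p" for p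
      using Hsupp[of "fst p" "snd p"] by (cases p) (auto simp: indicator_def)
    ultimately show ?thesis unfolding set_integrable_def lborel_prod by (simp only:)
  qed
  define F where "F p = indicator ({0..T} \<times> {0..L}) p * ?f p" for p
  have F: "F (t, x) = indicator {0..T} t * ?f (t, x)" for t x
  proof (cases "(t, x) \<in> {..<T} \<times> {0<..<L}")
    case True
    then show ?thesis by (simp add: F_def indicator_def)
  next
    case False
    then show ?thesis using test_function_zero(2,3)[OF \<phi> False] by (simp add: F_def)
  qed
  have Fint: "integrable (lborel \<Otimes>\<^sub>M lborel) F"
    using int unfolding set_integrable_def lborel_prod F_def real_scaleR_def .
  have inner: "(LBINT t. H t y) = - (G y * \<phi> (0, y))" for y
  proof -
    have Lip: "\<bar>\<phi> (s, y + m s) - \<phi> (t, y + m t)\<bar> \<le> B * (1 + C) * \<bar>s - t\<bar>" for s t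
    proof -
      have "\<bar>\<phi> (s, y + m s) - \<phi> (t, y + m t)\<bar> \<le> B * (\<bar>s - t\<bar> + \<bar>m s - m t\<bar>)"
        using test_function_Lipschitz[OF \<phi> B(3,4), of "(s, y + m s)" "(t, y + m t)"] by simp
      also have "\<dots> \<le> B * (\<bar>s - t\<bar> + C * \<bar>s - t\<bar>)" using m(1)[of s t] B(1) by simp
      finally show ?thesis by (simp add: algebra_simps)
    qed
    have der: "((\<lambda>t. \<phi> (t, y + m t)) has_real_derivative \<phi>t (t, y + m t) + w t * \<phi>x (t, y + m t)) (at t)"
      if "t \<notin> E" for t
    proof -
      have 1: "((\<lambda>t. (t, y + m t)) has_derivative (\<lambda>h. (h, 0 + w t * h))) (at t)"
        using E(2)[OF that] unfolding has_field_derivative_def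
        by (intro has_derivative_Pair has_derivative_add has_derivative_ident has_derivative_const)
      have 2: "(\<phi> has_derivative (\<lambda>(s, x). \<phi>t (t, y + m t) * s + \<phi>x (t, y + m t) * x)) (at (t, y + m t))"
        using \<phi> unfolding test_function_def by blast
      from has_derivative_compose[OF 1 2] show ?thesis
        unfolding has_field_derivative_def
        by (rule has_derivative_eq_rhs) (auto simp: fun_eq_iff algebra_simps)
    qed
    have [measurable]: "(\<lambda>t. \<phi>t (t, y + m t) + w t * \<phi>x (t, y + m t)) \<in> borel_measurable borel"
    proof -
      have "(\<lambda>t. (t, y + m t)) \<in> borel_measurable borel" by measurable
      from measurable_compose[OF this test_function_measurable(2)[OF \<phi>]]
        measurable_compose[OF this test_function_measurable(3)[OF \<phi>]]
      show ?thesis by measurable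
    qed
    have "(LBINT t. H t y) = G y * (LBINT t:{0..T}. \<phi>t (t, y + m t) + w t * \<phi>x (t, y + m t))"
      unfolding H_def set_lebesgue_integral_def
      by (subst integral_mult_right_zero[symmetric]) (simp add: mult_ac)
    also have "(LBINT t:{0..T}. \<phi>t (t, y + m t) + w t * \<phi>x (t, y + m t)) = \<phi> (T, y + m T) - \<phi> (0, y + m 0)"
      by (rule set_integral_derivative_Lipschitz[OF Lip E(1) der _ T]) measurable
    also have "\<dots> = - \<phi> (0, y)" using test_function_zero(1)[OF \<phi>, of "(T, y + m T)"] m(2) by simp
    finally show ?thesis by simp
  qed
  have "(LBINT p:{0..T} \<times> {0..L}. ?f p) = integral\<^sup>L (lborel \<Otimes>\<^sub>M lborel) F"
    unfolding set_lebesgue_integral_def F_def lborel_prod real_scaleR_def ..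
  also have "\<dots> = (\<integral>t. (LBINT x. F (t, x)) \<partial>lborel)"
    by (rule lborel_pair.integral_fst'[symmetric, OF Fint])
  also have "\<dots> = (\<integral>t. (LBINT y. H t y) \<partial>lborel)"
  proof (rule Bochner_Integration.integral_cong[OF refl])
    fix t
    have "(LBINT x. F (t, x)) = (LBINT y. F (t, m t + 1 * y))"
      using lborel_integral_real_affine[of 1 "\<lambda>x. F (t, x)" "m t"] by simp
    then show "(LBINT x. F (t, x)) = (LBINT y. H t y)" by (simp add: F Hf add.commute)
  qed
  also have "\<dots> = (\<integral>y. (LBINT t. H t y) \<partial>lborel)"
    by (rule lborel_pair.Fubini_integral[OF Hint, symmetric])
  also have "\<dots> = (LBINT y. - (G y * \<phi> (0, y)))" unfolding inner ..
  also have "\<dots> = - (LBINT x:{0..L}. G x * \<phi> (0, x))"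
  proof -
    have "indicator {0..L} x *\<^sub>R (G x * \<phi> (0, x)) = G x * \<phi> (0, x)" for x
      by (cases "x \<in> {0..L}") (use test_function_zero(1)[OF \<phi>, of "(0, x)"] in auto)
    then show ?thesis unfolding set_lebesgue_integral_def by (simp only: Bochner_Integration.integral_minus)
  qed
  finally show ?eq .
qed

lemma rectangle_sets [measurable]: "{a..b} \<times> {c..d} \<in> sets (borel :: (real \<times> real) measure)"
  by (intro borel_closed closed_Times closed_atLeastAtMost)

lemma strip_eq: "{0..L} \<inter> cball x e = {max 0 (x - e)..min L (x + e)}" for x :: real
  by (auto simp: cball_eq_atLeastAtMost)

lemma has_trace_cong:
  assumes "\<And>t. t \<in> {0..T} \<Longrightarrow> g t = g' t"
  shows "has_trace T L \<rho> x g \<longleftrightarrow> has_trace T L \<rho> x g'"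
proof -
  have "set_integrable lborel {0..T} g \<longleftrightarrow> set_integrable lborel {0..T} g'"
    by (rule set_integrable_cong) (use assms in auto)
  moreover have "(LBINT p:{0..T} \<times> S. \<bar>\<rho> p - g (fst p)\<bar>) = (LBINT p:{0..T} \<times> S. \<bar>\<rho> p - g' (fst p)\<bar>)" for S
    unfolding set_lebesgue_integral_def
    by (rule Bochner_Integration.integral_cong) (use assms in \<open>auto simp: indicator_def\<close>)
  ultimately show ?thesis unfolding has_trace_def by simp
qed

context bv_speed begin

definition transported :: "(real \<Rightarrow> real) \<Rightarrow> real \<times> real \<Rightarrow> real" where
  "transported h p = h (entry (fst p) (snd p))"

lemma entry_measurable [measurable]: "(\<lambda>p. entry (fst p) (snd p)) \<in> borel_measurable borel"
  by (rule borel_measurable_continuous_onI[OF continuous_on_entry])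

lemma entry_slice_measurable [measurable]: "(\<lambda>t. entry t x) \<in> borel_measurable borel"
  by (rule borel_measurable_mono[OF entry_mono])

lemma transported_measurable:
  assumes "h \<in> borel_measurable borel" shows "transported h \<in> borel_measurable borel"
  unfolding transported_def using assms by measurable

lemma transported_eq_shift: "transported h p = h (entry 0 (snd p - V (fst p)))"
proof -
  have "entry (fst p) (snd p) = entry 0 (snd p - V (fst p))"
    by (rule entry_eqI) (simp add: V_entry V_0)
  then show ?thesis by (simp add: transported_def)
qed

text \<open>By \<open>entry_entry\<close> the density at \<open>x\<close> is the trace on \<open>x0\<close>, taken at a time that differs by at most
  \<open>\<bar>x - x0\<bar> / vmin\<close>. The shift estimate makes the integral over the strip of order \<open>e\<^sup>2\<close>.\<close>

lemma transported_has_trace: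
  assumes h: "variation_bound Kh h" and hb: "\<And>t. \<bar>h t\<bar> \<le> B" and T: "0 \<le> T"
  shows "has_trace T L (transported h) x0 (\<lambda>t. h (entry t x0))"
proof -
  have [measurable]: "h \<in> borel_measurable borel" using h by (rule variation_bound_borel_measurable)
  note [measurable] = transported_measurable
  define g where "g t = h (entry t x0)" for t
  have g: "variation_bound Kh g"
    using variation_bound_compose[OF h, of "\<lambda>t. entry t x0"] entry_mono by (simp add: g_def[abs_def] o_def)
  have Kh: "0 \<le> Kh" using h by (rule variation_bound_nonneg)
  have [measurable]: "g \<in> borel_measurable borel" using g by (rule variation_bound_borel_measurable)
  have h2: "\<bar>h s - h t\<bar> \<le> 2 * B" for s t using hb[of s] hb[of t] by linarith
  have tr: "transported h (t, x) = g (entry t (x - x0))" for t x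
    by (simp add: transported_def g_def entry_entry)
  let ?I = "\<lambda>e. LBINT p:{0..T} \<times> ({0..L} \<inter> cball x0 e). \<bar>transported h p - g (fst p)\<bar>"
  have bound: "\<bar>?I e\<bar> / e \<le> 4 * Kh / vmin * e" if e: "0 < e" for e
  proof -
    let ?J = "{max 0 (x0 - e)..min L (x0 + e)}"
    let ?f = "\<lambda>p. \<bar>transported h p - g (fst p)\<bar>"
    have int: "integrable (lborel \<Otimes>\<^sub>M lborel) (\<lambda>(t, x). indicator ({0..T} \<times> ?J) (t, x) *\<^sub>R ?f (t, x))"
    proof -
      have "set_integrable lborel ({0..T} \<times> ?J) ?f"
        by (rule bounded_set_integrable[where B="2 * B"])
          (use h2 in \<open>auto simp: set_borel_measurable_def transported_def g_def\<close>)
      then show ?thesis unfolding set_integrable_def lborel_prod case_prod_unfold by simp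
    qed
    have "?I e = (\<integral>x. (LBINT t. indicator ({0..T} \<times> ?J) (t, x) *\<^sub>R ?f (t, x)) \<partial>lborel)"
      unfolding strip_eq set_lebesgue_integral_def
      using lborel_pair.integral_snd[OF int] by (simp add: lborel_prod case_prod_unfold)
    also have "\<dots> = (LBINT x. indicator ?J x * (LBINT t:{0..T}. \<bar>g (entry t (x - x0)) - g t\<bar>))"
      unfolding set_lebesgue_integral_def
      by (rule Bochner_Integration.integral_cong[OF refl], subst integral_mult_right_zero[symmetric])
        (auto intro!: Bochner_Integration.integral_cong simp: tr indicator_times mult_ac)
    also have "\<dots> \<le> (LBINT x:{x0 - e..x0 + e}. 2 * (e / vmin) * Kh)"
      unfolding set_lebesgue_integral_def
    proof (rule integral_mono')
      show "integrable lborel (\<lambda>x. indicator {x0 - e..x0 + e} x *\<^sub>R (2 * (e / vmin) * Kh))"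
        using set_integrable_Icc_const unfolding set_integrable_def .
      fix x
      show "0 \<le> indicator {x0 - e..x0 + e} x *\<^sub>R (2 * (e / vmin) * Kh)"
        using e Kh vmin_pos by simp
      have "(LBINT t:{0..T}. \<bar>g (entry t (x - x0)) - g t\<bar>) \<le> 2 * (e / vmin) * Kh" if "x \<in> ?J"
      proof (rule variation_bound_shift_integral[OF g T])
        fix t
        have "\<bar>x - x0\<bar> / vmin \<le> e / vmin" using that vmin_pos by (intro divide_right_mono) auto
        then show "\<bar>entry t (x - x0) - t\<bar> \<le> e / vmin" using entry_near order_trans by blast
      qed (use e vmin_pos in simp)
      then show "indicator ?J x * (LBINT t. indicator {0..T} t *\<^sub>R \<bar>g (entry t (x - x0)) - g t\<bar>)
          \<le> indicator {x0 - e..x0 + e} x *\<^sub>R (2 * (e / vmin) * Kh)"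
        using e Kh vmin_pos by (auto simp: indicator_def set_lebesgue_integral_def)
    qed
    also have "\<dots> = 2 * (e / vmin) * Kh * (x0 + e - (x0 - e))" using e by (intro set_integral_Icc_const) simp
    finally have "?I e \<le> 4 * Kh / vmin * e * e" by (simp add: field_simps)
    moreover have "0 \<le> ?I e"
      unfolding set_lebesgue_integral_def by (intro Bochner_Integration.integral_nonneg) auto
    ultimately show ?thesis using e by (simp add: divide_le_eq)
  qed
  have "((\<lambda>e. 4 * Kh / vmin * e) \<longlongrightarrow> 4 * Kh / vmin * 0) (at_right 0)" by (intro tendsto_intros)
  then have "((\<lambda>e. ?I e / e) \<longlongrightarrow> 0) (at_right 0)"
    by - (rule Lim_null_comparison[where g="\<lambda>e. 4 * Kh / vmin * e"],
        use bound in \<open>auto simp: eventually_at_right_field abs_divide intro!: exI[of _ 1]\<close>)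
  moreover have "set_integrable lborel {0..T} g"
    by (rule bounded_set_integrable_Icc[where B=B]) (use hb in \<open>auto simp: g_def\<close>)
  ultimately show ?thesis unfolding has_trace_def g_def by simp
qed

text \<open>For a constant \<open>k\<close> up to the critical density, the entropy flux is \<open>v\<close> times the entropy
  \<open>\<bar>h - k\<bar>\<close>, which is transported like \<open>h\<close>. The point \<open>x = 0\<close> is left out of the initial condition:
  initial and boundary data may disagree in the corner, where test functions vanish.\<close>

lemma transported_kruzhkov:
  assumes [measurable]: "h \<in> borel_measurable borel"
    and h: "\<And>t. 0 \<le> h t" "\<And>t. h t \<le> \<rho>cr" and cr: "\<rho>cr < \<rho>max" and T: "0 \<le> T"
    and init: "\<And>x. x \<in> {0<..L} \<Longrightarrow> h (entry 0 x) = \<rho>0 x"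
  shows "kruzhkov_entropy_solution T L \<rho>cr \<rho>max \<rho>0 v (transported h)"
proof -
  let ?Q = "{0..T} \<times> {0..L}"
  note [measurable] = transported_measurable
  have [measurable]: "(\<lambda>x. entry 0 x) \<in> borel_measurable borel"
    by (rule measurable_compose[of "\<lambda>x. (0, x)" borel borel "\<lambda>p. entry (fst p) (snd p)", simplified]) measurable
  let ?\<rho> = "transported h"
  define G where "G x = h (entry 0 x)" for x
  have [measurable]: "G \<in> borel_measurable borel" unfolding G_def by measurable
  have \<rho>G: "?\<rho> p = G (snd p - V (fst p))" for p by (simp add: G_def transported_eq_shift)
  have G: "0 \<le> G x" "G x \<le> \<rho>cr" for x using h by (auto simp: G_def)
  have G0: "G x = \<rho>0 x" if "x \<in> {0<..L}" for x using init[OF that] by (simp add: G_def)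
  have fluxG: "flux \<rho>cr \<rho>max (G x) w = G x * w" for x w using G(2) by (simp add: flux_def)
  have flux\<rho>: "flux \<rho>cr \<rho>max (?\<rho> p) w = ?\<rho> p * w" for p w using G(2) by (simp add: flux_def \<rho>G)
  have "0 \<le> (LBINT p:?Q. \<bar>?\<rho> p - k\<bar> * \<phi>t p +
             sgn (?\<rho> p - k) * (flux \<rho>cr \<rho>max (?\<rho> p) (v (fst p)) - flux \<rho>cr \<rho>max k (v (fst p))) * \<phi>x p) +
          (LBINT x:{0..L}. \<bar>\<rho>0 x - k\<bar> * \<phi> (0, x))"
    if k: "k \<in> {0..\<rho>max}" and \<phi>: "test_function ({..<T} \<times> {0<..<L}) \<phi> \<phi>t \<phi>x" for k \<phi> \<phi>t \<phi>x
  proof -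
    note TI = transported_test_integral[OF \<phi> T V_Lipschitz V_0
        variation_bound_countable_discont[OF v_var] V_deriv v_measurable v_abs_le]
    have init_eq: "(LBINT x:{0..L}. \<bar>G x - k\<bar> * \<phi> (0, x)) = (LBINT x:{0..L}. \<bar>\<rho>0 x - k\<bar> * \<phi> (0, x))"
    proof (rule set_lebesgue_integral_cong)
      show "\<forall>x. x \<in> {0..L} \<longrightarrow> \<bar>G x - k\<bar> * \<phi> (0, x) = \<bar>\<rho>0 x - k\<bar> * \<phi> (0, x)"
      proof (intro allI impI)
        fix x assume "x \<in> {0..L}"
        then show "\<bar>G x - k\<bar> * \<phi> (0, x) = \<bar>\<rho>0 x - k\<bar> * \<phi> (0, x)"
          using G0[of x] test_function_zero(1)[OF \<phi>, of "(0, 0)"] by (cases "x = 0") auto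
      qed
    qed simp
    have Gk: "\<bar>\<bar>G x - k\<bar>\<bar> \<le> \<rho>max" for x using G[of x] k cr by auto
    have I1: "set_integrable lborel ?Q (\<lambda>p. \<bar>G (snd p - V (fst p)) - k\<bar> * (\<phi>t p + v (fst p) * \<phi>x p))"
      "(LBINT p:?Q. \<bar>G (snd p - V (fst p)) - k\<bar> * (\<phi>t p + v (fst p) * \<phi>x p))
        = - (LBINT x:{0..L}. \<bar>G x - k\<bar> * \<phi> (0, x))"
      using TI[of "\<lambda>x. \<bar>G x - k\<bar>" \<rho>max] Gk by auto
    show ?thesis
    proof (cases "k \<le> \<rho>cr")
      case True
      have "\<bar>?\<rho> p - k\<bar> * \<phi>t p +
             sgn (?\<rho> p - k) * (flux \<rho>cr \<rho>max (?\<rho> p) (v (fst p)) - flux \<rho>cr \<rho>max k (v (fst p))) * \<phi>x p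
          = \<bar>G (snd p - V (fst p)) - k\<bar> * (\<phi>t p + v (fst p) * \<phi>x p)" for p
        using True by (simp add: \<rho>G fluxG flux_def[of _ _ k] abs_sgn algebra_simps)
      then show ?thesis using I1(2) init_eq by simp
    next
      case False
      (* for congested k both fluxes are multiples of v, and k contributes a constant times \<phi>x *)
      define c where "c = \<rho>cr / (\<rho>max - \<rho>cr) * (\<rho>max - k)"
      have J1: "set_integrable lborel ?Q (\<lambda>p. 1 * (\<phi>t p + v (fst p) * \<phi>x p))"
        "(LBINT p:?Q. 1 * (\<phi>t p + v (fst p) * \<phi>x p)) = - (LBINT x:{0..L}. 1 * \<phi> (0, x))"
        using TI[of "\<lambda>_. 1" 1] by auto
      have J0: "set_integrable lborel ?Q (\<lambda>p. 1 * (\<phi>t p + 0 * \<phi>x p))"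
        "(LBINT p:?Q. 1 * (\<phi>t p + 0 * \<phi>x p)) = - (LBINT x:{0..L}. 1 * \<phi> (0, x))"
        using transported_test_integral[OF \<phi> T, of "\<lambda>_. 0" 0 "{}" "\<lambda>_. 0" "\<lambda>_. 1" 1] by auto
      have pt: "\<bar>?\<rho> p - k\<bar> * \<phi>t p +
             sgn (?\<rho> p - k) * (flux \<rho>cr \<rho>max (?\<rho> p) (v (fst p)) - flux \<rho>cr \<rho>max k (v (fst p))) * \<phi>x p
          = \<bar>G (snd p - V (fst p)) - k\<bar> * (\<phi>t p + v (fst p) * \<phi>x p)
            + (c - k) * (1 * (\<phi>t p + v (fst p) * \<phi>x p) - 1 * (\<phi>t p + 0 * \<phi>x p))" for p
      proof -
        have "?\<rho> p < k" using False G(2)[of "snd p - V (fst p)"] by (simp add: \<rho>G)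
        moreover have "flux \<rho>cr \<rho>max k (v (fst p)) = c * v (fst p)"
          using False by (simp add: flux_def c_def)
        ultimately show ?thesis by (simp add: flux\<rho> flip: \<rho>G) (simp add: algebra_simps)
      qed
      have Z: "(LBINT p:?Q. (c - k) * (1 * (\<phi>t p + v (fst p) * \<phi>x p) - 1 * (\<phi>t p + 0 * \<phi>x p))) = 0"
        using set_integral_diff(2)[OF J1(1) J0(1)] J1(2) J0(2) by simp
      have SI: "set_integrable lborel ?Q (\<lambda>p. (c - k) * (1 * (\<phi>t p + v (fst p) * \<phi>x p) - 1 * (\<phi>t p + 0 * \<phi>x p)))"
        using set_integral_diff(1)[OF J1(1) J0(1)] by (intro set_integrable_mult_right) auto
      show ?thesis
        unfolding pt set_integral_add(2)[OF I1(1) SI] Z I1(2) init_eq by simp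
    qed
  qed
  moreover have "?\<rho> ` ?Q \<subseteq> {0..\<rho>max}" using G(1) order_trans[OF G(2) less_imp_le[OF cr]] by (auto simp: \<rho>G)
  moreover have "set_borel_measurable borel ?Q ?\<rho>"
    unfolding set_borel_measurable_def by measurable
  ultimately show ?thesis unfolding kruzhkov_entropy_solution_def by blast
qed

lemma transported_traffic_solution:
  assumes h: "variation_bound Kh h" "\<And>t. 0 \<le> h t" "\<And>t. h t \<le> \<rho>cr" and cr: "\<rho>cr < \<rho>max" and T: "0 \<le> T"
    and init: "\<And>x. x \<in> {0<..L} \<Longrightarrow> h (entry 0 x) = \<rho>0 x"
    and inflow: "\<And>t. t \<in> {0..T} \<Longrightarrow> h t = In t / v t"
  shows "traffic_solution T L \<rho>cr \<rho>max \<rho>0 In v (transported h) (\<lambda>t. h (entry t L))"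
proof -
  have hb: "\<bar>h t\<bar> \<le> \<rho>cr" for t using h(2,3)[of t] by simp
  have "has_trace T L (transported h) 0 (\<lambda>t. In t / v t)"
    using transported_has_trace[OF h(1) hb T, of L 0] has_trace_cong[of T "\<lambda>t. h (entry t 0)" "\<lambda>t. In t / v t"]
      inflow by (simp add: entry_0)
  moreover have "kruzhkov_entropy_solution T L \<rho>cr \<rho>max \<rho>0 v (transported h)"
    by (rule transported_kruzhkov[OF variation_bound_borel_measurable[OF h(1)] h(2,3) cr T init])
  ultimately show ?thesis
    unfolding traffic_solution_def using transported_has_trace[OF h(1) hb T, of L L] h(3)
    by (auto simp: flux_def)
qed

end

section \<open>Boundary terms\<close>

lemma AE_lborel_fst:
  assumes "AE t in lborel. P (t :: real)" shows "AE p in (lborel :: (real \<times> real) measure). P (fst p)"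
proof -
  obtain N where N: "{t \<in> space lborel. \<not> P t} \<subseteq> N" "emeasure lborel N = 0" "N \<in> sets lborel"
    using assms by (rule AE_E)
  have "AE t in lborel. t \<notin> N" using N by (intro AE_not_in) auto
  moreover have "{p \<in> space (lborel \<Otimes>\<^sub>M lborel). fst p \<notin> N} \<in> sets (lborel \<Otimes>\<^sub>M lborel)"
    using N(3) by measurable
  ultimately have "AE p in lborel \<Otimes>\<^sub>M lborel. fst p \<notin> N"
    by (intro lborel_pair.AE_pair_measure) auto
  then have "AE p in (lborel :: (real \<times> real) measure). fst p \<notin> N" unfolding lborel_prod .
  then show ?thesis by (rule eventually_mono) (use N(1) in auto)
qed

lemma AE_lborel_snd:
  assumes "AE x in lborel. P (x :: real)" shows "AE p in (lborel :: (real \<times> real) measure). P (snd p)"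
proof -
  obtain N where N: "{t \<in> space lborel. \<not> P t} \<subseteq> N" "emeasure lborel N = 0" "N \<in> sets lborel"
    using assms by (rule AE_E)
  have "AE t in lborel. t \<notin> N" using N by (intro AE_not_in) auto
  moreover have "{p \<in> space (lborel \<Otimes>\<^sub>M lborel). snd p \<notin> N} \<in> sets (lborel \<Otimes>\<^sub>M lborel)"
    using N(3) by measurable
  ultimately have "AE p in lborel \<Otimes>\<^sub>M lborel. snd p \<notin> N"
    by (intro lborel_pair.AE_pair_measure) auto
  then have "AE p in (lborel :: (real \<times> real) measure). snd p \<notin> N" unfolding lborel_prod .
  then show ?thesis by (rule eventually_mono) (use N(1) in auto)
qed

lemma integral_product_of_functions:
  fixes f k :: "real \<Rightarrow> real"
  assumes f: "integrable lborel f" and k: "integrable lborel k"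
  shows "integrable lborel (\<lambda>p :: real \<times> real. f (fst p) * k (snd p))"
    and "(\<integral>p. f (fst p) * k (snd p) \<partial>(lborel :: (real \<times> real) measure)) = (LBINT t. f t) * (LBINT x. k x)"
proof -
  have [measurable]: "f \<in> borel_measurable borel" "k \<in> borel_measurable borel"
    using borel_measurable_integrable[OF f] borel_measurable_integrable[OF k] by simp_all
  have int: "integrable (lborel \<Otimes>\<^sub>M lborel) (\<lambda>p. f (fst p) * k (snd p))"
  proof (rule lborel_pair.Fubini_integrable)
    have "integrable lborel (\<lambda>t. \<bar>f t\<bar> * (LBINT x. \<bar>k x\<bar>))" using f by simp
    then show "integrable lborel (\<lambda>t. LBINT x. norm (f (fst (t, x)) * k (snd (t, x))))"
      by (simp add: abs_mult)
  qed (use k in auto)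
  then show "integrable lborel (\<lambda>p :: real \<times> real. f (fst p) * k (snd p))" by (simp add: lborel_prod)
  show "(\<integral>p. f (fst p) * k (snd p) \<partial>(lborel :: (real \<times> real) measure)) = (LBINT t. f t) * (LBINT x. k x)"
    using lborel_pair.integral_fst'[OF int] by (simp add: lborel_prod)
qed

lemma set_integrable_rectangle_fst:
  fixes g :: "real \<Rightarrow> real" and a b :: real
  assumes "set_integrable lborel {0..T} g"
  shows "set_integrable lborel ({0..T} \<times> {a..b}) (\<lambda>p. g (fst p))"
proof -
  have "integrable lborel (\<lambda>p :: real \<times> real. (indicator {0..T} (fst p) *\<^sub>R g (fst p)) * (indicator {a..b} (snd p) *\<^sub>R 1))"
    using integral_product_of_functions(1)[OF assms[unfolded set_integrable_def]
        set_integrable_Icc_const[of a b 1, unfolded set_integrable_def]] .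
  moreover have "(\<lambda>p :: real \<times> real. (indicator {0..T} (fst p) *\<^sub>R g (fst p)) * (indicator {a..b} (snd p) *\<^sub>R 1))
      = (\<lambda>p. indicator ({0..T} \<times> {a..b}) p *\<^sub>R g (fst p))"
    by (auto simp: indicator_def fun_eq_iff)
  ultimately show ?thesis by (simp add: set_integrable_def)
qed

lemma trace_difference_integrable:
  fixes q :: "real \<times> real \<Rightarrow> real"
  assumes q: "set_borel_measurable borel ({0..T} \<times> {0..L}) q" "\<And>p. p \<in> {0..T} \<times> {0..L} \<Longrightarrow> \<bar>q p\<bar> \<le> B"
    and g: "set_integrable lborel {0..T} g"
  shows "set_integrable lborel ({0..T} \<times> ({0..L} \<inter> cball x0 e)) (\<lambda>p. \<bar>q p - g (fst p)\<bar>)"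
proof -
  have "set_integrable lborel ({0..T} \<times> {0..L}) q"
    by (rule bounded_set_integrable[OF q(1) order_refl rectangle_sets q(2)])
  then have "set_integrable lborel ({0..T} \<times> {0..L}) (\<lambda>p. \<bar>q p - g (fst p)\<bar>)"
    using set_integrable_rectangle_fst[OF g] by (intro set_integrable_abs set_integral_diff(1))
  then show ?thesis
    by (rule set_integrable_subset) (auto simp: strip_eq)
qed

text \<open>A trace can be evaluated with kernels of mass one that shrink to the boundary line: since
  their height times the width of the strip stays bounded, the strong form of the trace absorbs them.\<close>

lemma trace_kernel_limit:
  assumes q [measurable]: "q \<in> borel_measurable borel" and qB: "\<And>p. \<bar>q p\<bar> \<le> Bq"
    and tr: "has_trace T L q x0 g" and \<phi>: "test_function U \<phi> \<phi>t \<phi>x"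
    and k [measurable]: "\<And>n. k n \<in> borel_measurable borel"
    and k0: "\<And>n x. 0 \<le> k n x" and kC: "\<And>n x. k n x \<le> C / e n"
    and ksupp: "\<And>n x. k n x \<noteq> 0 \<Longrightarrow> x \<in> {0..L} \<inter> cball x0 (e n)"
    and kint: "\<And>n. integrable lborel (k n)" and k1: "\<And>n. (LBINT x. k n x) = 1"
    and e: "\<And>n. 0 < e n" "e \<longlonglongrightarrow> 0"
  shows "(\<lambda>n. LBINT p:{0..T} \<times> {0..L}. q p * \<phi> p * k n (snd p)) \<longlonglongrightarrow> (LBINT t:{0..T}. g t * \<phi> (t, x0))"
proof -
  let ?Q = "{0..T} \<times> {0..L}"
  let ?S = "\<lambda>n. {0..T} \<times> ({0..L} \<inter> cball x0 (e n))"
  note [measurable] = test_function_measurable[OF \<phi>]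
  obtain B where B: "0 < B" "\<And>p. \<bar>\<phi> p\<bar> \<le> B" "\<And>p. \<bar>\<phi>t p\<bar> \<le> B" "\<And>p. \<bar>\<phi>x p\<bar> \<le> B"
    using test_function_bounded[OF \<phi>] by metis
  have g: "set_integrable lborel {0..T} g" using tr unfolding has_trace_def by blast
  have lim0: "(\<lambda>n. (LBINT p:?S n. \<bar>q p - g (fst p)\<bar>) / e n) \<longlonglongrightarrow> 0"
  proof -
    have "e n \<noteq> 0" for n using e(1)[of n] by simp
    then have "filterlim e (at_right 0) sequentially"
      using e by (auto simp: filterlim_at)
    then show ?thesis using tr unfolding has_trace_def by (auto intro: filterlim_compose)
  qed
  define gh where "gh t = indicator {0..T} t *\<^sub>R g t" for t
  have gh: "integrable lborel gh" using g unfolding set_integrable_def gh_def[abs_def] .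
  have [measurable]: "gh \<in> borel_measurable borel" using borel_measurable_integrable[OF gh] by simp
  have [measurable]: "(\<lambda>t. \<phi> (t, x0)) \<in> borel_measurable borel"
    by (rule measurable_compose[OF _ test_function_measurable(1)[OF \<phi>]]) measurable
  have g\<phi>: "integrable lborel (\<lambda>t. gh t * \<phi> (t, x0))"
  proof (rule Bochner_Integration.integrable_bound)
    show "integrable lborel (\<lambda>t. B * gh t)" using gh by simp
    show "AE t in lborel. norm (gh t * \<phi> (t, x0)) \<le> norm (B * gh t)"
    proof (rule AE_I2)
      fix t
      show "norm (gh t * \<phi> (t, x0)) \<le> norm (B * gh t)"
        using mult_left_mono[OF B(2)[of "(t, x0)"], of "\<bar>gh t\<bar>"] B(1) by (simp add: abs_mult mult.commute)
    qed
  qed measurable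
  have bnd: "\<bar>(LBINT p:?Q. q p * \<phi> p * k n (snd p)) - (LBINT t:{0..T}. g t * \<phi> (t, x0))\<bar>
      \<le> B * C * ((LBINT p:?S n. \<bar>q p - g (fst p)\<bar>) / e n) + B * e n * (LBINT t. \<bar>gh t\<bar>)" for n
  proof -
    let ?a = "\<lambda>p. indicator ?Q p * (q p * \<phi> p * k n (snd p))"
    let ?b = "\<lambda>p. (gh (fst p) * \<phi> (fst p, x0)) * k n (snd p)"
    let ?c = "\<lambda>p. B * C / e n * (indicator (?S n) p *\<^sub>R \<bar>q p - g (fst p)\<bar>)"
    let ?d = "\<lambda>p. B * e n * (\<bar>gh (fst p)\<bar> * k n (snd p))"
    have a: "integrable lborel ?a"
    proof -
      have "set_integrable lborel ?Q (\<lambda>p. q p * \<phi> p * k n (snd p))"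
      proof (rule bounded_set_integrable[where B="Bq * B * (C / e n)"])
        show "\<bar>q p * \<phi> p * k n (snd p)\<bar> \<le> Bq * B * (C / e n)" for p
        proof -
          have "0 \<le> Bq" using qB[of p] by linarith
          then show ?thesis unfolding abs_mult using qB B k0 kC
            by (intro mult_mono) (auto intro: mult_nonneg_nonneg order_trans[OF k0 kC])
        qed
      qed (auto simp: set_borel_measurable_def)
      then show ?thesis by (simp add: set_integrable_def)
    qed
    have b: "integrable lborel ?b" "integral\<^sup>L lborel ?b = (LBINT t. gh t * \<phi> (t, x0))"
      using integral_product_of_functions[OF g\<phi> kint] k1 by simp_all
    have c: "integrable lborel ?c"
      using trace_difference_integrable[of T L q Bq g x0 "e n"] qB g
      by (simp add: set_integrable_def set_borel_measurable_def)
    have d: "integrable lborel ?d" "integral\<^sup>L lborel ?d = B * e n * (LBINT t. \<bar>gh t\<bar>)"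
      using integral_product_of_functions[OF integrable_abs[OF gh] kint] k1 by simp_all
    have pw: "\<bar>?a p - ?b p\<bar> \<le> ?c p + ?d p" for p
    proof (cases "k n (snd p) = 0")
      case True
      have "0 \<le> ?c p"
      proof -
        have "0 \<le> C / e n" using order_trans[OF k0 kC] .
        then show ?thesis using B(1) by (metis abs_ge_zero indicator_pos_le less_imp_le mult_nonneg_nonneg real_scaleR_def times_divide_eq_right)
      qed
      then show ?thesis using True by simp
    next
      case False
      note x = ksupp[OF False]
      show ?thesis
      proof (cases "fst p \<in> {0..T}")
        case True
        then have pQ: "p \<in> ?Q" "p \<in> ?S n" using x by (auto simp: mem_Times_iff)
        have "\<bar>q p * \<phi> p - g (fst p) * \<phi> (fst p, x0)\<bar> \<le> B * \<bar>q p - g (fst p)\<bar> + B * e n * \<bar>g (fst p)\<bar>"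
        proof -
          have "q p * \<phi> p - g (fst p) * \<phi> (fst p, x0) = (q p - g (fst p)) * \<phi> p + g (fst p) * (\<phi> p - \<phi> (fst p, x0))"
            by (simp add: algebra_simps)
          also have "\<bar>\<dots>\<bar> \<le> \<bar>(q p - g (fst p)) * \<phi> p\<bar> + \<bar>g (fst p) * (\<phi> p - \<phi> (fst p, x0))\<bar>"
            by (rule abs_triangle_ineq)
          also have "\<bar>(q p - g (fst p)) * \<phi> p\<bar> \<le> \<bar>q p - g (fst p)\<bar> * B"
            unfolding abs_mult by (intro mult_left_mono B) auto
          also have "\<bar>g (fst p) * (\<phi> p - \<phi> (fst p, x0))\<bar> \<le> \<bar>g (fst p)\<bar> * (B * e n)"
          proof -
            have "\<bar>\<phi> p - \<phi> (fst p, x0)\<bar> \<le> B * \<bar>snd p - x0\<bar>"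
              using test_function_Lipschitz[OF \<phi> B(3,4), of p "(fst p, x0)"] by simp
            also have "\<dots> \<le> B * e n" using x B(1) by (auto simp: dist_real_def abs_minus_commute)
            finally show ?thesis unfolding abs_mult by (intro mult_left_mono) auto
          qed
          finally show ?thesis by (simp add: mult_ac)
        qed
        then have "\<bar>q p * \<phi> p - g (fst p) * \<phi> (fst p, x0)\<bar> * k n (snd p)
            \<le> (B * \<bar>q p - g (fst p)\<bar> + B * e n * \<bar>g (fst p)\<bar>) * k n (snd p)"
          by (rule mult_right_mono[OF _ k0])
        also have "\<dots> \<le> B * \<bar>q p - g (fst p)\<bar> * (C / e n) + B * e n * \<bar>g (fst p)\<bar> * k n (snd p)"
          unfolding distrib_right using B(1) kC by (intro add_right_mono mult_left_mono) auto
        finally have "\<bar>(q p * \<phi> p - g (fst p) * \<phi> (fst p, x0)) * k n (snd p)\<bar>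
            \<le> B * \<bar>q p - g (fst p)\<bar> * (C / e n) + B * e n * \<bar>g (fst p)\<bar> * k n (snd p)"
          by (simp only: abs_mult abs_of_nonneg[OF k0])
        moreover have "?a p - ?b p = (q p * \<phi> p - g (fst p) * \<phi> (fst p, x0)) * k n (snd p)"
          using pQ True by (simp add: gh_def left_diff_distrib)
        moreover have "?c p = B * \<bar>q p - g (fst p)\<bar> * (C / e n)" using pQ by simp
        moreover have "?d p = B * e n * \<bar>g (fst p)\<bar> * k n (snd p)" using True by (simp add: gh_def)
        ultimately show ?thesis by (simp only:)
      next
        case F: False
        then have "?a p = 0" "?b p = 0" by (auto simp: gh_def indicator_def)
        moreover have "0 \<le> C / e n" using order_trans[OF k0 kC] .
        moreover have "0 \<le> ?d p" using B(1) e(1)[of n] k0[of n "snd p"] by simp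
        ultimately show ?thesis using F by (auto simp: indicator_def)
      qed
    qed
    have eq: "(LBINT p:?Q. q p * \<phi> p * k n (snd p)) - (LBINT t:{0..T}. g t * \<phi> (t, x0))
        = (LBINT p. ?a p - ?b p)"
      unfolding Bochner_Integration.integral_diff[OF a b(1)] b(2)
      by (simp add: set_lebesgue_integral_def gh_def mult.assoc)
    have le: "\<bar>LBINT p. ?a p - ?b p\<bar> \<le> (LBINT p. ?c p + ?d p)"
    proof (rule order_trans[OF integral_abs_bound])
      show "(LBINT p. \<bar>?a p - ?b p\<bar>) \<le> (LBINT p. ?c p + ?d p)"
        by (rule integral_mono[OF integrable_abs[OF Bochner_Integration.integrable_diff[OF a b(1)]]
              Bochner_Integration.integrable_add[OF c d(1)]]) (rule pw)
    qed
    have "(LBINT p. ?c p) = B * C / e n * (LBINT p:?S n. \<bar>q p - g (fst p)\<bar>)"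
      unfolding set_lebesgue_integral_def by (rule integral_mult_right_zero)
    then have "(LBINT p. ?c p + ?d p)
        = B * C / e n * (LBINT p:?S n. \<bar>q p - g (fst p)\<bar>) + B * e n * (LBINT t. \<bar>gh t\<bar>)"
      unfolding Bochner_Integration.integral_add[OF c d(1)] d(2) by (rule arg_cong)
    then show ?thesis unfolding eq using le
      by (simp only: times_divide_eq_left times_divide_eq_right mult.assoc)
  qed
  have "(\<lambda>n. B * C * ((LBINT p:?S n. \<bar>q p - g (fst p)\<bar>) / e n) + B * e n * (LBINT t. \<bar>gh t\<bar>)) \<longlonglongrightarrow>
      B * C * 0 + B * 0 * (LBINT t. \<bar>gh t\<bar>)"
    by (intro tendsto_intros lim0 e(2))
  then have "(\<lambda>n. (LBINT p:?Q. q p * \<phi> p * k n (snd p)) - (LBINT t:{0..T}. g t * \<phi> (t, x0))) \<longlonglongrightarrow> 0"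
    by - (rule Lim_null_comparison[OF always_eventually], use bnd in auto)
  then show ?thesis by (rule LIM_zero_cancel)
qed

text \<open>A test function that does not vanish on the sides \<open>x = 0\<close> and \<open>x = L\<close> is cut off there by
  a plateau. The derivative of the plateau consists of two kernels of mass one at the two sides,
  which in the limit pick out the traces of the flow \<open>q\<close>.\<close>

lemma inequality_with_boundary_terms:
  assumes L: "0 < L"
    and [measurable]: "z \<in> borel_measurable borel" "q \<in> borel_measurable borel"
    and bd: "\<And>p. \<bar>z p\<bar> \<le> B" "\<And>p. \<bar>q p\<bar> \<le> B"
    and tr: "has_trace T L q 0 q0" "has_trace T L q L qL"
    and weak: "\<And>\<phi> \<phi>t \<phi>x. test_function ({..<T} \<times> {0<..<L}) \<phi> \<phi>t \<phi>x \<Longrightarrow>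
      0 \<le> (LBINT p:{0..T} \<times> {0..L}. z p * \<phi>t p + q p * \<phi>x p)"
    and \<phi>: "test_function ({..<T} \<times> UNIV) \<phi> \<phi>t \<phi>x"
  shows "0 \<le> (LBINT p:{0..T} \<times> {0..L}. z p * \<phi>t p + q p * \<phi>x p)
    + (LBINT t:{0..T}. q0 t * \<phi> (t, 0)) - (LBINT t:{0..T}. qL t * \<phi> (t, L))"
proof -
  let ?Q = "{0..T} \<times> {0..L}"
  note [measurable] = test_function_measurable[OF \<phi>]
  obtain B' where B': "0 < B'" "\<And>p. \<bar>\<phi> p\<bar> \<le> B'" "\<And>p. \<bar>\<phi>t p\<bar> \<le> B'" "\<And>p. \<bar>\<phi>x p\<bar> \<le> B'"
    using test_function_bounded[OF \<phi>] by metis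
  obtain C where C: "0 < C" "\<And>x. ramp' x \<le> C" using ramp'_bounded by blast
  have B0: "0 \<le> B" using bd(1)[of undefined] by linarith
  (* width of the ramps; 4 * e n \<le> L keeps the two ramps apart *)
  define e where "e n = L / 4 / real (Suc n)" for n
  have e: "0 < e n" "4 * e n \<le> L" for n
    using L by (auto simp: e_def field_simps)
  have e0: "e \<longlonglongrightarrow> 0"
    unfolding e_def using tendsto_mult_left[OF LIMSEQ_Suc[OF lim_1_over_n], of "L / 4"] by simp
  define k where "k n x = ramp' ((x - e n) / e n) / e n" for n x
  define l where "l n x = ramp' ((L - e n - x) / e n) / e n" for n x
  define \<kappa> where "\<kappa> n = plateau (e n) (L - e n) (e n)" for n
  have pl: "0 < e n" "e n + 2 * e n \<le> L - e n" for n using e[of n] by auto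
  have \<kappa>': "plateau' (e n) (L - e n) (e n) x = k n x - l n x" for n x
    by (simp add: plateau'_def k_def l_def)
  have [measurable]: "k n \<in> borel_measurable borel" "l n \<in> borel_measurable borel" "\<kappa> n \<in> borel_measurable borel" for n
    unfolding k_def l_def \<kappa>_def by measurable
  have kl0: "0 \<le> k n x" "0 \<le> l n x" "k n x \<le> 2 * C / (2 * e n)" "l n x \<le> 2 * C / (2 * e n)" for n x
    using ramp'_nonneg C(2) e(1)[of n] by (auto simp: k_def l_def intro!: divide_right_mono)
  have ksupp: "x \<in> {0..L} \<inter> cball 0 (2 * e n)" if "k n x \<noteq> 0" for n x
  proof -
    have "\<not> ((x - e n) / e n \<le> 0 \<or> 1 \<le> (x - e n) / e n)"
      using that ramp'_0[of "(x - e n) / e n"] by (auto simp: k_def)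
    then show ?thesis using e[of n] by (auto simp: dist_real_def divide_le_eq le_divide_eq)
  qed
  have lsupp: "x \<in> {0..L} \<inter> cball L (2 * e n)" if "l n x \<noteq> 0" for n x
  proof -
    have "\<not> ((L - e n - x) / e n \<le> 0 \<or> 1 \<le> (L - e n - x) / e n)"
      using that ramp'_0[of "(L - e n - x) / e n"] by (auto simp: l_def)
    then show ?thesis using e[of n] by (auto simp: dist_real_def divide_le_eq le_divide_eq)
  qed
  have "k n x = ramp' (- 1 + 1 / e n * x) * \<bar>1 / e n\<bar>" "l n x = ramp' ((L - e n) / e n + - 1 / e n * x) * \<bar>- 1 / e n\<bar>" for n x
    using e(1)[of n] by (simp_all add: k_def l_def diff_divide_distrib add_divide_distrib)
  then have kl: "k n = (\<lambda>x. ramp' (- 1 + 1 / e n * x) * \<bar>1 / e n\<bar>)" "l n = (\<lambda>x. ramp' ((L - e n) / e n + - 1 / e n * x) * \<bar>- 1 / e n\<bar>)" for n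
    by blast+
  have nz: "1 / e n \<noteq> 0" "- 1 / e n \<noteq> 0" for n using e(1)[of n] by auto
  have ki: "integrable lborel (k n)" "(LBINT x. k n x) = 1" for n
    using ramp'_rescaled[OF nz(1)[of n], of "- 1"] by (simp_all only: kl)
  have li: "integrable lborel (l n)" "(LBINT x. l n x) = 1" for n
    using ramp'_rescaled[OF nz(2)[of n], of "(L - e n) / e n"] by (simp_all only: kl)
  have e20: "(\<lambda>n. 2 * e n) \<longlonglongrightarrow> 0" using tendsto_mult_left[OF e0, of 2] by simp
  have lim1: "(\<lambda>n. LBINT p:?Q. q p * \<phi> p * k n (snd p)) \<longlonglongrightarrow> (LBINT t:{0..T}. q0 t * \<phi> (t, 0))"
    by (rule trace_kernel_limit[OF _ bd(2) tr(1) \<phi> _ kl0(1) kl0(3) ksupp ki _ e20]) (use e in auto)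
  have lim2: "(\<lambda>n. LBINT p:?Q. q p * \<phi> p * l n (snd p)) \<longlonglongrightarrow> (LBINT t:{0..T}. qL t * \<phi> (t, L))"
    by (rule trace_kernel_limit[OF _ bd(2) tr(2) \<phi> _ kl0(2) kl0(4) lsupp li _ e20]) (use e in auto)
  define J where "J p = z p * \<phi>t p + q p * \<phi>x p" for p
  have [measurable]: "J \<in> borel_measurable borel" unfolding J_def by measurable
  have JB: "\<bar>J p\<bar> \<le> B * B' + B * B'" for p
  proof -
    have "\<bar>z p * \<phi>t p\<bar> \<le> B * B'" unfolding abs_mult by (rule mult_mono[OF bd(1) B'(3) B0]) simp
    moreover have "\<bar>q p * \<phi>x p\<bar> \<le> B * B'" unfolding abs_mult by (rule mult_mono[OF bd(2) B'(4) B0]) simp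
    ultimately show ?thesis unfolding J_def by linarith
  qed
  have \<kappa>01: "0 \<le> \<kappa> n x" "\<kappa> n x \<le> 1" for n x by (auto simp: \<kappa>_def plateau_nonneg plateau_le_1)
  have lim3: "(\<lambda>n. LBINT p:?Q. J p * \<kappa> n (snd p)) \<longlonglongrightarrow> (LBINT p:?Q. J p)"
  proof -
    have "set_integrable lborel ?Q J"
      by (rule bounded_set_integrable[OF _ order_refl rectangle_sets JB]) (simp add: set_borel_measurable_def)
    moreover have "AE p in (lborel :: (real \<times> real) measure). snd p \<noteq> 0 \<and> snd p \<noteq> L"
      using AE_lborel_snd[OF AE_not_in_countable[of "{0, L}"]] by simp
    then have "AE p in lborel. p \<in> ?Q \<longrightarrow> (\<lambda>n. \<kappa> n (snd p)) \<longlonglongrightarrow> 1"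
    proof eventually_elim
      case (elim p)
      show ?case
      proof
        assume "p \<in> ?Q"
        then have x: "0 < snd p" "snd p < L" using elim by (auto simp: mem_Times_iff)
        have "\<forall>\<^sub>F n in sequentially. 2 * e n < min (snd p) (L - snd p)"
          using order_tendstoD(2)[OF e20, of "min (snd p) (L - snd p)"] x by auto
        then have "\<forall>\<^sub>F n in sequentially. \<kappa> n (snd p) = 1"
          by eventually_elim (use pl in \<open>simp add: \<kappa>_def plateau_1\<close>)
        then show "(\<lambda>n. \<kappa> n (snd p)) \<longlonglongrightarrow> 1" by (rule tendsto_eventually)
      qed
    qed
    ultimately have "(\<lambda>n. LBINT p:?Q. J p * \<kappa> n (snd p)) \<longlonglongrightarrow> (LBINT p:?Q. J p * 1)"
      using \<kappa>01 by (intro set_integral_mult_limit) (auto simp: abs_le_iff intro: order_trans[of _ 0])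
    then show ?thesis by simp
  qed
  have "0 \<le> (LBINT p:?Q. J p * \<kappa> n (snd p)) + (LBINT p:?Q. q p * \<phi> p * k n (snd p))
     - (LBINT p:?Q. q p * \<phi> p * l n (snd p))" for n
  proof -
    have "test_function ({..<T} \<times> {0<..<L}) (\<lambda>p. \<phi> p * \<kappa> n (snd p)) (\<lambda>p. \<phi>t p * \<kappa> n (snd p))
      (\<lambda>p. \<phi>x p * \<kappa> n (snd p) + \<phi> p * (k n (snd p) - l n (snd p)))"
      unfolding \<kappa>'[symmetric] \<kappa>_def
      by (rule test_function_mult_cutoff[OF \<phi> plateau_deriv[OF pl] continuous_on_plateau'[OF pl] plateau_nonneg,
            where c="e n" and d="L - e n"])
        (use pl[of n] in \<open>auto intro: plateau_0\<close>)
    from weak[OF this]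
    have pos: "0 \<le> (LBINT p:?Q. J p * \<kappa> n (snd p) + q p * \<phi> p * k n (snd p) - q p * \<phi> p * l n (snd p))"
      by (simp add: J_def algebra_simps)
    have s1: "set_integrable lborel ?Q (\<lambda>p. J p * \<kappa> n (snd p))"
    proof (rule bounded_set_integrable[OF _ order_refl rectangle_sets])
      show "set_borel_measurable borel ?Q (\<lambda>p. J p * \<kappa> n (snd p))"
        unfolding set_borel_measurable_def by measurable
      fix p
      show "\<bar>J p * \<kappa> n (snd p)\<bar> \<le> (B * B' + B * B') * 1"
        unfolding abs_mult[of "J p"] using \<kappa>01[where x="snd p"] B0 B'(1) by (intro mult_mono JB) auto
    qed
    have s: "set_integrable lborel ?Q (\<lambda>p. q p * \<phi> p * r (snd p))"
      if r: "\<And>x. 0 \<le> r x" "\<And>x. r x \<le> D" and [measurable]: "r \<in> borel_measurable borel" for r :: "real \<Rightarrow> real" and D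
    proof (rule bounded_set_integrable[OF _ order_refl rectangle_sets])
      show "set_borel_measurable borel ?Q (\<lambda>p. q p * \<phi> p * r (snd p))"
        unfolding set_borel_measurable_def by measurable
      fix p
      have "\<bar>q p * \<phi> p\<bar> \<le> B * B'" unfolding abs_mult by (rule mult_mono[OF bd(2) B'(2) B0]) simp
      moreover have "\<bar>r (snd p)\<bar> \<le> D" using r by simp
      ultimately show "\<bar>q p * \<phi> p * r (snd p)\<bar> \<le> B * B' * D"
        unfolding abs_mult[of "q p * \<phi> p"] using B0 B'(1) by (intro mult_mono) auto
    qed
    have s2: "set_integrable lborel ?Q (\<lambda>p. q p * \<phi> p * k n (snd p))"
      by (rule s[where r="k n", OF kl0(1,3)]) measurable
    have s3: "set_integrable lborel ?Q (\<lambda>p. q p * \<phi> p * l n (snd p))"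
      by (rule s[where r="l n", OF kl0(2,4)]) measurable
    from pos show ?thesis
      unfolding set_integral_diff(2)[OF set_integral_add(1)[OF s1 s2] s3] set_integral_add(2)[OF s1 s2] .
  qed
  note nonneg = this
  have "0 \<le> (LBINT p:?Q. J p) + (LBINT t:{0..T}. q0 t * \<phi> (t, 0)) - (LBINT t:{0..T}. qL t * \<phi> (t, L))"
    by (rule LIMSEQ_le_const[OF tendsto_diff[OF tendsto_add[OF lim3 lim1] lim2]])
      (intro exI allI impI nonneg)
  then show ?thesis by (simp add: J_def)
qed

section \<open>Uniqueness of the outflow\<close>

lemma set_integrable_mult_test:
  fixes f \<psi> :: "real \<times> real \<Rightarrow> real"
  assumes [measurable]: "f \<in> borel_measurable borel" "\<psi> \<in> borel_measurable borel"
    and b: "\<And>p. \<bar>f p\<bar> \<le> A" "\<And>p. \<bar>\<psi> p\<bar> \<le> B"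
  shows "set_integrable lborel ({0..T :: real} \<times> {0..L :: real}) (\<lambda>p. f p * \<psi> p)"
proof (rule bounded_set_integrable[OF _ order_refl rectangle_sets])
  show "set_borel_measurable borel ({0..T} \<times> {0..L}) (\<lambda>p. f p * \<psi> p)"
    unfolding set_borel_measurable_def by measurable
  have "0 \<le> A" using b(1)[of undefined] by linarith
  then show "\<bar>f p * \<psi> p\<bar> \<le> A * B" for p
    unfolding abs_mult using b by (intro mult_mono) auto
qed

text \<open>Two densities occur in the hypotheses so that the difference of two solutions is covered;
  a function of one solution is treated by taking both equal.\<close>

lemma has_trace_dominated:
  assumes tr: "has_trace T L \<rho>1 x0 g1" "has_trace T L \<rho>2 x0 g2"
    and meas: "\<rho>1 \<in> borel_measurable borel" "\<rho>2 \<in> borel_measurable borel"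
    and b: "\<And>p. \<bar>\<rho>1 p\<bar> \<le> B" "\<And>p. \<bar>\<rho>2 p\<bar> \<le> B"
    and g: "set_integrable lborel {0..T} g"
    and dom: "AE p in lborel. p \<in> {0..T} \<times> {0..L} \<longrightarrow>
      \<bar>q p - g (fst p)\<bar> \<le> M * (\<bar>\<rho>1 p - g1 (fst p)\<bar> + \<bar>\<rho>2 p - g2 (fst p)\<bar>)" and M: "0 \<le> M"
  shows "has_trace T L q x0 g"
proof -
  let ?S = "\<lambda>e. {0..T} \<times> ({0..L} \<inter> cball x0 e)"
  let ?I = "\<lambda>q g e. LBINT p:?S e. \<bar>q p - g (fst p)\<bar>"
  have g12: "set_integrable lborel {0..T} g1" "set_integrable lborel {0..T} g2"
    and lim: "((\<lambda>e. ?I \<rho>1 g1 e / e) \<longlongrightarrow> 0) (at_right 0)" "((\<lambda>e. ?I \<rho>2 g2 e / e) \<longlongrightarrow> 0) (at_right 0)"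
    using tr unfolding has_trace_def by blast+
  have le: "\<bar>?I q g e / e\<bar> \<le> M * (?I \<rho>1 g1 e / e + ?I \<rho>2 g2 e / e)" if e: "0 < e" for e
  proof -
    have int: "set_integrable lborel (?S e) (\<lambda>p. \<bar>\<rho>1 p - g1 (fst p)\<bar>)" "set_integrable lborel (?S e) (\<lambda>p. \<bar>\<rho>2 p - g2 (fst p)\<bar>)"
      using meas b g12 by (auto intro!: trace_difference_integrable simp: set_borel_measurable_def)
    have "?I q g e \<le> (LBINT p:?S e. M * (\<bar>\<rho>1 p - g1 (fst p)\<bar> + \<bar>\<rho>2 p - g2 (fst p)\<bar>))"
      unfolding set_lebesgue_integral_def
    proof (rule integral_mono_AE')
      show "integrable lborel (\<lambda>p. indicator (?S e) p *\<^sub>R (M * (\<bar>\<rho>1 p - g1 (fst p)\<bar> + \<bar>\<rho>2 p - g2 (fst p)\<bar>)))"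
        using set_integrable_mult_right[OF set_integral_add(1)[OF int], of M] unfolding set_integrable_def by simp
      show "AE p in lborel. indicator (?S e) p *\<^sub>R \<bar>q p - g (fst p)\<bar>
          \<le> indicator (?S e) p *\<^sub>R (M * (\<bar>\<rho>1 p - g1 (fst p)\<bar> + \<bar>\<rho>2 p - g2 (fst p)\<bar>))"
        using dom by eventually_elim (auto simp: indicator_def)
    qed (use M in auto)
    then have "?I q g e \<le> M * (?I \<rho>1 g1 e + ?I \<rho>2 g2 e)"
      using set_integral_add(2)[OF int] by simp
    moreover have "0 \<le> ?I q g e"
      unfolding set_lebesgue_integral_def by (intro Bochner_Integration.integral_nonneg) auto
    ultimately have "\<bar>?I q g e / e\<bar> \<le> M * (?I \<rho>1 g1 e + ?I \<rho>2 g2 e) / e"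
      using e by (simp add: divide_right_mono)
    then show ?thesis by (simp only: add_divide_distrib times_divide_eq_right distrib_left)
  qed
  have "((\<lambda>e. M * (?I \<rho>1 g1 e / e + ?I \<rho>2 g2 e / e)) \<longlongrightarrow> M * (0 + 0)) (at_right 0)"
    by (intro tendsto_intros lim)
  moreover have "\<forall>\<^sub>F e in at_right 0. norm (?I q g e / e) \<le> M * (?I \<rho>1 g1 e / e + ?I \<rho>2 g2 e / e)"
    unfolding eventually_at_right_field real_norm_def by (rule exI[of _ 1]) (use le in auto)
  ultimately have "((\<lambda>e. ?I q g e / e) \<longlongrightarrow> 0) (at_right 0)"
    by (intro Lim_null_comparison[where f="\<lambda>e. ?I q g e / e" and g="\<lambda>e. M * (?I \<rho>1 g1 e / e + ?I \<rho>2 g2 e / e)"]) simp_all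
  then show ?thesis unfolding has_trace_def using g by blast
qed

text \<open>Only the values on the rectangle matter, so that a solution may be taken to vanish outside it;
  it is then a bounded Borel function on the whole plane.\<close>

lemma traffic_solution_zero_extension:
  assumes "traffic_solution T L \<rho>cr \<rho>max \<rho>0 In v \<rho> r" "0 \<le> \<rho>max"
  obtains \<rho>' where "traffic_solution T L \<rho>cr \<rho>max \<rho>0 In v \<rho>' r"
    "\<rho>' \<in> borel_measurable borel" "\<And>p. 0 \<le> \<rho>' p" "\<And>p. \<rho>' p \<le> \<rho>max"
proof -
  let ?Q = "{0..T} \<times> {0..L}"
  define \<rho>' where "\<rho>' p = indicator ?Q p *\<^sub>R \<rho> p" for p
  have eq: "\<rho>' p = \<rho> p" if "p \<in> ?Q" for p using that by (simp add: \<rho>'_def)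
  have kr: "kruzhkov_entropy_solution T L \<rho>cr \<rho>max \<rho>0 v \<rho>"
    using assms(1) by (simp add: traffic_solution_def)
  have m: "\<rho>' \<in> borel_measurable borel" and r: "\<rho> ` ?Q \<subseteq> {0..\<rho>max}"
    using kr by (auto simp: kruzhkov_entropy_solution_def set_borel_measurable_def \<rho>'_def[abs_def])
  have range: "0 \<le> \<rho>' p" "\<rho>' p \<le> \<rho>max" for p
    using r assms(2) by (auto simp: \<rho>'_def indicator_def image_subset_iff)
  have cong: "(LBINT p:?Q. F (\<rho>' p) p) = (LBINT p:?Q. F (\<rho> p) p)" for F :: "real \<Rightarrow> real \<times> real \<Rightarrow> real"
    unfolding set_lebesgue_integral_def
    by (rule Bochner_Integration.integral_cong) (auto simp: indicator_def eq)
  have tr: "has_trace T L \<rho>' x g \<longleftrightarrow> has_trace T L \<rho> x g" for x g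
  proof -
    have "(LBINT p:{0..T} \<times> ({0..L} \<inter> cball x e). \<bar>\<rho>' p - g (fst p)\<bar>)
      = (LBINT p:{0..T} \<times> ({0..L} \<inter> cball x e). \<bar>\<rho> p - g (fst p)\<bar>)" for e
      unfolding set_lebesgue_integral_def
      by (rule Bochner_Integration.integral_cong) (auto simp: indicator_def eq)
    then show ?thesis unfolding has_trace_def by simp
  qed
  have "kruzhkov_entropy_solution T L \<rho>cr \<rho>max \<rho>0 v \<rho>'"
    unfolding kruzhkov_entropy_solution_def
  proof (intro conjI ballI allI impI)
    fix k \<phi> \<phi>t \<phi>x
    assume "k \<in> {0..\<rho>max}" "test_function ({..<T} \<times> {0<..<L}) \<phi> \<phi>t \<phi>x"
    then show "0 \<le> (LBINT p:?Q. \<bar>\<rho>' p - k\<bar> * \<phi>t p +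
          sgn (\<rho>' p - k) * (flux \<rho>cr \<rho>max (\<rho>' p) (v (fst p)) - flux \<rho>cr \<rho>max k (v (fst p))) * \<phi>x p) +
        (LBINT x:{0..L}. \<bar>\<rho>0 x - k\<bar> * \<phi> (0, x))"
      using kr cong[of "\<lambda>u p. \<bar>u - k\<bar> * \<phi>t p +
          sgn (u - k) * (flux \<rho>cr \<rho>max u (v (fst p)) - flux \<rho>cr \<rho>max k (v (fst p))) * \<phi>x p"]
      unfolding kruzhkov_entropy_solution_def by simp
  qed (use m range in \<open>auto simp: set_borel_measurable_def\<close>)
  then have "traffic_solution T L \<rho>cr \<rho>max \<rho>0 In v \<rho>' r"
    using assms(1) tr by (simp add: traffic_solution_def)
  then show thesis using m range by (rule that)
qed

lemma flux_le_critical: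
  assumes "0 \<le> \<rho>" "\<rho> \<le> \<rho>max" "0 \<le> \<rho>cr" "\<rho>cr < \<rho>max" "0 \<le> w"
  shows "0 \<le> flux \<rho>cr \<rho>max \<rho> w" "flux \<rho>cr \<rho>max \<rho> w \<le> \<rho>cr * w"
proof -
  have "w * \<rho>cr / (\<rho>max - \<rho>cr) * (\<rho>max - \<rho>) \<le> w * \<rho>cr / (\<rho>max - \<rho>cr) * (\<rho>max - \<rho>cr)" if "\<rho>cr < \<rho>"
    using assms that by (intro mult_left_mono) auto
  then have "w * \<rho>cr / (\<rho>max - \<rho>cr) * (\<rho>max - \<rho>) \<le> \<rho>cr * w" if "\<rho>cr < \<rho>"
    using assms that by (simp add: mult.commute)
  then show "0 \<le> flux \<rho>cr \<rho>max \<rho> w" "flux \<rho>cr \<rho>max \<rho> w \<le> \<rho>cr * w"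
    using assms by (auto simp: flux_def intro!: mult_nonneg_nonneg mult_right_mono)
qed

locale inflow_problem = bv_speed +
  fixes T L \<rho>cr \<rho>max :: real and \<rho>0 :: "real \<Rightarrow> real"
  assumes T_pos: "0 < T" and L_pos: "0 < L" and cr_pos: "0 < \<rho>cr" and cr_less: "\<rho>cr < \<rho>max"
    and \<rho>0_measurable [measurable]: "\<rho>0 \<in> borel_measurable borel"
    and \<rho>0_range: "\<And>x. 0 \<le> \<rho>0 x" "\<And>x. \<rho>0 x \<le> \<rho>cr"
begin

abbreviation "Q \<equiv> {0..T} \<times> {0..L}"

text \<open>Above the critical density, the derivative of the flux with respect to the density is
  \<open>- congested_slope * v\<close>.\<close>

definition congested_slope :: real where
  "congested_slope = \<rho>cr / (\<rho>max - \<rho>cr)"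

text \<open>The constant density \<open>1\<close> is transported by every speed, in particular by \<open>0\<close> and by \<open>v\<close>.\<close>

lemma test_integrals:
  assumes \<phi>: "test_function ({..<T} \<times> {0<..<L}) \<phi> \<phi>t \<phi>x"
  shows "set_integrable lborel Q \<phi>t" "(LBINT p:Q. \<phi>t p) = - (LBINT x:{0..L}. \<phi> (0, x))"
    "set_integrable lborel Q (\<lambda>p. v (fst p) * \<phi>x p)" "(LBINT p:Q. v (fst p) * \<phi>x p) = 0"
proof -
  show 0: "set_integrable lborel Q \<phi>t" "(LBINT p:Q. \<phi>t p) = - (LBINT x:{0..L}. \<phi> (0, x))"
    using transported_test_integral[OF \<phi>, of "\<lambda>_. 0" 0 "{}" "\<lambda>_. 0" "\<lambda>_. 1" 1] T_pos by auto
  have 1: "set_integrable lborel Q (\<lambda>p. \<phi>t p + v (fst p) * \<phi>x p)"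
    "(LBINT p:Q. \<phi>t p + v (fst p) * \<phi>x p) = - (LBINT x:{0..L}. \<phi> (0, x))"
    using transported_test_integral[OF \<phi> less_imp_le[OF T_pos] V_Lipschitz V_0
        variation_bound_countable_discont[OF v_var] V_deriv v_measurable v_abs_le, of "\<lambda>_. 1" 1] by auto
  have "(\<lambda>p. v (fst p) * \<phi>x p) = (\<lambda>p. (\<phi>t p + v (fst p) * \<phi>x p) - \<phi>t p)" by auto
  then show "set_integrable lborel Q (\<lambda>p. v (fst p) * \<phi>x p)" "(LBINT p:Q. v (fst p) * \<phi>x p) = 0"
    using set_integral_diff[OF 1(1) 0(1)] 1(2) 0(2) by simp_all
qed

lemma initial_integrable:
  assumes \<phi>: "test_function U \<phi> \<phi>t \<phi>x"
  shows "set_integrable lborel {0..L} (\<lambda>x. \<rho>0 x * \<phi> (0, x))" "set_integrable lborel {0..L} (\<lambda>x. \<phi> (0, x))"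
proof -
  obtain B where B: "0 < B" "\<And>p. \<bar>\<phi> p\<bar> \<le> B"
    using test_function_bounded[OF \<phi>] by metis
  have [measurable]: "(\<lambda>x. \<phi> (0, x)) \<in> borel_measurable borel"
    by (rule measurable_compose[OF _ test_function_measurable(1)[OF \<phi>]]) measurable
  show "set_integrable lborel {0..L} (\<lambda>x. \<phi> (0, x))"
    by (rule bounded_set_integrable_Icc[where B=B]) (use B in auto)
  show "set_integrable lborel {0..L} (\<lambda>x. \<rho>0 x * \<phi> (0, x))"
  proof (rule bounded_set_integrable_Icc[where B="\<rho>cr * B"])
    show "\<bar>\<rho>0 x * \<phi> (0, x)\<bar> \<le> \<rho>cr * B" for x
      unfolding abs_mult using \<rho>0_range B cr_pos by (intro mult_mono) auto
  qed measurable
qed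

context
  fixes \<rho>
  assumes kr: "kruzhkov_entropy_solution T L \<rho>cr \<rho>max \<rho>0 v \<rho>"
    and \<rho>_measurable [measurable]: "\<rho> \<in> borel_measurable borel"
    and \<rho>_range: "\<And>p. 0 \<le> \<rho> p" "\<And>p. \<rho> p \<le> \<rho>max"
begin

lemma entropy_inequality:
  assumes "k \<in> {0..\<rho>max}" "test_function ({..<T} \<times> {0<..<L}) \<phi> \<phi>t \<phi>x"
  shows "0 \<le> (LBINT p:Q. \<bar>\<rho> p - k\<bar> * \<phi>t p +
      sgn (\<rho> p - k) * (flux \<rho>cr \<rho>max (\<rho> p) (v (fst p)) - flux \<rho>cr \<rho>max k (v (fst p))) * \<phi>x p) +
    (LBINT x:{0..L}. \<bar>\<rho>0 x - k\<bar> * \<phi> (0, x))"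
  using kr assms unfolding kruzhkov_entropy_solution_def by blast

lemma flux_measurable [measurable]: "(\<lambda>p. flux \<rho>cr \<rho>max (\<rho> p) (v (fst p))) \<in> borel_measurable borel"
  unfolding flux_def by measurable

lemma flux_bounded: "\<bar>flux \<rho>cr \<rho>max (\<rho> p) (v (fst p))\<bar> \<le> \<rho>cr * vmax"
proof -
  have "\<rho>cr * v (fst p) \<le> \<rho>cr * vmax" using cr_pos v_le by simp
  then show ?thesis
    using flux_le_critical[OF \<rho>_range less_imp_le[OF cr_pos] cr_less less_imp_le[OF v_pos], of p "fst p"]
    unfolding abs_le_iff by linarith
qed

lemma flow_integrable:
  assumes \<phi>: "test_function U \<phi> \<phi>t \<phi>x"
  shows "set_integrable lborel Q (\<lambda>p. \<rho> p * \<phi>t p + flux \<rho>cr \<rho>max (\<rho> p) (v (fst p)) * \<phi>x p)"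
proof -
  note [measurable] = test_function_measurable[OF \<phi>]
  obtain B where B: "\<And>p. \<bar>\<phi>t p\<bar> \<le> B" "\<And>p. \<bar>\<phi>x p\<bar> \<le> B"
    using test_function_bounded[OF \<phi>] by metis
  have "set_integrable lborel Q (\<lambda>p. \<rho> p * \<phi>t p)"
    by (rule set_integrable_mult_test[where A=\<rho>max and B=B]) (use B \<rho>_range in auto)
  moreover have "set_integrable lborel Q (\<lambda>p. flux \<rho>cr \<rho>max (\<rho> p) (v (fst p)) * \<phi>x p)"
    by (rule set_integrable_mult_test[OF _ _ flux_bounded B(2)]) measurable
  ultimately show ?thesis by (rule set_integral_add(1))
qed

text \<open>The entropy inequalities for the two extreme constants \<open>0\<close> and \<open>\<rho>max\<close> are linear in the
  solution, with opposite signs.\<close>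

lemma weak_solution:
  assumes \<phi>: "test_function ({..<T} \<times> {0<..<L}) \<phi> \<phi>t \<phi>x"
  shows "(LBINT p:Q. \<rho> p * \<phi>t p + flux \<rho>cr \<rho>max (\<rho> p) (v (fst p)) * \<phi>x p)
    = - (LBINT x:{0..L}. \<rho>0 x * \<phi> (0, x))"
proof (rule antisym)
  let ?F = "\<lambda>p. flux \<rho>cr \<rho>max (\<rho> p) (v (fst p))"
  have e0: "\<bar>\<rho> p - 0\<bar> * \<phi>t p + sgn (\<rho> p - 0) * (?F p - flux \<rho>cr \<rho>max 0 (v (fst p))) * \<phi>x p
      = \<rho> p * \<phi>t p + ?F p * \<phi>x p" for p
    using \<rho>_range[of p] cr_pos by (cases "\<rho> p = 0") (auto simp: flux_def)
  have a0: "\<bar>\<rho>0 x - 0\<bar> * \<phi> (0, x) = \<rho>0 x * \<phi> (0, x)" for x using \<rho>0_range[of x] by simp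
  from entropy_inequality[of 0, OF _ \<phi>] cr_pos cr_less
  show "- (LBINT x:{0..L}. \<rho>0 x * \<phi> (0, x)) \<le> (LBINT p:Q. \<rho> p * \<phi>t p + ?F p * \<phi>x p)"
    unfolding e0 a0 by simp
  have e1: "\<bar>\<rho> p - \<rho>max\<bar> * \<phi>t p + sgn (\<rho> p - \<rho>max) * (?F p - flux \<rho>cr \<rho>max \<rho>max (v (fst p))) * \<phi>x p
      = \<rho>max * \<phi>t p - (\<rho> p * \<phi>t p + ?F p * \<phi>x p)" for p
    using \<rho>_range[of p] cr_less by (cases "\<rho> p = \<rho>max") (auto simp: flux_def algebra_simps)
  have a1: "\<bar>\<rho>0 x - \<rho>max\<bar> * \<phi> (0, x) = \<rho>max * \<phi> (0, x) - \<rho>0 x * \<phi> (0, x)" for x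
    using \<rho>0_range[of x] cr_less by (simp add: algebra_simps)
  have "(LBINT x:{0..L}. \<rho>max * \<phi> (0, x) - \<rho>0 x * \<phi> (0, x))
      = \<rho>max * (LBINT x:{0..L}. \<phi> (0, x)) - (LBINT x:{0..L}. \<rho>0 x * \<phi> (0, x))"
    by (subst set_integral_diff(2)) (use initial_integrable[OF \<phi>] in auto)
  moreover have "(LBINT p:Q. \<rho>max * \<phi>t p - (\<rho> p * \<phi>t p + ?F p * \<phi>x p))
      = \<rho>max * (LBINT p:Q. \<phi>t p) - (LBINT p:Q. \<rho> p * \<phi>t p + ?F p * \<phi>x p)"
    by (subst set_integral_diff(2)) (use test_integrals[OF \<phi>] flow_integrable[OF \<phi>] in auto)
  ultimately show "(LBINT p:Q. \<rho> p * \<phi>t p + ?F p * \<phi>x p) \<le> - (LBINT x:{0..L}. \<rho>0 x * \<phi> (0, x))"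
    using entropy_inequality[of \<rho>max, OF _ \<phi>] cr_pos cr_less test_integrals(2)[OF \<phi>]
    unfolding e1 a1 by simp
qed

definition excess :: "real \<times> real \<Rightarrow> real" where
  "excess p = max 0 (\<rho> p - \<rho>cr)"

lemma excess_measurable [measurable]: "excess \<in> borel_measurable borel"
  unfolding excess_def by measurable

lemma excess_range: "0 \<le> excess p" "\<bar>excess p\<bar> \<le> \<rho>max"
  using \<rho>_range[of p] cr_pos cr_less by (auto simp: excess_def)

lemma backward_speed: "0 < congested_slope" "\<bar>- (congested_slope * v t)\<bar> \<le> congested_slope * vmax"
proof -
  show c: "0 < congested_slope" using cr_pos cr_less by (simp add: congested_slope_def)
  then show "\<bar>- (congested_slope * v t)\<bar> \<le> congested_slope * vmax" using v_abs_le[of t] by (simp add: abs_mult)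
qed

lemma congested_bound_nonneg: "0 \<le> congested_slope * vmax"
  using backward_speed(1) vmax_pos by simp

text \<open>The entropy inequality for \<open>\<rho>cr\<close> combined with the weak equation: in the sum of
  \<open>\<bar>\<rho> - \<rho>cr\<bar>\<close> and \<open>\<rho> - \<rho>cr\<close> the values below the critical density cancel. What is left is
  transported with a negative speed.\<close>

lemma excess_subsolution:
  assumes \<phi>: "test_function ({..<T} \<times> {0<..<L}) \<phi> \<phi>t \<phi>x"
  shows "0 \<le> (LBINT p:Q. excess p * \<phi>t p + - (congested_slope * v (fst p)) * excess p * \<phi>x p)"
proof -
  let ?F = "\<lambda>p. flux \<rho>cr \<rho>max (\<rho> p) (v (fst p))"
  let ?E = "\<lambda>p. \<bar>\<rho> p - \<rho>cr\<bar> * \<phi>t p + sgn (\<rho> p - \<rho>cr) * (?F p - flux \<rho>cr \<rho>max \<rho>cr (v (fst p))) * \<phi>x p"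
  let ?u = "\<lambda>p. excess p * \<phi>t p + - (congested_slope * v (fst p)) * excess p * \<phi>x p"
  note [measurable] = test_function_measurable[OF \<phi>]
  obtain B where B: "\<And>p. \<bar>\<phi>t p\<bar> \<le> B" "\<And>p. \<bar>\<phi>x p\<bar> \<le> B"
    using test_function_bounded[OF \<phi>] by metis
  have u: "set_integrable lborel Q ?u"
  proof (rule set_integral_add(1))
    show "set_integrable lborel Q (\<lambda>p. excess p * \<phi>t p)"
      by (rule set_integrable_mult_test[OF _ _ excess_range(2) B(1)]) measurable
    have "\<bar>- (congested_slope * v (fst p)) * excess p\<bar> \<le> congested_slope * vmax * \<rho>max" for p
      unfolding abs_mult[of "- _"] using backward_speed(1) backward_speed(2)[of "fst p"] excess_range[of p] congested_bound_nonneg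
      by (intro mult_mono) auto
    then show "set_integrable lborel Q (\<lambda>p. - (congested_slope * v (fst p)) * excess p * \<phi>x p)"
      by (intro set_integrable_mult_test[OF _ _ _ B(2)]) measurable
  qed
  (* twice the excess is the sum of \<bar>\<rho> - \<rho>cr\<bar> and \<rho> - \<rho>cr, and likewise for the fluxes *)
  have pt: "?E p = 2 * ?u p + \<rho>cr * (\<phi>t p + v (fst p) * \<phi>x p) - (\<rho> p * \<phi>t p + ?F p * \<phi>x p)" for p
  proof -
    have Fcr: "flux \<rho>cr \<rho>max \<rho>cr (v (fst p)) = \<rho>cr * v (fst p)" by (simp add: flux_def)
    consider "\<rho> p < \<rho>cr" | "\<rho> p = \<rho>cr" | "\<rho>cr < \<rho> p" by linarith
    then show ?thesis
    proof cases
      case 1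
      then show ?thesis by (simp add: Fcr excess_def flux_def[of _ _ "\<rho> p"] algebra_simps)
    next
      case 2
      then show ?thesis by (simp add: Fcr excess_def algebra_simps)
    next
      case 3
      have F: "?F p = \<rho>cr * v (fst p) - congested_slope * v (fst p) * (\<rho> p - \<rho>cr)"
        using 3 cr_less by (simp add: flux_def congested_slope_def field_simps)
      have "\<bar>\<rho> p - \<rho>cr\<bar> = \<rho> p - \<rho>cr" "sgn (\<rho> p - \<rho>cr) = 1" "excess p = \<rho> p - \<rho>cr"
        using 3 by (simp_all add: excess_def)
      then show ?thesis by (simp only: F Fcr) (simp add: algebra_simps)
    qed
  qed
  have "set_integrable lborel Q (\<lambda>p. \<phi>t p + v (fst p) * \<phi>x p)"
    using test_integrals(1,3)[OF \<phi>] by (rule set_integral_add(1))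
  then have s1: "set_integrable lborel Q (\<lambda>p. \<rho>cr * (\<phi>t p + v (fst p) * \<phi>x p))" by simp
  have s2: "set_integrable lborel Q (\<lambda>p. 2 * ?u p)" using u by (rule set_integrable_mult_right)
  have "(LBINT p:Q. ?E p) = 2 * (LBINT p:Q. ?u p) + \<rho>cr * (LBINT p:Q. \<phi>t p + v (fst p) * \<phi>x p)
      - (LBINT p:Q. \<rho> p * \<phi>t p + ?F p * \<phi>x p)"
    unfolding pt set_integral_diff(2)[OF set_integral_add(1)[OF s2 s1] flow_integrable[OF \<phi>]]
      set_integral_add(2)[OF s2 s1] by (simp only: set_integral_mult_right)
  moreover have "(LBINT p:Q. \<phi>t p + v (fst p) * \<phi>x p) = - (LBINT x:{0..L}. \<phi> (0, x))"
    unfolding set_integral_add(2)[OF test_integrals(1,3)[OF \<phi>]] test_integrals(2,4)[OF \<phi>] by simp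
  moreover have "(LBINT x:{0..L}. \<bar>\<rho>0 x - \<rho>cr\<bar> * \<phi> (0, x))
      = \<rho>cr * (LBINT x:{0..L}. \<phi> (0, x)) - (LBINT x:{0..L}. \<rho>0 x * \<phi> (0, x))"
  proof -
    have "\<bar>\<rho>0 x - \<rho>cr\<bar> * \<phi> (0, x) = \<rho>cr * \<phi> (0, x) - \<rho>0 x * \<phi> (0, x)" for x
      using \<rho>0_range[of x] by (simp add: algebra_simps)
    then show ?thesis
      by (simp only:) (subst set_integral_diff(2), use initial_integrable[OF \<phi>] in auto)
  qed
  ultimately show ?thesis
    using entropy_inequality[of \<rho>cr, OF _ \<phi>] weak_solution[OF \<phi>] cr_pos cr_less by simp
qed

text \<open>The excess over the critical density travels to the left. It is zero initially, and nothing
  enters on the right, so testing with a decreasing function of time shows that it vanishes.\<close>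

lemma free_flow:
  assumes tr: "has_trace T L \<rho> 0 g0" "has_trace T L \<rho> L gL"
    and g: "AE t in lborel. t \<in> {0..T} \<longrightarrow> g0 t \<le> \<rho>cr" "AE t in lborel. t \<in> {0..T} \<longrightarrow> gL t \<le> \<rho>cr"
  shows "AE p in lborel. p \<in> Q \<longrightarrow> \<rho> p \<le> \<rho>cr"
proof -
  let ?q = "\<lambda>p. - (congested_slope * v (fst p)) * excess p"
  have qb: "\<bar>?q p\<bar> \<le> congested_slope * vmax * excess p" for p
    unfolding abs_mult[of "- _"] using backward_speed(1) backward_speed(2)[of "fst p"] excess_range[of p] congested_bound_nonneg
    by (intro mult_mono) auto
  have zero: "has_trace T L ?q x0 (\<lambda>_. 0)"
    if "has_trace T L \<rho> x0 g" "AE t in lborel. t \<in> {0..T} \<longrightarrow> g t \<le> \<rho>cr" for x0 g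
  proof (rule has_trace_dominated[OF that(1) that(1), where B=\<rho>max and M="congested_slope * vmax"])
    show "AE p in lborel. p \<in> Q \<longrightarrow> \<bar>?q p - 0\<bar> \<le> congested_slope * vmax * (\<bar>\<rho> p - g (fst p)\<bar> + \<bar>\<rho> p - g (fst p)\<bar>)"
      using AE_lborel_fst[OF that(2)]
    proof eventually_elim
      case (elim p)
      show ?case
      proof
        assume "p \<in> Q"
        then have "g (fst p) \<le> \<rho>cr" using elim by (auto simp: mem_Times_iff)
        then have "\<rho> p - \<rho>cr \<le> \<bar>\<rho> p - g (fst p)\<bar>" by linarith
        then have "excess p \<le> \<bar>\<rho> p - g (fst p)\<bar> + \<bar>\<rho> p - g (fst p)\<bar>"
          by (intro order_trans[OF _ add_increasing2[OF abs_ge_zero order_refl]]) (simp add: excess_def)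
        then have "congested_slope * vmax * excess p \<le> congested_slope * vmax * (\<bar>\<rho> p - g (fst p)\<bar> + \<bar>\<rho> p - g (fst p)\<bar>)"
          using backward_speed(1) vmax_pos by (intro mult_left_mono) auto
        then show "\<bar>?q p - 0\<bar> \<le> congested_slope * vmax * (\<bar>\<rho> p - g (fst p)\<bar> + \<bar>\<rho> p - g (fst p)\<bar>)"
          using qb[of p] by simp
      qed
    qed
    show "set_integrable lborel {0..T} (\<lambda>_. 0 :: real)" by (rule set_integrable_Icc_const)
    show "0 \<le> congested_slope * vmax" using backward_speed(1) vmax_pos by simp
  qed (use \<rho>_range in auto)
  have *: "AE p in lborel. p \<in> Q \<longrightarrow> 0 < fst p \<longrightarrow> fst p < \<delta> \<longrightarrow> \<rho> p \<le> \<rho>cr" if \<delta>: "0 < \<delta>" "\<delta> < T" for \<delta>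
  proof -
    (* \<alpha> decreases strictly on the interval from 0 to \<delta>, and \<beta> is constant on [0, L] *)
    define \<alpha> where "\<alpha> = plateau (- \<delta>) \<delta> \<delta>"
    define \<alpha>' where "\<alpha>' = plateau' (- \<delta>) \<delta> \<delta>"
    define \<beta> where "\<beta> = plateau (- 2) (L + 2) 1"
    define \<beta>' where "\<beta>' = plateau' (- 2) (L + 2) 1"
    have d: "0 < \<delta>" "- \<delta> + 2 * \<delta> \<le> \<delta>" "0 < (1::real)" "- 2 + 2 * 1 \<le> L + 2" using \<delta> L_pos by auto
    have \<alpha>: "(\<alpha> has_real_derivative \<alpha>' t) (at t)" "continuous_on UNIV \<alpha>'" "0 \<le> \<alpha> t" for t
      unfolding \<alpha>_def \<alpha>'_def using plateau_deriv[OF d(1,2)] continuous_on_plateau'[OF d(1,2)] plateau_nonneg by auto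
    have \<beta>: "(\<beta> has_real_derivative \<beta>' t) (at t)" "continuous_on UNIV \<beta>'" "0 \<le> \<beta> t" for t
      unfolding \<beta>_def \<beta>'_def using plateau_deriv[OF d(3,4)] continuous_on_plateau'[OF d(3,4)] plateau_nonneg by auto
    have \<beta>1: "\<beta> x = 1" "\<beta>' x = 0" if "x \<in> {0..L}" for x
      using that plateau_1[OF d(3,4), of x] plateau'_0[OF d(3,4), of x] by (auto simp: \<beta>_def \<beta>'_def)
    have \<alpha>'0: "\<alpha>' t \<le> 0" if "0 \<le> t" for t
      using that plateau'_neg[OF d(1,2), of t] plateau'_0[OF d(1,2), of t]
      by (cases "0 < t \<and> t < \<delta>") (auto simp: \<alpha>'_def)
    have m0: "((\<lambda>_::real. 0) has_real_derivative (\<lambda>_. 0) t) (at t)" for t by simp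
    have "test_function ({..<T} \<times> UNIV) (\<lambda>(t, x). \<alpha> t * \<beta> (x - 0))
      (\<lambda>(t, x). \<alpha>' t * \<beta> (x - 0) - \<alpha> t * \<beta>' (x - 0) * 0) (\<lambda>(t, x). \<alpha> t * \<beta>' (x - 0))"
      by (rule test_function_transported_product[OF \<alpha> \<beta> m0, where a="- \<delta>" and b=\<delta> and c="- 2" and d="L + 2"])
        (use plateau_0[OF d(1,2)] plateau_0[OF d(3,4)] \<delta> in \<open>auto simp: \<alpha>_def \<beta>_def\<close>)
    note tf = this[simplified]
    have "\<bar>?q p\<bar> \<le> max \<rho>max (congested_slope * vmax * \<rho>max)" for p
      using order_trans[OF qb mult_left_mono[of "excess p" \<rho>max "congested_slope * vmax"]] excess_range[of p] backward_speed(1) vmax_pos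
      by (auto simp: le_max_iff_disj)
    moreover have "\<bar>excess p\<bar> \<le> max \<rho>max (congested_slope * vmax * \<rho>max)" for p using excess_range(2)[of p] by simp
    ultimately have "0 \<le> (LBINT p:Q. excess p * (case p of (t, x) \<Rightarrow> \<alpha>' t * \<beta> x) + ?q p * (case p of (t, x) \<Rightarrow> \<alpha> t * \<beta>' x))
      + (LBINT t:{0..T}. 0 * (case (t, 0) of (t, x) \<Rightarrow> \<alpha> t * \<beta> x)) - (LBINT t:{0..T}. 0 * (case (t, L) of (t, x) \<Rightarrow> \<alpha> t * \<beta> x))"
      by (intro inequality_with_boundary_terms[OF L_pos _ _ _ _ zero[OF tr(1) g(1)] zero[OF tr(2) g(2)] excess_subsolution tf])
        measurable
    then have "0 \<le> (LBINT p:Q. excess p * (case p of (t, x) \<Rightarrow> \<alpha>' t * \<beta> x) + ?q p * (case p of (t, x) \<Rightarrow> \<alpha> t * \<beta>' x))"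
      by simp
    moreover have "(LBINT p:Q. excess p * (case p of (t, x) \<Rightarrow> \<alpha>' t * \<beta> x) + ?q p * (case p of (t, x) \<Rightarrow> \<alpha> t * \<beta>' x))
        = - (LBINT p. indicator Q p * (excess p * - \<alpha>' (fst p)))"
      unfolding set_lebesgue_integral_def Bochner_Integration.integral_minus[symmetric]
      by (rule Bochner_Integration.integral_cong) (auto simp: indicator_def \<beta>1)
    ultimately have le0: "(LBINT p. indicator Q p * (excess p * - \<alpha>' (fst p))) \<le> 0" by simp
    have ge0: "0 \<le> indicator Q p * (excess p * - \<alpha>' (fst p))" for p
      using excess_range(1)[of p] \<alpha>'0[of "fst p"] by (auto simp: indicator_def mem_Times_iff mult_nonneg_nonpos)
    have int: "integrable lborel (\<lambda>p. indicator Q p * (excess p * - \<alpha>' (fst p)))"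
    proof -
      obtain B where B: "\<And>p. \<bar>(\<lambda>(t, x). \<alpha>' t * \<beta> x) p\<bar> \<le> B"
        using test_function_bounded[OF tf] by metis
      have "set_integrable lborel Q (\<lambda>p. excess p * (\<lambda>(t, x). \<alpha>' t * \<beta> x) p)"
        by (rule set_integrable_mult_test[OF _ _ excess_range(2) B])
          (auto intro: test_function_measurable(2)[OF tf])
      then have "integrable lborel (\<lambda>p. - (indicator Q p *\<^sub>R (excess p * (\<lambda>(t, x). \<alpha>' t * \<beta> x) p)))"
        unfolding set_integrable_def by (rule integrable_minus)
      moreover have "(\<lambda>p. - (indicator Q p *\<^sub>R (excess p * (\<lambda>(t, x). \<alpha>' t * \<beta> x) p))) = (\<lambda>p. indicator Q p * (excess p * - \<alpha>' (fst p)))"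
        by (auto simp: fun_eq_iff indicator_def \<beta>1)
      ultimately show ?thesis by (simp only:)
    qed
    have "(LBINT p. indicator Q p * (excess p * - \<alpha>' (fst p))) = 0"
      using le0 ge0 by (intro antisym Bochner_Integration.integral_nonneg) auto
    then have "AE p in lborel. indicator Q p * (excess p * - \<alpha>' (fst p)) = 0"
      using integral_nonneg_eq_0_iff_AE[OF int] ge0 by auto
    then show ?thesis
    proof eventually_elim
      case (elim p)
      show ?case
      proof (intro impI)
        assume p: "p \<in> Q" "0 < fst p" "fst p < \<delta>"
        then have "\<alpha>' (fst p) < 0" using plateau'_neg[OF d(1,2), of "fst p"] by (simp add: \<alpha>'_def)
        then show "\<rho> p \<le> \<rho>cr" using elim p by (simp add: excess_def)
      qed
    qed
  qed
  have "AE p in lborel. \<forall>n. p \<in> Q \<longrightarrow> 0 < fst p \<longrightarrow> fst p < T - T / real (n + 2) \<longrightarrow> \<rho> p \<le> \<rho>cr"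
    unfolding AE_all_countable
  proof
    fix n
    show "AE p in lborel. p \<in> Q \<longrightarrow> 0 < fst p \<longrightarrow> fst p < T - T / real (n + 2) \<longrightarrow> \<rho> p \<le> \<rho>cr"
      by (rule *) (use T_pos in \<open>auto simp: field_simps intro: add_pos_nonneg\<close>)
  qed
  moreover have "AE p in (lborel :: (real \<times> real) measure). fst p \<notin> {0, T}"
    by (rule AE_lborel_fst[OF AE_not_in_countable]) simp
  ultimately show ?thesis
  proof eventually_elim
    case (elim p)
    show ?case
    proof
      assume p: "p \<in> Q"
      then have "0 < fst p" "fst p < T" using elim(2) by (auto simp: mem_Times_iff)
      have "(\<lambda>n. T - T * (1 / real (n + 2))) \<longlonglongrightarrow> T - T * 0"
        by (intro tendsto_intros LIMSEQ_ignore_initial_segment[OF lim_1_over_n])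
      then have "\<forall>\<^sub>F n in sequentially. fst p < T - T * (1 / real (n + 2))"
        using \<open>fst p < T\<close> by (intro order_tendstoD(1)) auto
      then obtain n where "fst p < T - T / real (n + 2)" by (auto simp: eventually_sequentially)
      then show "\<rho> p \<le> \<rho>cr" using elim(1) p \<open>0 < fst p\<close> by blast
    qed
  qed
qed

end

end

lemma AE_zero_of_initial_integrals:
  fixes e :: "real \<Rightarrow> real"
  assumes T: "0 < T" and e: "set_integrable lborel {0..T} e"
    and zero: "\<And>S. 0 < S \<Longrightarrow> S < T \<Longrightarrow> (LBINT t:{0..T}. e t * indicator {..<S} t) = 0"
  shows "AE t in lborel. t \<in> {0..T} \<longrightarrow> e t = 0"
proof -
  define f where "f t = indicator {0..T} t *\<^sub>R e t" for t
  have f: "integrable lborel f" using e unfolding set_integrable_def f_def[abs_def] .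
  have [measurable]: "f \<in> borel_measurable borel" using borel_measurable_integrable[OF f] by simp
  have fi: "integrable lborel (\<lambda>t. f t * indicator A t)" if "A \<in> sets borel" for A
    using integrable_real_mult_indicator[OF _ f] that by simp
  have below: "(LBINT t. f t * indicator {..<S} t) = 0" if "S < T" for S
  proof (cases "0 < S")
    case True
    then show ?thesis using zero[OF True that] by (simp add: f_def set_lebesgue_integral_def mult.assoc)
  next
    case False
    then have "f t * indicator {..<S} t = 0" for t by (auto simp: f_def indicator_def)
    then show ?thesis by (simp only: Bochner_Integration.integral_zero)
  qed
  have total: "(LBINT t. f t) = 0"
  proof -
    define s where "s n = T - T * (1 / real (Suc n))" for n
    have "s \<longlonglongrightarrow> T - T * 0" unfolding s_def by (intro tendsto_intros LIMSEQ_Suc[OF lim_1_over_n])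
    then have s: "s \<longlonglongrightarrow> T" by simp
    have sT: "s n < T" for n using T by (simp add: s_def)
    have ind: "(\<lambda>n. indicator {..<s n} t) \<longlonglongrightarrow> (1 :: real)" if t: "t < T" for t
    proof -
      from order_tendstoD(1)[OF s t]
      have "\<forall>\<^sub>F n in sequentially. indicator {..<s n} t = (1 :: real)" by eventually_elim simp
      then show ?thesis by (rule tendsto_eventually)
    qed
    have "AE t in lborel. t \<in> {0..T} \<longrightarrow> (\<lambda>n. indicator {..<s n} t) \<longlonglongrightarrow> (1 :: real)"
      using AE_not_in_countable[of "{T}", simplified] by eventually_elim (auto intro: ind simp: less_le)
    then have "(\<lambda>n. LBINT t:{0..T}. e t * indicator {..<s n} t) \<longlonglongrightarrow> (LBINT t:{0..T}. e t * 1)"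
      by (intro set_integral_mult_limit[OF e]) (auto simp: indicator_def)
    then have "(\<lambda>n. LBINT t. f t * indicator {..<s n} t) \<longlonglongrightarrow> (LBINT t. f t)"
      by (simp add: f_def set_lebesgue_integral_def mult.assoc)
    then show ?thesis using below[OF sT] by (simp add: LIMSEQ_const_iff)
  qed
  have below': "(LBINT t. f t * indicator {..<S} t) = 0" for S
  proof (cases "S < T")
    case False
    have "(LBINT t. f t * indicator {..<S} t) = (LBINT t. f t)"
    proof (rule integral_cong_AE)
      show "AE t in lborel. f t * indicator {..<S} t = f t"
        using AE_not_in_countable[of "{T}", simplified] by eventually_elim (use False in \<open>auto simp: f_def indicator_def\<close>)
    qed measurable
    then show ?thesis using total by simp
  qed (rule below)
  have above: "(LBINT t. f t * indicator {x<..} t) = 0" for x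
  proof -
    have "(LBINT t. f t * indicator {x<..} t) = (LBINT t. f t - f t * indicator {..<x} t)"
    proof (rule integral_cong_AE)
      show "AE t in lborel. f t * indicator {x<..} t = f t - f t * indicator {..<x} t"
        using AE_not_in_countable[of "{x}", simplified] by eventually_elim (auto simp: indicator_def)
    qed measurable
    then show ?thesis using Bochner_Integration.integral_diff[OF f fi[of "{..<x}"]] total below' by simp
  qed
  (* the positive and the negative part of f are densities of the same measure *)
  let ?p = "\<lambda>t. ennreal (max 0 (f t))" and ?n = "\<lambda>t. ennreal (max 0 (- f t))"
  have pn: "integrable lborel (\<lambda>t. max 0 (f t))" "integrable lborel (\<lambda>t. max 0 (- f t))"
    using f by auto
  have "density lborel ?p = density lborel ?n"
  proof (rule measure_eqI_lessThan)
    have em: "emeasure (density lborel (\<lambda>t. ennreal (max 0 (g t)))) {x<..} = ennreal (LBINT t. max 0 (g t) * indicator {x<..} t)"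
      if g: "integrable lborel (\<lambda>t. max 0 (g t))" and [measurable]: "g \<in> borel_measurable borel" for g :: "real \<Rightarrow> real" and x
    proof -
      have "emeasure (density lborel (\<lambda>t. ennreal (max 0 (g t)))) {x<..} = (\<integral>\<^sup>+t. ennreal (max 0 (g t) * indicator {x<..} t) \<partial>lborel)"
        by (subst emeasure_density) (auto intro!: nn_integral_cong simp: indicator_def)
      also have "\<dots> = ennreal (LBINT t. max 0 (g t) * indicator {x<..} t)"
        using integrable_real_mult_indicator[OF _ g, of "{x<..}"] by (intro nn_integral_eq_integral) auto
      finally show ?thesis .
    qed
    show "emeasure (density lborel ?p) {x<..} < \<infinity>" for x using em[OF pn(1)] by simp
    show "emeasure (density lborel ?p) {x<..} = emeasure (density lborel ?n) {x<..}" for x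
    proof -
      have i: "integrable lborel (\<lambda>t. max 0 (f t) * indicator {x<..} t)" "integrable lborel (\<lambda>t. max 0 (- f t) * indicator {x<..} t)"
        using integrable_real_mult_indicator[OF _ pn(1), of "{x<..}"] integrable_real_mult_indicator[OF _ pn(2), of "{x<..}"] by auto
      have "(LBINT t. max 0 (f t) * indicator {x<..} t) - (LBINT t. max 0 (- f t) * indicator {x<..} t)
          = (LBINT t. max 0 (f t) * indicator {x<..} t - max 0 (- f t) * indicator {x<..} t)"
        using Bochner_Integration.integral_diff[OF i] by simp
      moreover have "(\<lambda>t. max 0 (f t) * indicator {x<..} t - max 0 (- f t) * indicator {x<..} t) = (\<lambda>t. f t * indicator {x<..} t)"
        by (auto simp: fun_eq_iff indicator_def max_def)
      ultimately show ?thesis using em[OF pn(1), of x] em[OF pn(2), of x] above[of x] by simp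
    qed
  qed simp_all
  then have "AE t in lborel. ?p t = ?n t"
    by (intro finite_density_unique[THEN iffD1])
      (use pn nn_integral_eq_integral[OF pn(1)] in \<open>auto\<close>)
  then show ?thesis
    by eventually_elim (auto simp: f_def max_def ennreal_eq_0_iff split: if_splits)
qed

context inflow_problem begin

text \<open>Above \<open>\<rho>cr\<close> the congested branch of the flux lies strictly below the line \<open>u * v\<close>.\<close>

lemma outflow_trace_le_critical:
  assumes "flux \<rho>cr \<rho>max u (v t) = u * v t" shows "u \<le> \<rho>cr"
proof (rule ccontr)
  assume "\<not> u \<le> \<rho>cr"
  then have "v t * \<rho>cr / (\<rho>max - \<rho>cr) * (\<rho>max - u) = u * v t" using assms by (simp add: flux_def)
  then have "\<rho>cr * (\<rho>max - u) = u * (\<rho>max - \<rho>cr)"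
    using v_pos[of t] cr_less by (simp add: field_simps)
  then have "\<rho>max * (\<rho>cr - u) = 0" by (simp add: algebra_simps)
  then show False using cr_pos cr_less \<open>\<not> u \<le> \<rho>cr\<close> by simp
qed

definition flow_difference :: "(real \<Rightarrow> real) \<Rightarrow> (real \<Rightarrow> real) \<Rightarrow> real \<Rightarrow> real" where
  "flow_difference r1 r2 t = v t * (r1 t - r2 t)"

context
  fixes In :: "real \<Rightarrow> real" and \<rho>1 \<rho>2 :: "real \<times> real \<Rightarrow> real" and r1 r2 :: "real \<Rightarrow> real"
  assumes sol1: "traffic_solution T L \<rho>cr \<rho>max \<rho>0 In v \<rho>1 r1"
    and sol2: "traffic_solution T L \<rho>cr \<rho>max \<rho>0 In v \<rho>2 r2"
    and \<rho>1 [measurable]: "\<rho>1 \<in> borel_measurable borel" and \<rho>1_range: "\<And>p. 0 \<le> \<rho>1 p" "\<And>p. \<rho>1 p \<le> \<rho>max"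
    and \<rho>2 [measurable]: "\<rho>2 \<in> borel_measurable borel" and \<rho>2_range: "\<And>p. 0 \<le> \<rho>2 p" "\<And>p. \<rho>2 p \<le> \<rho>max"
    and In_le: "\<And>t. t \<in> {0..T} \<Longrightarrow> In t / v t \<le> \<rho>cr"
begin

lemma solution_free_flow:
  assumes "traffic_solution T L \<rho>cr \<rho>max \<rho>0 In v \<rho> r" "\<rho> \<in> borel_measurable borel" "\<And>p. 0 \<le> \<rho> p" "\<And>p. \<rho> p \<le> \<rho>max"
  shows "AE p in lborel. p \<in> Q \<longrightarrow> \<rho> p \<le> \<rho>cr"
proof -
  note sol = assms(1)[unfolded traffic_solution_def]
  show ?thesis
  proof (rule free_flow[OF _ assms(2-4)])
    show "AE t in lborel. t \<in> {0..T} \<longrightarrow> In t / v t \<le> \<rho>cr" using In_le by auto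
    show "AE t in lborel. t \<in> {0..T} \<longrightarrow> r t \<le> \<rho>cr"
      using sol by (auto elim!: eventually_mono intro: outflow_trace_le_critical)
  qed (use sol in auto)
qed

lemma difference_weak_equality:
  assumes \<phi>: "test_function ({..<T} \<times> {0<..<L}) \<phi> \<phi>t \<phi>x"
  shows "(LBINT p:Q. (\<rho>1 p - \<rho>2 p) * \<phi>t p + v (fst p) * (\<rho>1 p - \<rho>2 p) * \<phi>x p) = 0"
proof -
  note [measurable] = test_function_measurable[OF \<phi>]
  let ?G = "\<lambda>\<rho> p. \<rho> p * \<phi>t p + flux \<rho>cr \<rho>max (\<rho> p) (v (fst p)) * \<phi>x p"
  have kr: "kruzhkov_entropy_solution T L \<rho>cr \<rho>max \<rho>0 v \<rho>1" "kruzhkov_entropy_solution T L \<rho>cr \<rho>max \<rho>0 v \<rho>2"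
    using sol1 sol2 by (auto simp: traffic_solution_def)
  have "(LBINT p:Q. ?G \<rho>1 p - ?G \<rho>2 p) = 0"
    using set_integral_diff(2)[OF flow_integrable[OF kr(1) \<rho>1 \<rho>1_range \<phi>] flow_integrable[OF kr(2) \<rho>2 \<rho>2_range \<phi>]]
      weak_solution[OF kr(1) \<rho>1 \<rho>1_range \<phi>] weak_solution[OF kr(2) \<rho>2 \<rho>2_range \<phi>] by simp
  moreover have "(LBINT p:Q. ?G \<rho>1 p - ?G \<rho>2 p)
      = (LBINT p:Q. (\<rho>1 p - \<rho>2 p) * \<phi>t p + v (fst p) * (\<rho>1 p - \<rho>2 p) * \<phi>x p)"
    unfolding set_lebesgue_integral_def
  proof (rule integral_cong_AE)
    show "AE p in lborel. indicator Q p *\<^sub>R (?G \<rho>1 p - ?G \<rho>2 p)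
        = indicator Q p *\<^sub>R ((\<rho>1 p - \<rho>2 p) * \<phi>t p + v (fst p) * (\<rho>1 p - \<rho>2 p) * \<phi>x p)"
      using solution_free_flow[OF sol1 \<rho>1 \<rho>1_range] solution_free_flow[OF sol2 \<rho>2 \<rho>2_range]
    proof eventually_elim
      case (elim p)
      show ?case
      proof (cases "p \<in> Q")
        case True
        then have "flux \<rho>cr \<rho>max (\<rho>1 p) (v (fst p)) = \<rho>1 p * v (fst p)" "flux \<rho>cr \<rho>max (\<rho>2 p) (v (fst p)) = \<rho>2 p * v (fst p)"
          using elim by (auto simp: flux_def)
        then show ?thesis by (simp add: algebra_simps)
      qed simp
    qed
  qed (unfold flux_def, measurable)
  ultimately show ?thesis by simp
qed

lemma flow_difference_integrable: "set_integrable lborel {0..T} (flow_difference r1 r2)"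
proof -
  have r: "set_integrable lborel {0..T} r1" "set_integrable lborel {0..T} r2"
    using sol1 sol2 by (auto simp: traffic_solution_def has_trace_def)
  have d: "set_integrable lborel {0..T} (\<lambda>t. r1 t - r2 t)" by (rule set_integral_diff(1)[OF r])
  show ?thesis
  proof (rule set_integrable_bound[OF set_integrable_mult_right[of vmax, OF d]])
    have "(\<lambda>t. v t * (indicator {0..T} t *\<^sub>R (r1 t - r2 t))) \<in> borel_measurable lborel"
      using borel_measurable_integrable[OF d[unfolded set_integrable_def]]
      by (intro borel_measurable_times) simp_all
    then show "set_borel_measurable lborel {0..T} (flow_difference r1 r2)"
      unfolding set_borel_measurable_def flow_difference_def by (simp add: mult.left_commute)
    have "\<bar>v t\<bar> * \<bar>r1 t - r2 t\<bar> \<le> \<bar>vmax\<bar> * \<bar>r1 t - r2 t\<bar>" for t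
      using v_abs_le[of t] by (intro mult_right_mono) auto
    then show "AE t in lborel. t \<in> {0..T} \<longrightarrow> norm (flow_difference r1 r2 t) \<le> norm (vmax * (r1 t - r2 t))"
      by (auto simp: flow_difference_def abs_mult)
  qed
qed

text \<open>The traces on the left side agree, so only the right side contributes.\<close>

lemma boundary_inequality:
  assumes \<phi>: "test_function ({..<T} \<times> UNIV) \<phi> \<phi>t \<phi>x"
  shows "(LBINT t:{0..T}. flow_difference r1 r2 t * \<phi> (t, L))
    \<le> (LBINT p:Q. (\<rho>1 p - \<rho>2 p) * \<phi>t p + v (fst p) * (\<rho>1 p - \<rho>2 p) * \<phi>x p)"
proof -
  have d: "\<bar>\<rho>1 p - \<rho>2 p\<bar> \<le> \<rho>max" for p
    using \<rho>1_range[of p] \<rho>2_range[of p] by (simp add: abs_le_iff)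
  have dom: "\<bar>v s * (a - b) - v s * (c - d)\<bar> \<le> vmax * (\<bar>a - c\<bar> + \<bar>b - d\<bar>)" for s a b c d
  proof -
    have "v s * (a - b) - v s * (c - d) = v s * ((a - c) - (b - d))" by (simp add: algebra_simps)
    also have "\<bar>\<dots>\<bar> \<le> vmax * (\<bar>a - c\<bar> + \<bar>b - d\<bar>)"
      unfolding abs_mult using v_abs_le[of s] vmax_pos by (intro mult_mono) auto
    finally show ?thesis .
  qed
  have dom0: "\<bar>v s * (a - b)\<bar> \<le> vmax * (\<bar>a - c\<bar> + \<bar>b - c\<bar>)" for s a b c
    using dom[of s a b c c] by simp
  have tr: "has_trace T L \<rho>1 0 (\<lambda>t. In t / v t)" "has_trace T L \<rho>2 0 (\<lambda>t. In t / v t)"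
    "has_trace T L \<rho>1 L r1" "has_trace T L \<rho>2 L r2"
    using sol1 sol2 by (auto simp: traffic_solution_def)
  have b: "\<bar>\<rho>1 p\<bar> \<le> \<rho>max" "\<bar>\<rho>2 p\<bar> \<le> \<rho>max" for p using \<rho>1_range[of p] \<rho>2_range[of p] by auto
  let ?q = "\<lambda>p. v (fst p) * (\<rho>1 p - \<rho>2 p)"
  have t0: "has_trace T L ?q 0 (\<lambda>_. 0)"
    by (rule has_trace_dominated[OF tr(1,2) \<rho>1 \<rho>2 b set_integrable_Icc_const _ less_imp_le[OF vmax_pos]])
      (use dom0 in auto)
  have tL: "has_trace T L ?q L (flow_difference r1 r2)"
    by (rule has_trace_dominated[OF tr(3,4) \<rho>1 \<rho>2 b flow_difference_integrable _ less_imp_le[OF vmax_pos]])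
      (use dom in \<open>auto simp: flow_difference_def\<close>)
  have qb: "\<bar>?q p\<bar> \<le> max \<rho>max (vmax * \<rho>max)" for p
    using mult_mono[OF v_abs_le[of "fst p"] d[of p]] vmax_pos by (simp add: abs_mult le_max_iff_disj)
  have db: "\<bar>\<rho>1 p - \<rho>2 p\<bar> \<le> max \<rho>max (vmax * \<rho>max)" for p
    using d[of p] by (simp add: le_max_iff_disj)
  have "0 \<le> (LBINT p:Q. (\<rho>1 p - \<rho>2 p) * \<phi>t p + ?q p * \<phi>x p)
      + (LBINT t:{0..T}. 0 * \<phi> (t, 0)) - (LBINT t:{0..T}. flow_difference r1 r2 t * \<phi> (t, L))"
    by (rule inequality_with_boundary_terms[OF L_pos _ _ db qb t0 tL _ \<phi>])
      (auto simp: difference_weak_equality)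
  then show ?thesis by simp
qed

text \<open>The test functions are \<open>\<alpha>(t) \<beta>(x - V t)\<close> where \<open>\<alpha>\<close> equals \<open>1\<close> up to time \<open>S\<close> and \<open>\<beta>\<close> is
  supported beyond the characteristic that arrives at \<open>L\<close> at time \<open>S\<close>. When \<open>\<alpha>\<close> starts to decrease,
  this support has left the rectangle, so the rectangle contributes nothing. At \<open>x = L\<close> it
  is met exactly at the times before \<open>S\<close>.\<close>

lemma initial_flow_difference_nonpos:
  assumes S: "0 < S" "S < T"
  shows "(LBINT t:{0..T}. flow_difference r1 r2 t * indicator {..<S} t) \<le> 0"
proof -
  define a where "a = (T - S) / 2"
  define \<alpha> where "\<alpha> = plateau (- a) (S + a) a"
  define \<alpha>' where "\<alpha>' = plateau' (- a) (S + a) a"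
  have a: "0 < a" "- a + 2 * a \<le> S + a" "S + a < T" using S by (auto simp: a_def field_simps)
  have \<alpha>: "(\<alpha> has_real_derivative \<alpha>' t) (at t)" "continuous_on UNIV \<alpha>'" "0 \<le> \<alpha> t" for t
    unfolding \<alpha>_def \<alpha>'_def using plateau_deriv[OF a(1,2)] continuous_on_plateau'[OF a(1,2)] plateau_nonneg by auto
  have \<alpha>1: "\<alpha> t = 1" "\<alpha>' t = 0" if "0 \<le> t" "t \<le> S" for t
    using that plateau_1[OF a(1,2), of t] plateau'_0[OF a(1,2), of t] by (auto simp: \<alpha>_def \<alpha>'_def)
  have \<alpha>le: "\<alpha> t \<le> 1" for t by (simp add: \<alpha>_def plateau_le_1)
  have [measurable]: "\<alpha> \<in> borel_measurable borel" "\<alpha>' \<in> borel_measurable borel" by (simp_all add: \<alpha>_def \<alpha>'_def)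
  let ?e = "flow_difference r1 r2"
  let ?d = "\<lambda>p. \<rho>1 p - \<rho>2 p"
  have db: "\<bar>?d p\<bar> \<le> \<rho>max" for p
    using \<rho>1_range[of p] \<rho>2_range[of p] by (simp add: abs_le_iff)
  note limit = set_integral_mult_limit[OF flow_difference_integrable]
  have step: "(LBINT t:{0..T}. ?e t * (\<alpha> t * \<beta> (L - V t))) \<le> 0"
    if \<delta>: "0 < \<delta>" "2 * \<delta> \<le> 1" and \<beta>_def: "\<beta> = plateau (L - V S) (L + 1) \<delta>" for \<delta> \<beta>
  proof -
    define \<beta>' where "\<beta>' = plateau' (L - V S) (L + 1) \<delta>"
    have VS: "0 \<le> V S" using V_le_iff[of 0 S] S V_0 by simp
    have b: "0 < \<delta>" "L - V S + 2 * \<delta> \<le> L + 1" using \<delta> VS by auto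
    have \<beta>: "(\<beta> has_real_derivative \<beta>' t) (at t)" "continuous_on UNIV \<beta>'" "0 \<le> \<beta> t" for t
      unfolding \<beta>_def \<beta>'_def using plateau_deriv[OF b] continuous_on_plateau'[OF b] plateau_nonneg by auto
    have \<beta>le: "\<beta> t \<le> 1" for t by (simp add: \<beta>_def plateau_le_1)
    have [measurable]: "\<beta> \<in> borel_measurable borel" "\<beta>' \<in> borel_measurable borel" by (simp_all add: \<beta>_def \<beta>'_def)
    have c\<beta>: "isCont \<beta> y" "isCont \<beta>' y" for y
      using DERIV_isCont[OF \<beta>(1)] \<beta>(2) by (auto simp: continuous_on_eq_continuous_at)
    have [measurable]: "Vn n \<in> borel_measurable borel" "vn n \<in> borel_measurable borel" for n
      using continuous_on_vn Vn_deriv DERIV_isCont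
      by (blast intro: borel_measurable_continuous_onI continuous_at_imp_continuous_on)+
    have bound: "\<exists>B. \<forall>x. \<bar>plateau' p q s x\<bar> \<le> B" if "0 < s" for p q s
    proof -
      obtain C where C: "0 < C" "\<And>x. ramp' x \<le> C" using ramp'_bounded by blast
      have "\<bar>plateau' p q s x\<bar> \<le> C / s" for x
      proof -
        have "0 \<le> ramp' y / s" "ramp' y / s \<le> C / s" for y
          using C(2)[of y] ramp'_nonneg[of y] that by (auto intro: divide_right_mono)
        from this[of "(x - p) / s"] this[of "(q - x) / s"] show ?thesis
          unfolding plateau'_def abs_le_iff by linarith
      qed
      then show ?thesis by blast
    qed
    obtain A where A: "\<And>x. \<bar>\<alpha>' x\<bar> \<le> A" using bound[OF a(1)] unfolding \<alpha>'_def by blast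
    obtain B where B: "\<And>x. \<bar>\<beta>' x\<bar> \<le> B" using bound[OF b(1)] unfolding \<beta>'_def by blast
    let ?X = "\<lambda>n p. ?d p * (\<alpha>' (fst p) * \<beta> (snd p - Vn n (fst p)) + \<alpha> (fst p) * \<beta>' (snd p - Vn n (fst p)) * (v (fst p) - vn n (fst p)))"
    let ?Y = "\<lambda>n t. ?e t * (\<alpha> t * \<beta> (L - Vn n t))"
    have ineq: "(LBINT t:{0..T}. ?Y n t) \<le> (LBINT p:Q. ?X n p)" for n
    proof -
      have tf: "test_function ({..<T} \<times> UNIV) (\<lambda>(t, x). \<alpha> t * \<beta> (x - Vn n t))
        (\<lambda>(t, x). \<alpha>' t * \<beta> (x - Vn n t) - \<alpha> t * \<beta>' (x - Vn n t) * vn n t) (\<lambda>(t, x). \<alpha> t * \<beta>' (x - Vn n t))"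
        by (rule test_function_transported_product[OF \<alpha> \<beta> Vn_deriv continuous_on_vn, where a="- a" and b="S + a" and c="L - V S" and d="L + 1"])
          (use plateau_0[OF a(1,2)] plateau_0[OF b] a(3) in \<open>auto simp: \<alpha>_def \<beta>_def\<close>)
      have X: "?d p * (\<lambda>(t, x). \<alpha>' t * \<beta> (x - Vn n t) - \<alpha> t * \<beta>' (x - Vn n t) * vn n t) p
          + v (fst p) * ?d p * (\<lambda>(t, x). \<alpha> t * \<beta>' (x - Vn n t)) p = ?X n p" for p
        by (simp add: case_prod_unfold algebra_simps)
      from boundary_inequality[OF tf] show ?thesis unfolding X by simp
    qed
    (* the error v - vn of the averaged speed disappears in the limit *)
    have lim1: "(\<lambda>n. LBINT p:Q. ?X n p) \<longlonglongrightarrow> (LBINT p:Q. ?d p * (\<alpha>' (fst p) * \<beta> (snd p - V (fst p)) + \<alpha> (fst p) * \<beta>' (snd p - V (fst p)) * 0))"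
      unfolding set_lebesgue_integral_def
    proof (rule integral_dominated_convergence[where w="\<lambda>p. indicator Q p *\<^sub>R (\<rho>max * (A + B * (vmax + vmax)))"])
      show "integrable lborel (\<lambda>p. indicator Q p *\<^sub>R (\<rho>max * (A + B * (vmax + vmax))))"
        using set_integrable_rectangle_fst[OF set_integrable_Icc_const] unfolding set_integrable_def .
      show "AE p in lborel. norm (indicator Q p *\<^sub>R ?X n p) \<le> indicator Q p *\<^sub>R (\<rho>max * (A + B * (vmax + vmax)))" for n
      proof (intro AE_I2)
        fix p
        have B0: "0 \<le> A" "0 \<le> B" using A[of 0] B[of 0] by linarith+
        have "\<bar>\<alpha>' (fst p) * \<beta> (snd p - Vn n (fst p))\<bar> \<le> A * 1"
          unfolding abs_mult using A \<beta>(3) \<beta>le B0 by (intro mult_mono) auto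
        moreover have "\<bar>\<alpha> (fst p) * \<beta>' (snd p - Vn n (fst p)) * (v (fst p) - vn n (fst p))\<bar> \<le> 1 * B * (vmax + vmax)"
        proof -
          have "\<bar>v (fst p) - vn n (fst p)\<bar> \<le> vmax + vmax"
            using v_abs_le[of "fst p"] vn_abs_le[of n "fst p"] by linarith
          then show ?thesis unfolding abs_mult using B \<alpha>(3) \<alpha>le B0 by (intro mult_mono) auto
        qed
        ultimately have "\<bar>\<alpha>' (fst p) * \<beta> (snd p - Vn n (fst p)) + \<alpha> (fst p) * \<beta>' (snd p - Vn n (fst p)) * (v (fst p) - vn n (fst p))\<bar>
            \<le> A + B * (vmax + vmax)" by linarith
        then have "\<bar>?X n p\<bar> \<le> \<rho>max * (A + B * (vmax + vmax))"
          unfolding abs_mult[of "?d p"] using db[of p] cr_pos cr_less by (intro mult_mono) auto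
        then show "norm (indicator Q p *\<^sub>R ?X n p) \<le> indicator Q p *\<^sub>R (\<rho>max * (A + B * (vmax + vmax)))"
          by (auto simp: indicator_def)
      qed
      show "AE p in lborel. (\<lambda>n. indicator Q p *\<^sub>R ?X n p) \<longlonglongrightarrow>
          indicator Q p *\<^sub>R (?d p * (\<alpha>' (fst p) * \<beta> (snd p - V (fst p)) + \<alpha> (fst p) * \<beta>' (snd p - V (fst p)) * 0))"
        using AE_lborel_fst[OF AE_not_in_countable[OF variation_bound_countable_discont[OF v_var]]]
      proof eventually_elim
        case (elim p)
        then have "(\<lambda>n. vn n (fst p)) \<longlonglongrightarrow> v (fst p)" by (intro vn_tendsto) auto
        then have "(\<lambda>n. v (fst p) - vn n (fst p)) \<longlonglongrightarrow> v (fst p) - v (fst p)" by (intro tendsto_intros)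
        moreover have "(\<lambda>n. snd p - Vn n (fst p)) \<longlonglongrightarrow> snd p - V (fst p)" by (intro tendsto_intros Vn_tendsto)
        ultimately show ?case
          by (intro tendsto_intros isCont_tendsto_compose[OF c\<beta>(1)] isCont_tendsto_compose[OF c\<beta>(2)] Vn_tendsto) simp_all
      qed
    qed measurable
    have zero: "(LBINT p:Q. ?d p * (\<alpha>' (fst p) * \<beta> (snd p - V (fst p)) + \<alpha> (fst p) * \<beta>' (snd p - V (fst p)) * 0)) = 0"
    proof -
      have "\<alpha>' t * \<beta> (x - V t) = 0" if "t \<in> {0..T}" "x \<in> {0..L}" for t x
      proof (cases "t \<le> S")
        case False
        then have "x - V t \<le> L - V S" using that V_le_iff[of S t] by simp
        then show ?thesis using plateau_0[OF b] by (simp add: \<beta>_def)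
      qed (use \<alpha>1 that in auto)
      then have "indicator Q p *\<^sub>R (?d p * (\<alpha>' (fst p) * \<beta> (snd p - V (fst p)) + \<alpha> (fst p) * \<beta>' (snd p - V (fst p)) * 0)) = 0" for p
        by (auto simp: indicator_def mem_Times_iff)
      then show ?thesis unfolding set_lebesgue_integral_def by (simp only: Bochner_Integration.integral_zero)
    qed
    have lim2: "(\<lambda>n. LBINT t:{0..T}. ?Y n t) \<longlonglongrightarrow> (LBINT t:{0..T}. ?e t * (\<alpha> t * \<beta> (L - V t)))"
    proof (rule limit)
      show "\<bar>\<alpha> t * \<beta> (L - Vn n t)\<bar> \<le> 1" for n t
        unfolding abs_mult using \<alpha>(3) \<alpha>le \<beta>(3) \<beta>le by (intro mult_le_one) auto
      show "AE t in lborel. t \<in> {0..T} \<longrightarrow> (\<lambda>n. \<alpha> t * \<beta> (L - Vn n t)) \<longlonglongrightarrow> \<alpha> t * \<beta> (L - V t)"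
        by (intro AE_I2 impI tendsto_intros isCont_tendsto_compose[OF c\<beta>(1)] Vn_tendsto)
    qed measurable
    show ?thesis
      using LIMSEQ_le[OF lim2 lim1] ineq unfolding zero by blast
  qed
  (* steeper and steeper ramps turn \<beta> (L - V t) into the indicator of the times before S *)
  define \<delta> where "\<delta> n = 1 / 2 * (1 / real (Suc n))" for n
  have \<delta>: "0 < \<delta> n" "2 * \<delta> n \<le> 1" for n by (auto simp: \<delta>_def divide_le_eq)
  have \<delta>0: "\<delta> \<longlonglongrightarrow> 0"
    unfolding \<delta>_def using tendsto_mult_left[OF LIMSEQ_Suc[OF lim_1_over_n], of "1 / 2"] by simp
  let ?\<beta> = "\<lambda>n. plateau (L - V S) (L + 1) (\<delta> n)"
  have VS: "0 \<le> V S" using V_le_iff[of 0 S] S V_0 by simp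
  have b: "0 < \<delta> n" "L - V S + 2 * \<delta> n \<le> L + 1" for n using \<delta>[of n] VS by auto
  have "(\<lambda>n. LBINT t:{0..T}. ?e t * (\<alpha> t * ?\<beta> n (L - V t))) \<longlonglongrightarrow> (LBINT t:{0..T}. ?e t * indicator {..<S} t)"
  proof (rule limit)
    show "\<bar>\<alpha> t * ?\<beta> n (L - V t)\<bar> \<le> 1" for n t
      unfolding abs_mult using \<alpha>(3) \<alpha>le plateau_nonneg plateau_le_1 by (intro mult_le_one) auto
    show "AE t in lborel. t \<in> {0..T} \<longrightarrow> (\<lambda>n. \<alpha> t * ?\<beta> n (L - V t)) \<longlonglongrightarrow> indicator {..<S} t"
    proof (intro AE_I2 impI)
      fix t assume t: "t \<in> {0..T}"
      show "(\<lambda>n. \<alpha> t * ?\<beta> n (L - V t)) \<longlonglongrightarrow> indicator {..<S} t"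
      proof (cases "t < S")
        case True
        then have "0 < V S - V t" "0 \<le> V t" using V_strict_mono[of t S] V_le_iff[of 0 t] V_0 t by auto
        from order_tendstoD(2)[OF \<delta>0 this(1)]
        have "\<forall>\<^sub>F n in sequentially. \<alpha> t * ?\<beta> n (L - V t) = indicator {..<S} t"
        proof eventually_elim
          case (elim n)
          have "?\<beta> n (L - V t) = 1"
            using elim \<open>0 \<le> V t\<close> \<delta>[of n] by (intro plateau_1[OF b]) auto
          then show ?case using True \<alpha>1 t by simp
        qed
        then show ?thesis by (rule tendsto_eventually)
      next
        case False
        then have "?\<beta> n (L - V t) = 0" for n using V_le_iff[of S t] by (intro plateau_0[OF b]) auto
        then show ?thesis using False by simp
      qed
    qed
  qed measurable
  then show ?thesis
    using step[OF \<delta> refl] by (intro LIMSEQ_le_const2) auto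
qed

end

text \<open>The two solutions may be interchanged, so the inequalities for the difference of the flows are
  equalities.\<close>

theorem outflow_unique:
  assumes sol: "traffic_solution T L \<rho>cr \<rho>max \<rho>0 In v \<rho>1 r1" "traffic_solution T L \<rho>cr \<rho>max \<rho>0 In v \<rho>2 r2"
    and In_le: "\<And>t. t \<in> {0..T} \<Longrightarrow> In t / v t \<le> \<rho>cr"
  shows "AE t in lborel. t \<in> {0..T} \<longrightarrow> r1 t = r2 t"
proof -
  have m0: "0 \<le> \<rho>max" using cr_pos cr_less by simp
  obtain \<rho>1' where 1: "traffic_solution T L \<rho>cr \<rho>max \<rho>0 In v \<rho>1' r1"
    "\<rho>1' \<in> borel_measurable borel" "\<And>p. 0 \<le> \<rho>1' p" "\<And>p. \<rho>1' p \<le> \<rho>max"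
    using traffic_solution_zero_extension[OF sol(1) m0] by metis
  obtain \<rho>2' where 2: "traffic_solution T L \<rho>cr \<rho>max \<rho>0 In v \<rho>2' r2"
    "\<rho>2' \<in> borel_measurable borel" "\<And>p. 0 \<le> \<rho>2' p" "\<And>p. \<rho>2' p \<le> \<rho>max"
    using traffic_solution_zero_extension[OF sol(2) m0] by metis
  note n12 = initial_flow_difference_nonpos[OF 1(1) 2(1) 1(2-4) 2(2-4) In_le]
  note n21 = initial_flow_difference_nonpos[OF 2(1) 1(1) 2(2-4) 1(2-4) In_le]
  note int = flow_difference_integrable[OF 1(1) 2(1) 1(2-4) 2(2-4) In_le]
  have "AE t in lborel. t \<in> {0..T} \<longrightarrow> flow_difference r1 r2 t = 0"
  proof (rule AE_zero_of_initial_integrals[OF T_pos int])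
    fix S assume S: "0 < S" "S < T"
    have "flow_difference r2 r1 t * indicator {..<S} t = - (flow_difference r1 r2 t * indicator {..<S} t)" for t
      by (simp add: flow_difference_def algebra_simps)
    then have "(LBINT t:{0..T}. flow_difference r2 r1 t * indicator {..<S} t) = - (LBINT t:{0..T}. flow_difference r1 r2 t * indicator {..<S} t)"
      by (simp add: set_lebesgue_integral_def)
    with n12[OF _ S] n21[OF _ S] show "(LBINT t:{0..T}. flow_difference r1 r2 t * indicator {..<S} t) = 0" by simp
  qed
  then show ?thesis
  proof eventually_elim
    case (elim t)
    then show ?case using v_pos[of t]
      by (simp add: flow_difference_def)
  qed
qed

end

section \<open>Dependence of the outflow on the speed\<close>

context bv_speed begin

lemma entry_deriv:
  assumes "isCont v t" "isCont v (entry t x)"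
  shows "((\<lambda>t. entry t x) has_real_derivative v t / v (entry t x)) (at t)"
proof -
  define U where "U y = entry 0 (- y)" for y
  have VU: "V (U y) = y" for y by (simp add: U_def V_entry V_0)
  have eU: "entry s x = U (V s - x)" for s by (rule entry_eqI) (simp add: VU)
  have "continuous_on UNIV (\<lambda>y. entry (fst (0 :: real, - y)) (snd (0 :: real, - y)))"
    by (rule continuous_on_compose2[OF continuous_on_entry]) (auto intro!: continuous_intros)
  then have cU: "isCont U y" for y by (simp add: U_def[abs_def] continuous_on_eq_continuous_at)
  have d1: "(U has_real_derivative inverse (v (U (V t - x)))) (at (V t - x))"
  proof (rule DERIV_inverse_function[where f=V and a="V t - x - 1" and b="V t - x + 1"])
    show "(V has_real_derivative v (U (V t - x))) (at (U (V t - x)))"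
      using assms(2) by (intro V_deriv) (simp add: eU)
    show "v (U (V t - x)) \<noteq> 0" using v_pos[of "U (V t - x)"] by simp
  qed (simp_all add: VU cU)
  have d2: "((\<lambda>s. V s - x) has_real_derivative v t) (at t)"
    using V_deriv[OF assms(1)] by (auto intro!: derivative_eq_intros)
  from DERIV_chain'[OF d2 d1] show ?thesis by (simp add: eU divide_inverse mult.commute)
qed

lemma countable_entry_vimage:
  assumes "countable E" shows "countable {t. entry t x \<in> E}"
proof (rule countable_image_inj_on)
  show "countable ((\<lambda>t. entry t x) ` {t. entry t x \<in> E})"
    by (rule countable_subset[OF _ assms]) auto
  show "inj_on (\<lambda>t. entry t x) {t. entry t x \<in> E}"
  proof (rule inj_onI)
    fix s t assume "entry s x = entry t x"
    then have "V s - x = V t - x" using V_entry[of s x] V_entry[of t x] by metis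
    then show "s = t" by (simp add: V_eq_iff)
  qed
qed

text \<open>The integrand is required to be a speed in order to have its primitive at hand as a travelled
  distance.\<close>

lemma change_of_variables_speed:
  assumes u: "bv_speed u umin umax Ku" and ab: "a \<le> b"
  shows "(LBINT t:{a..b}. u (entry t x) * (v t / v (entry t x))) = (LBINT s:{entry a x..entry b x}. u s)"
proof -
  interpret u: bv_speed u umin umax Ku by (rule u)
  let ?E = "{t. \<not> isCont v t} \<union> {t. entry t x \<in> {t. \<not> isCont v t}} \<union> {t. entry t x \<in> {t. \<not> isCont u t}}"
  have E: "countable ?E"
    using variation_bound_countable_discont[OF v_var] variation_bound_countable_discont[OF u.v_var]
    by (intro countable_Un countable_entry_vimage)
  have Lip: "\<bar>u.V (entry s x) - u.V (entry t x)\<bar> \<le> umax * (vmax / vmin) * \<bar>s - t\<bar>" for s t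
    using order_trans[OF u.V_Lipschitz mult_left_mono[OF entry_Lipschitz less_imp_le[OF u.vmax_pos]]]
    by (simp add: mult.assoc)
  have der: "((\<lambda>t. u.V (entry t x)) has_real_derivative u (entry t x) * (v t / v (entry t x))) (at t)" if "t \<notin> ?E" for t
    using DERIV_chain'[OF entry_deriv u.V_deriv, of t x] that by (simp add: mult.commute)
  have "(LBINT t:{a..b}. u (entry t x) * (v t / v (entry t x))) = u.V (entry b x) - u.V (entry a x)"
    by (rule set_integral_derivative_Lipschitz[OF Lip E der _ ab]) measurable
  also have "\<dots> = (LBINT s:{entry a x..entry b x}. u s)"
    by (rule u.V_diff) (use entry_mono ab in \<open>auto dest: monoD\<close>)
  finally show ?thesis .
qed

text \<open>The function \<open>g + 1\<close> is a speed. The Jacobian \<open>v t / v (entry t x)\<close> of the map to the entry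
  time is at least \<open>vmin / vmax\<close>.\<close>

lemma entry_composition_integral:
  assumes g: "variation_bound Kg g" "\<And>s. 0 \<le> g s" "\<And>s. g s \<le> B" and ab: "a \<le> b"
  shows "(LBINT t:{a..b}. g (entry t x)) \<le> vmax / vmin * (LBINT s:{entry a x..entry b x}. g s)"
proof -
  have [measurable]: "g \<in> borel_measurable borel" using g(1) by (rule variation_bound_borel_measurable)
  have "variation_bound Kg (\<lambda>s. g s + 1)"
    using g(1) by (simp add: variation_bound_def)
  then have u: "bv_speed (\<lambda>s. g s + 1) 1 (B + 1) Kg" using g by unfold_locales auto
  have c: "bv_speed (\<lambda>_. 1) 1 1 0" using variation_bound_const by unfold_locales auto
  let ?r = "\<lambda>t. v t / v (entry t x)"
  have r: "vmin / vmax \<le> ?r t" "?r t \<le> vmax / vmin" for t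
    by (intro frac_le v_ge v_le v_pos vmin_pos less_imp_le[OF v_pos] less_imp_le[OF vmax_pos])+
  have gi: "set_integrable lborel {p..q} g" for p q
    by (rule bounded_set_integrable_Icc[where B=B]) (use g in auto)
  have ri: "set_integrable lborel {a..b} ?r"
  proof (rule bounded_set_integrable_Icc[where B="vmax / vmin"])
    fix t
    have "0 \<le> ?r t" using v_pos by (simp add: less_imp_le)
    then show "\<bar>?r t\<bar> \<le> vmax / vmin" using r(2)[of t] by (simp only: abs_of_nonneg)
  qed measurable
  have gri: "set_integrable lborel {a..b} (\<lambda>t. g (entry t x) * ?r t)"
  proof (rule bounded_set_integrable_Icc[where B="B * (vmax / vmin)"])
    fix t
    have "0 \<le> ?r t" using v_pos by (simp add: less_imp_le)
    then show "\<bar>g (entry t x) * ?r t\<bar> \<le> B * (vmax / vmin)"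
      unfolding abs_mult using g(2,3)[of "entry t x"] r[of t] by (intro mult_mono) auto
  qed measurable
  have gei: "set_integrable lborel {a..b} (\<lambda>t. g (entry t x))"
    by (rule bounded_set_integrable_Icc[where B=B]) (use g in auto)
  have eq: "(LBINT t:{a..b}. g (entry t x) * ?r t) = (LBINT s:{entry a x..entry b x}. g s)"
  proof -
    have "(LBINT t:{a..b}. (g (entry t x) + 1) * ?r t) = (LBINT t:{a..b}. g (entry t x) * ?r t) + (LBINT t:{a..b}. ?r t)"
      unfolding distrib_right mult_1 by (rule set_integral_add(2)[OF gri ri])
    moreover have "(LBINT s:{entry a x..entry b x}. g s + 1) = (LBINT s:{entry a x..entry b x}. g s) + (LBINT s:{entry a x..entry b x}. 1)"
      by (rule set_integral_add(2)[OF gi set_integrable_Icc_const])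
    ultimately show ?thesis
      using change_of_variables_speed[OF u ab, of x] change_of_variables_speed[OF c ab, of x] by simp
  qed
  have le: "(LBINT t:{a..b}. g (entry t x)) \<le> (LBINT t:{a..b}. vmax / vmin * (g (entry t x) * ?r t))"
  proof (rule set_integral_mono[OF gei set_integrable_mult_right[OF gri]])
    fix t
    have "1 \<le> vmax / vmin * ?r t"
      using mult_left_mono[OF r(1)[of t], of "vmax / vmin"] vmin_pos vmax_pos by simp
    from mult_left_mono[OF this g(2)[of "entry t x"]]
    show "g (entry t x) \<le> vmax / vmin * (g (entry t x) * ?r t)" by (simp only: mult_1_right mult.left_commute mult.assoc)
  qed
  then show ?thesis unfolding set_integral_mult_right eq .
qed

end

locale speed_pair = A: bv_speed v vmin vmax K + B: bv_speed w vmin vmax K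
  for v w vmin vmax K +
  fixes T L :: real
  assumes T: "0 \<le> T" and L: "0 \<le> L" and agree: "\<And>s. s < 0 \<Longrightarrow> v s = w s"
begin

text \<open>The \<open>L\<^sup>1\<close> distance of the two speeds.\<close>

definition D :: real where
  "D = (LBINT s:{0..T}. \<bar>v s - w s\<bar>)"

lemma difference_bounded: "\<bar>v s - w s\<bar> \<le> vmax"
  using A.v_le[of s] A.v_pos[of s] B.v_le[of s] B.v_pos[of s] by linarith

lemma difference_integrable: "set_integrable lborel {a..b} (\<lambda>s. \<bar>v s - w s\<bar>)"
  by (rule bounded_set_integrable_Icc[where B=vmax]) (use difference_bounded in auto)

lemma D_nonneg: "0 \<le> D"
  unfolding D_def set_lebesgue_integral_def by (intro Bochner_Integration.integral_nonneg) auto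

lemma difference_integral_le:
  assumes "b \<le> T" shows "(LBINT s:{a..b}. \<bar>v s - w s\<bar>) \<le> D"
  unfolding D_def set_lebesgue_integral_def
proof (rule integral_mono)
  show "indicator {a..b} s *\<^sub>R \<bar>v s - w s\<bar> \<le> indicator {0..T} s *\<^sub>R \<bar>v s - w s\<bar>" for s
    using assms agree[of s] by (cases "s < 0") (auto simp: indicator_def)
qed (use difference_integrable in \<open>auto simp: set_integrable_def\<close>)

lemma distance_difference:
  assumes "t \<le> T" shows "\<bar>A.V t - B.V t\<bar> \<le> D"
proof -
  have *: "\<bar>(LBINT s:{a..b}. v s) - (LBINT s:{a..b}. w s)\<bar> \<le> D" if "b \<le> T" for a b
  proof -
    have "(LBINT s:{a..b}. v s) - (LBINT s:{a..b}. w s) = (LBINT s:{a..b}. v s - w s)"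
      using set_integral_diff(2)[OF A.v_integrable B.v_integrable] by simp
    moreover have "\<bar>LBINT s:{a..b}. v s - w s\<bar> \<le> (LBINT s:{a..b}. \<bar>v s - w s\<bar>)"
      unfolding set_lebesgue_integral_def by (rule order_trans[OF integral_abs_bound]) (simp add: abs_mult)
    ultimately show ?thesis using difference_integral_le[OF that, of a] by simp
  qed
  show ?thesis
  proof (cases "0 \<le> t")
    case True
    then show ?thesis using *[OF assms, of 0] by (simp add: A.V_def B.V_def)
  next
    case False
    then show ?thesis using *[OF T, of t] by (simp add: A.V_def B.V_def abs_minus_commute)
  qed
qed

text \<open>The travelled distances differ by at most \<open>D\<close> at the exit time and by at most \<open>D\<close> at the
  entry time.\<close>

lemma entry_difference:
  assumes "t \<le> T" shows "\<bar>B.entry t L - A.entry t L\<bar> \<le> 2 * D / vmin"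
proof -
  have "B.entry t L \<le> t"
    using B.entry_le[of t L t 0] L by (simp add: B.entry_0)
  then have "\<bar>A.V (B.entry t L) - B.V (B.entry t L)\<bar> \<le> D" using assms by (intro distance_difference) simp
  moreover have "\<bar>B.V (B.entry t L) - A.V (A.entry t L)\<bar> \<le> D"
    using distance_difference[OF assms] by (simp add: A.V_entry B.V_entry abs_minus_commute)
  ultimately have "\<bar>A.V (B.entry t L) - A.V (A.entry t L)\<bar> \<le> 2 * D" by linarith
  then have "vmin * \<bar>B.entry t L - A.entry t L\<bar> \<le> 2 * D"
    using A.V_expansive[of "B.entry t L" "A.entry t L"] by simp
  then show ?thesis using A.vmin_pos by (simp add: field_simps)
qed

text \<open>The value of \<open>g\<close> at the second entry time is the value at the first entry time of the shifted
  exit time \<open>\<alpha> t\<close>, and \<open>g\<close> composed with the first entry time has the same variation bound as \<open>g\<close>.\<close>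

lemma entry_shift_integral:
  assumes g: "variation_bound Kg g"
  shows "(LBINT t:{0..T}. \<bar>g (B.entry t L) - g (A.entry t L)\<bar>) \<le> 4 * vmax / vmin\<^sup>2 * Kg * D"
proof -
  define G where "G t = g (A.entry t L)" for t
  define \<alpha> where "\<alpha> t = A.entry (B.entry t L) (- L)" for t
  have "variation_bound Kg G"
    using variation_bound_compose[OF g, of "\<lambda>t. A.entry t L"] A.entry_mono by (simp add: G_def[abs_def] o_def)
  moreover have "\<bar>\<alpha> t - t\<bar> \<le> vmax / vmin * (2 * D / vmin)" if "t \<in> {0..T}" for t
  proof -
    have "A.entry (A.entry t L) (- L) = t" by (simp add: A.entry_entry A.entry_0)
    then have "\<bar>\<alpha> t - t\<bar> \<le> vmax / vmin * \<bar>B.entry t L - A.entry t L\<bar>"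
      using A.entry_Lipschitz[of "B.entry t L" "- L" "A.entry t L"] by (simp add: \<alpha>_def)
    also have "\<dots> \<le> vmax / vmin * (2 * D / vmin)"
      using entry_difference[of t] that A.vmin_pos A.vmax_pos by (intro mult_left_mono) auto
    finally show ?thesis .
  qed
  ultimately have "(LBINT t:{0..T}. \<bar>G (\<alpha> t) - G t\<bar>) \<le> 2 * (vmax / vmin * (2 * D / vmin)) * Kg"
    using T D_nonneg A.vmin_pos A.vmax_pos by (intro variation_bound_shift_integral) auto
  moreover have "G (\<alpha> t) = g (B.entry t L)" for t by (simp add: G_def \<alpha>_def A.entry_entry A.entry_0)
  ultimately show ?thesis by (simp add: G_def power2_eq_square field_simps)
qed

lemma entry_speed_difference_integral:
  "(LBINT t:{0..T}. \<bar>v (A.entry t L) - w (A.entry t L)\<bar>) \<le> vmax / vmin * D"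
proof -
  have "variation_bound (K + K) (\<lambda>s. \<bar>v s - w s\<bar>)"
  proof -
    obtain W where W: "\<And>t. 0 \<le> W t" "\<And>t. W t \<le> K" "\<And>s t. s \<le> t \<Longrightarrow> \<bar>v t - v s\<bar> \<le> W t - W s"
      using variation_bound_dominator[OF A.v_var] by blast
    obtain W' where W': "\<And>t. 0 \<le> W' t" "\<And>t. W' t \<le> K" "\<And>s t. s \<le> t \<Longrightarrow> \<bar>w t - w s\<bar> \<le> W' t - W' s"
      using variation_bound_dominator[OF B.v_var] by blast
    show ?thesis
    proof (rule variation_boundI[of "\<lambda>t. W t + W' t"])
      fix s t :: real assume "s \<le> t"
      then show "\<bar>\<bar>v t - w t\<bar> - \<bar>v s - w s\<bar>\<bar> \<le> W t + W' t - (W s + W' s)"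
        using W(3)[of s t] W'(3)[of s t] by linarith
    next
      fix t
      show "0 \<le> W t + W' t" "W t + W' t \<le> K + K" using W(1,2)[of t] W'(1,2)[of t] by linarith+
    qed
  qed
  then have "(LBINT t:{0..T}. \<bar>v (A.entry t L) - w (A.entry t L)\<bar>)
      \<le> vmax / vmin * (LBINT s:{A.entry 0 L..A.entry T L}. \<bar>v s - w s\<bar>)"
    using difference_bounded T by (intro A.entry_composition_integral) auto
  also have "\<dots> \<le> vmax / vmin * D"
  proof (intro mult_left_mono difference_integral_le)
    show "A.entry T L \<le> T" using A.entry_le[of T L T 0] L by (simp add: A.entry_0)
  qed (use A.vmin_pos A.vmax_pos in simp)
  finally show ?thesis .
qed

text \<open>The difference of the outflows has four sources: the speeds at the exit time, the inflow at the
  two entry times, the two speeds at the first entry time, and the second speed at the two entry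
  times.\<close>

lemma outflow_difference_integral:
  assumes h: "variation_bound Ki i" "\<And>s. 0 \<le> i s" "\<And>s. i s \<le> B"
  shows "(LBINT t:{0..T}. \<bar>i (A.entry t L) / v (A.entry t L) * v t - i (B.entry t L) / w (B.entry t L) * w t\<bar>)
    \<le> (B / vmin + vmax * (4 * vmax / vmin\<^sup>2 * Ki / vmin + B / vmin\<^sup>2 * (vmax / vmin + 4 * vmax / vmin\<^sup>2 * K))) * D"
proof -
  have [measurable]: "i \<in> borel_measurable borel" using h(1) by (rule variation_bound_borel_measurable)
  let ?a = "\<lambda>t. \<bar>v t - w t\<bar>"
  let ?b = "\<lambda>t. \<bar>i (B.entry t L) - i (A.entry t L)\<bar>"
  let ?c = "\<lambda>t. \<bar>v (A.entry t L) - w (A.entry t L)\<bar>"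
  let ?d = "\<lambda>t. \<bar>w (B.entry t L) - w (A.entry t L)\<bar>"
  let ?m = "B / vmin\<^sup>2"
  let ?R = "\<lambda>t. B / vmin * ?a t + vmax * (?b t / vmin + ?m * (?c t + ?d t))"
  have B0: "0 \<le> B" using h(2)[of 0] h(3)[of 0] by linarith
  have pw: "\<bar>i (A.entry t L) / v (A.entry t L) * v t - i (B.entry t L) / w (B.entry t L) * w t\<bar> \<le> ?R t" for t
  proof -
    let ?p = "i (A.entry t L) / v (A.entry t L)" and ?q = "i (B.entry t L) / w (B.entry t L)"
    have "p * a - q * b = p * (a - b) + (p - q) * b" for p q a b :: real by (simp add: algebra_simps)
    then have "?p * v t - ?q * w t = ?p * (v t - w t) + (?p - ?q) * w t" .
    then have "\<bar>?p * v t - ?q * w t\<bar> \<le> \<bar>?p\<bar> * ?a t + \<bar>?p - ?q\<bar> * \<bar>w t\<bar>"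
      by (metis abs_mult abs_triangle_ineq)
    moreover have "\<bar>?p\<bar> * ?a t \<le> B / vmin * ?a t"
      using h(2,3)[of "A.entry t L"] A.v_ge[of "A.entry t L"] A.v_pos[of "A.entry t L"] A.vmin_pos
      by (intro mult_right_mono) (auto simp: abs_divide intro!: frac_le)
    moreover have "\<bar>?p - ?q\<bar> * \<bar>w t\<bar> \<le> (?b t / vmin + ?m * (?c t + ?d t)) * vmax"
    proof (intro mult_mono)
      have "\<bar>?p - ?q\<bar> \<le> \<bar>i (A.entry t L) - i (B.entry t L)\<bar> / vmin + ?m * \<bar>v (A.entry t L) - w (B.entry t L)\<bar>"
        using h(2,3)[of "B.entry t L"] by (intro abs_quotient_diff_le A.vmin_pos A.v_ge B.v_ge) auto
      moreover have "?m * \<bar>v (A.entry t L) - w (B.entry t L)\<bar> \<le> ?m * (?c t + ?d t)"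
        using B0 by (intro mult_left_mono) auto
      moreover have "\<bar>i (A.entry t L) - i (B.entry t L)\<bar> = ?b t" by (rule abs_minus_commute)
      ultimately show "\<bar>?p - ?q\<bar> \<le> ?b t / vmin + ?m * (?c t + ?d t)" by simp
    qed (use B.v_abs_le B0 A.vmin_pos in auto)
    ultimately show ?thesis by (simp only: mult.commute[of vmax])
  qed
  have ai: "set_integrable lborel {0..T} ?a" by (rule difference_integrable)
  have bi: "set_integrable lborel {0..T} ?b"
  proof (rule bounded_set_integrable_Icc[where B=B])
    show "\<bar>?b t\<bar> \<le> B" for t
      using h(2,3)[of "B.entry t L"] h(2,3)[of "A.entry t L"] by simp
  qed measurable
  have ci: "set_integrable lborel {0..T} ?c"
    by (rule bounded_set_integrable_Icc[where B=vmax]) (use difference_bounded in auto)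
  have di: "set_integrable lborel {0..T} ?d"
  proof (rule bounded_set_integrable_Icc[where B=vmax])
    show "\<bar>?d t\<bar> \<le> vmax" for t
      using B.v_le[of "B.entry t L"] B.v_le[of "A.entry t L"] B.v_pos[of "B.entry t L"] B.v_pos[of "A.entry t L"] by simp
  qed measurable
  have cdi: "set_integrable lborel {0..T} (\<lambda>t. ?m * (?c t + ?d t))"
    by (intro set_integrable_mult_right set_integral_add(1)[OF ci di])
  have bvi: "set_integrable lborel {0..T} (\<lambda>t. ?b t / vmin)" using bi by simp
  have R1: "set_integrable lborel {0..T} (\<lambda>t. vmax * (?b t / vmin + ?m * (?c t + ?d t)))"
    by (intro set_integrable_mult_right set_integral_add(1)[OF bvi cdi])
  have R0: "set_integrable lborel {0..T} (\<lambda>t. B / vmin * ?a t)" using ai by (rule set_integrable_mult_right)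
  have "(LBINT t:{0..T}. \<bar>i (A.entry t L) / v (A.entry t L) * v t - i (B.entry t L) / w (B.entry t L) * w t\<bar>) \<le> (LBINT t:{0..T}. ?R t)"
    unfolding set_lebesgue_integral_def
  proof (rule integral_mono')
    show "integrable lborel (\<lambda>t. indicator {0..T} t *\<^sub>R ?R t)"
      using set_integral_add(1)[OF R0 R1] unfolding set_integrable_def .
    fix t
    show "indicator {0..T} t *\<^sub>R \<bar>i (A.entry t L) / v (A.entry t L) * v t - i (B.entry t L) / w (B.entry t L) * w t\<bar> \<le> indicator {0..T} t *\<^sub>R ?R t"
      by (intro scaleR_left_mono pw) auto
    show "0 \<le> indicator {0..T} t *\<^sub>R ?R t"
      by (intro scaleR_nonneg_nonneg order_trans[OF abs_ge_zero pw]) auto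
  qed
  moreover have "(LBINT t:{0..T}. ?R t) = B / vmin * (LBINT t:{0..T}. ?a t)
      + vmax * ((LBINT t:{0..T}. ?b t) / vmin + ?m * ((LBINT t:{0..T}. ?c t) + (LBINT t:{0..T}. ?d t)))"
    unfolding set_integral_add(2)[OF R0 R1] set_integral_mult_right set_integral_add(2)[OF bvi cdi]
      set_integral_divide_zero set_integral_add(2)[OF ci di] ..
  moreover have "vmax * ((LBINT t:{0..T}. ?b t) / vmin + ?m * ((LBINT t:{0..T}. ?c t) + (LBINT t:{0..T}. ?d t)))
      \<le> vmax * ((4 * vmax / vmin\<^sup>2 * Ki * D) / vmin + ?m * (vmax / vmin * D + 4 * vmax / vmin\<^sup>2 * K * D))"
    using entry_shift_integral[OF h(1)] entry_speed_difference_integral entry_shift_integral[OF B.v_var] A.vmin_pos A.vmax_pos B0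
    by (intro mult_left_mono add_mono divide_right_mono) auto
  moreover have "B / vmin * D + vmax * ((4 * vmax / vmin\<^sup>2 * Ki * D) / vmin + ?m * (vmax / vmin * D + 4 * vmax / vmin\<^sup>2 * K * D))
      = (B / vmin + vmax * (4 * vmax / vmin\<^sup>2 * Ki / vmin + ?m * (vmax / vmin + 4 * vmax / vmin\<^sup>2 * K))) * D"
    by (simp add: distrib_left distrib_right mult_ac)
  ultimately show ?thesis unfolding D_def[symmetric] by linarith
qed

end

section \<open>Lipschitz continuity of the cost\<close>

lemma traffic_solution_cong:
  assumes v: "\<And>t. t \<in> {0..T} \<Longrightarrow> v t = w t" and \<rho>0: "\<And>x. x \<in> {0..L} \<Longrightarrow> \<rho>0 x = \<rho>0' x"
  shows "traffic_solution T L \<rho>cr \<rho>max \<rho>0 In v \<rho> r \<longleftrightarrow> traffic_solution T L \<rho>cr \<rho>max \<rho>0' In w \<rho> r"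
proof -
  let ?Q = "{0..T} \<times> {0..L}"
  have Qc: "(LBINT p:?Q. F (v (fst p)) p) = (LBINT p:?Q. F (w (fst p)) p)" for F :: "real \<Rightarrow> real \<times> real \<Rightarrow> real"
    unfolding set_lebesgue_integral_def
    by (rule Bochner_Integration.integral_cong) (auto simp: indicator_def v)
  have ic: "(LBINT x:{0..L}. F (\<rho>0 x) x) = (LBINT x:{0..L}. F (\<rho>0' x) x)" for F :: "real \<Rightarrow> real \<Rightarrow> real"
    unfolding set_lebesgue_integral_def
    by (rule Bochner_Integration.integral_cong) (auto simp: indicator_def \<rho>0)
  have "kruzhkov_entropy_solution T L \<rho>cr \<rho>max \<rho>0 v \<rho> \<longleftrightarrow> kruzhkov_entropy_solution T L \<rho>cr \<rho>max \<rho>0' w \<rho>"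
    unfolding kruzhkov_entropy_solution_def
    using Qc[of "\<lambda>u p. \<bar>\<rho> p - _\<bar> * _ p + sgn (\<rho> p - _) * (flux \<rho>cr \<rho>max (\<rho> p) u - flux \<rho>cr \<rho>max _ u) * _ p"]
      ic[of "\<lambda>y x. \<bar>y - _\<bar> * _ x"] by simp
  moreover have "has_trace T L \<rho> 0 (\<lambda>t. In t / v t) \<longleftrightarrow> has_trace T L \<rho> 0 (\<lambda>t. In t / w t)"
    by (rule has_trace_cong) (simp add: v)
  moreover have "(t \<in> {0..T} \<longrightarrow> flux \<rho>cr \<rho>max (r t) (v t) = r t * v t) \<longleftrightarrow> (t \<in> {0..T} \<longrightarrow> flux \<rho>cr \<rho>max (r t) (w t) = r t * w t)" for t
    using v[of t] by auto
  ultimately show ?thesis unfolding traffic_solution_def by simp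
qed

text \<open>Negative times serve to encode the initial density. If vehicles move with speed \<open>vmin\<close> before time
  \<open>0\<close>, those at \<open>x\<close> at time \<open>0\<close> have entered at time \<open>- x / vmin\<close>; the inflow \<open>\<rho>0 x * vmin\<close> at that
  time produces the density \<open>\<rho>0 x\<close>. After time \<open>T\<close> and beyond \<open>x = L\<close> the data are continued by
  constants.\<close>

definition extended_speed :: "real \<Rightarrow> real \<Rightarrow> (real \<Rightarrow> real) \<Rightarrow> real \<Rightarrow> real" where
  "extended_speed T vmin v s = (if s < 0 then vmin else v (max 0 (min T s)))"

definition extended_inflow :: "real \<Rightarrow> real \<Rightarrow> real \<Rightarrow> (real \<Rightarrow> real) \<Rightarrow> (real \<Rightarrow> real) \<Rightarrow> real \<Rightarrow> real" where
  "extended_inflow T L vmin \<rho>0 In s =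
    (if s < 0 then \<rho>0 (max 0 (min L (- vmin * s))) * vmin else In (max 0 (min T s)))"

lemma BV_variation_bound:
  assumes "g \<in> BV a b E" "a \<le> b"
  shows "\<exists>K. variation_bound K (\<lambda>t. g (max a (min b t)))"
proof
  have "total_variation a b g < \<infinity>" using assms(1) by (simp add: BV_def)
  then show "variation_bound (enn2real (total_variation a b g)) (\<lambda>t. g (max a (min b t)))"
    using assms(2) by (intro variation_bound_clip) auto
qed

locale control_problem =
  fixes T L vmin vmax \<rho>cr \<rho>max \<rho>0min \<rho>0max fmin fmax :: real
    and \<rho>0 In fstar :: "real \<Rightarrow> real"
  assumes L: "0 < L" and T: "0 < T" and vmin: "0 < vmin" "vmin \<le> vmax"
    and cr: "0 < \<rho>cr" "\<rho>cr < \<rho>max"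
    and \<rho>0_bounds: "0 < \<rho>0min" "\<rho>0max \<le> \<rho>cr" "fmax / vmin \<le> \<rho>0max"
    and f_bounds: "0 < fmin" "fmin \<le> fmax"
    and \<rho>0: "\<rho>0 \<in> BV 0 L {\<rho>0min..\<rho>0max}"
    and In: "In \<in> BV 0 T {fmin..fmax}"
    and fstar: "fstar \<in> BV 0 T {fmin..fmax}"
begin

abbreviation inflow :: "real \<Rightarrow> real" where
  "inflow \<equiv> extended_inflow T L vmin \<rho>0 In"

abbreviation speed :: "(real \<Rightarrow> real) \<Rightarrow> real \<Rightarrow> real" where
  "speed \<equiv> extended_speed T vmin"

definition outflow_formula :: "(real \<Rightarrow> real) \<Rightarrow> real \<Rightarrow> real" where
  "outflow_formula v t = inflow (bv_speed.entry (speed v) t L) / speed v (bv_speed.entry (speed v) t L) * speed v t"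

lemma clip_mem: "0 \<le> b \<Longrightarrow> max 0 (min b s) \<in> {0..b}" for b s :: real
  by auto

lemma \<rho>0_mem: "0 \<le> \<rho>0 (max 0 (min L x))" "\<rho>0 (max 0 (min L x)) \<le> \<rho>0max"
  using \<rho>0 clip_mem[of L x] L \<rho>0_bounds by (auto simp: BV_def image_subset_iff intro: order_trans[OF less_imp_le])

lemma In_mem: "0 \<le> In (max 0 (min T t))" "In (max 0 (min T t)) \<le> fmax"
  using In clip_mem[of T t] T f_bounds by (auto simp: BV_def image_subset_iff intro: order_trans[OF less_imp_le])

lemma fmax_le: "fmax \<le> \<rho>0max * vmin"
  using \<rho>0_bounds(3) vmin(1) by (simp add: divide_le_eq)

lemma inflow_range: "0 \<le> inflow s" "inflow s \<le> \<rho>0max * vmin"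
  using \<rho>0_mem[of "- vmin * s"] In_mem[of s] fmax_le vmin
  by (auto simp: extended_inflow_def intro: mult_right_mono order_trans)

lemma inflow_variation: "\<exists>Ki. variation_bound Ki inflow"
proof -
  obtain K0 where "variation_bound K0 (\<lambda>x. \<rho>0 (max 0 (min L x)))"
    using BV_variation_bound[OF \<rho>0] L by auto
  moreover have "antimono (\<lambda>s. - vmin * s)" using vmin by (intro antimonoI) simp
  ultimately have "variation_bound K0 ((\<lambda>x. \<rho>0 (max 0 (min L x))) \<circ> (\<lambda>s. - vmin * s))"
    by (intro variation_bound_compose) auto
  then have 1: "variation_bound (\<bar>vmin\<bar> * K0) (\<lambda>s. \<rho>0 (max 0 (min L (- vmin * s))) * vmin)"
    using variation_bound_mult_const[of K0 _ vmin] by (simp add: o_def)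
  obtain K1 where 2: "variation_bound K1 (\<lambda>t. In (max 0 (min T t)))"
    using BV_variation_bound[OF In] T by auto
  have "\<bar>In (max 0 (min T t)) - \<rho>0 (max 0 (min L (- vmin * s))) * vmin\<bar> \<le> \<rho>0max * vmin" for s t
  proof -
    have "0 \<le> \<rho>0 (max 0 (min L (- vmin * s))) * vmin" "\<rho>0 (max 0 (min L (- vmin * s))) * vmin \<le> \<rho>0max * vmin"
      using \<rho>0_mem[of "- vmin * s"] vmin by (auto intro: mult_right_mono)
    then show ?thesis using In_mem[of t] fmax_le by (simp add: abs_le_iff)
  qed
  from variation_bound_glue[OF 1 2 this, of 0] show ?thesis
    unfolding extended_inflow_def[abs_def] by blast
qed

lemma speed_eq: "t \<in> {0..T} \<Longrightarrow> speed v t = v t"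
  by (simp add: extended_speed_def min_absorb2 max_absorb2)

lemma bv_speed_extended:
  assumes v: "v \<in> admissible_controls T vmin vmax K C" and K: "0 \<le> K"
  shows "bv_speed (speed v) vmin vmax (0 + K + (vmax - vmin))"
proof
  have mem: "v (max 0 (min T t)) \<in> {vmin..vmax}" for t
    using v clip_mem[of T t] T by (auto simp: admissible_controls_def BV_def image_subset_iff)
  show "vmin \<le> speed v t" "speed v t \<le> vmax" for t
    using mem[of t] vmin by (auto simp: extended_speed_def)
  have "variation_bound K (\<lambda>t. v (max 0 (min T t)))"
    using v T K by (intro variation_bound_clip) (auto simp: admissible_controls_def)
  moreover have "\<bar>v (max 0 (min T t)) - vmin\<bar> \<le> vmax - vmin" for t using mem[of t] by simp
  ultimately show "variation_bound (0 + K + (vmax - vmin)) (speed v)"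
    unfolding extended_speed_def[abs_def] by (intro variation_bound_glue variation_bound_const)
qed (use vmin in auto)

context
  fixes v K C
  assumes v: "v \<in> admissible_controls T vmin vmax K C" and K: "0 \<le> K"
begin

interpretation bv_speed "speed v" vmin vmax "0 + K + (vmax - vmin)"
  by (rule bv_speed_extended[OF v K])

lemma V_negative:
  assumes "s \<le> 0" shows "V s = vmin * s"
proof -
  have "(LBINT r:{s..0}. speed v r) = (LBINT r:{s..0}. vmin)"
  proof (rule set_lebesgue_integral_cong_AE)
    show "AE r\<in>{s..0} in lborel. speed v r = vmin"
      using AE_not_in_countable[of "{0}", simplified] by eventually_elim (auto simp: extended_speed_def)
  qed simp_all
  then have "V 0 - V s = vmin * (0 - s)"
    unfolding V_diff[OF assms] by (simp only: set_integral_Icc_const[OF assms])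
  then show ?thesis by (simp add: V_0)
qed

lemma entry_density_range: "0 \<le> inflow s / speed v s" "inflow s / speed v s \<le> \<rho>cr"
proof -
  show "0 \<le> inflow s / speed v s" using inflow_range(1)[of s] v_pos[of s] by simp
  have "inflow s / speed v s \<le> \<rho>0max * vmin / vmin"
    using inflow_range[of s] v_ge[of s] vmin by (intro frac_le) auto
  then show "inflow s / speed v s \<le> \<rho>cr" using \<rho>0_bounds vmin by simp
qed

lemma formula_solution:
  "\<exists>\<rho>. traffic_solution T L \<rho>cr \<rho>max \<rho>0 In v \<rho> (\<lambda>t. inflow (entry t L) / speed v (entry t L))"
proof -
  obtain Ki where Ki: "variation_bound Ki inflow" using inflow_variation by blast
  have h: "variation_bound (Ki / vmin + \<rho>0max * vmin / vmin\<^sup>2 * (0 + K + (vmax - vmin))) (\<lambda>s. inflow s / speed v s)"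
    by (rule variation_bound_divide[OF Ki v_var vmin_pos v_ge]) (use inflow_range in auto)
  have init: "inflow (entry 0 x) / speed v (entry 0 x) = \<rho>0 x" if x: "x \<in> {0<..L}" for x
  proof -
    have e: "V (entry 0 x) = - x" by (simp add: V_entry V_0)
    then have neg: "entry 0 x < 0" using V_strict_mono[of "entry 0 x" 0] x by (simp add: V_0)
    then have "- vmin * entry 0 x = x" using V_negative[of "entry 0 x"] e by simp
    then show ?thesis using neg x vmin by (simp add: extended_inflow_def extended_speed_def)
  qed
  have "traffic_solution T L \<rho>cr \<rho>max \<rho>0 In (speed v) (transported (\<lambda>s. inflow s / speed v s))
      (\<lambda>t. inflow (entry t L) / speed v (entry t L))"
    by (rule transported_traffic_solution[OF h entry_density_range cr(2) less_imp_le[OF T] init])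
      (auto simp: extended_inflow_def)
  then show ?thesis
    using traffic_solution_cong[of T "speed v" v L \<rho>0 \<rho>0] speed_eq by blast
qed

lemma formula_unique:
  assumes "traffic_solution T L \<rho>cr \<rho>max \<rho>0 In v \<rho> r"
  shows "AE t in lborel. t \<in> {0..T} \<longrightarrow> r t * v t = outflow_formula v t"
proof -
  obtain \<rho>' where sol: "traffic_solution T L \<rho>cr \<rho>max \<rho>0 In v \<rho>' (\<lambda>t. inflow (entry t L) / speed v (entry t L))"
    using formula_solution by blast
  let ?\<rho>0 = "\<lambda>x. \<rho>0 (max 0 (min L x))"
  obtain K0 where "variation_bound K0 ?\<rho>0"
    using BV_variation_bound[OF \<rho>0] L by auto
  then have "?\<rho>0 \<in> borel_measurable borel" by (rule variation_bound_borel_measurable)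
  then interpret inflow_problem "speed v" vmin vmax "0 + K + (vmax - vmin)" T L \<rho>cr \<rho>max ?\<rho>0
    using T L cr \<rho>0_mem \<rho>0_bounds(2) by unfold_locales (auto intro: order_trans)
  have c: "traffic_solution T L \<rho>cr \<rho>max \<rho>0 In v \<rho> r \<longleftrightarrow> traffic_solution T L \<rho>cr \<rho>max ?\<rho>0 In (speed v) \<rho> r" for \<rho> r
    by (rule traffic_solution_cong) (auto simp: speed_eq)
  have "In t / speed v t \<le> \<rho>cr" if "t \<in> {0..T}" for t
    using entry_density_range(2)[of t] that by (simp add: extended_inflow_def)
  then have "AE t in lborel. t \<in> {0..T} \<longrightarrow> r t = inflow (entry t L) / speed v (entry t L)"
    by (rule outflow_unique[OF assms[unfolded c] sol[unfolded c]])
  then show ?thesis by eventually_elim (auto simp: outflow_formula_def speed_eq)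
qed

lemma outflow_formula_bounded: "\<bar>outflow_formula v t\<bar> \<le> \<rho>cr * vmax"
proof -
  have "\<bar>inflow s / speed v s\<bar> \<le> \<rho>cr" for s
    using entry_density_range[of s] by (simp only: abs_of_nonneg)
  then show ?thesis
    unfolding outflow_formula_def abs_mult using v_abs_le cr by (intro mult_mono) auto
qed

lemma outflow_formula_measurable: "outflow_formula v \<in> borel_measurable borel"
proof -
  have [measurable]: "inflow \<in> borel_measurable borel"
    using inflow_variation variation_bound_borel_measurable by blast
  show ?thesis unfolding outflow_formula_def[abs_def] by measurable
qed

text \<open>Since all solutions have almost everywhere the same outflow, the cost does not depend on the
  choice made in the definition of \<open>outflow\<close>.\<close>

lemma cost_formula:
  "cost T L \<rho>cr \<rho>max \<rho>0 In fstar v = (LBINT t:{0..T}. (outflow_formula v t - fstar (max 0 (min T t)))\<^sup>2)"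
proof -
  let ?q = "outflow T L \<rho>cr \<rho>max \<rho>0 In v"
  have "\<exists>q \<rho> r. traffic_solution T L \<rho>cr \<rho>max \<rho>0 In v \<rho> r \<and> q = (\<lambda>t. r t * v t)"
    using formula_solution by blast
  then have "\<exists>\<rho> r. traffic_solution T L \<rho>cr \<rho>max \<rho>0 In v \<rho> r \<and> ?q = (\<lambda>t. r t * v t)"
    unfolding outflow_def by (rule someI_ex)
  then obtain \<rho> r where sol: "traffic_solution T L \<rho>cr \<rho>max \<rho>0 In v \<rho> r" and q: "?q = (\<lambda>t. r t * v t)" by blast
  obtain Kf where "variation_bound Kf (\<lambda>t. fstar (max 0 (min T t)))"
    using BV_variation_bound[OF fstar] T by auto
  then have [measurable]: "(\<lambda>t. fstar (max 0 (min T t))) \<in> borel_measurable borel"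
    by (rule variation_bound_borel_measurable)
  note [measurable] = outflow_formula_measurable
  have "(\<lambda>t. indicator {0..T} t *\<^sub>R r t) \<in> borel_measurable lborel"
    using sol unfolding traffic_solution_def has_trace_def set_integrable_def
    by (intro borel_measurable_integrable) blast
  then have [measurable]: "(\<lambda>t. indicator {0..T} t *\<^sub>R r t) \<in> borel_measurable borel" by simp
  have eq: "indicator {0..T} t *\<^sub>R (?q t - fstar t)\<^sup>2
      = indicator {0..T} t *\<^sub>R ((indicator {0..T} t *\<^sub>R r t) * speed v t - fstar (max 0 (min T t)))\<^sup>2" for t
    using speed_eq[of t v] by (cases "t \<in> {0..T}") (auto simp: q)
  show ?thesis
    unfolding cost_def set_lebesgue_integral_def
  proof (rule integral_cong_AE)
    show "(\<lambda>t. indicator {0..T} t *\<^sub>R (?q t - fstar t)\<^sup>2) \<in> borel_measurable lborel"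
      unfolding eq by measurable
    show "AE t in lborel. indicator {0..T} t *\<^sub>R (?q t - fstar t)\<^sup>2
        = indicator {0..T} t *\<^sub>R (outflow_formula v t - fstar (max 0 (min T t)))\<^sup>2"
      using formula_unique[OF sol] by eventually_elim (auto simp: q indicator_def)
  qed measurable
qed

end

lemma fstar_mem: "\<bar>fstar (max 0 (min T t))\<bar> \<le> fmax"
proof -
  have "fstar (max 0 (min T t)) \<in> {fmin..fmax}"
    using fstar clip_mem[of T t] T by (auto simp: BV_def image_subset_iff)
  then show ?thesis using f_bounds by simp
qed

text \<open>The difference \<open>(a - f)\<^sup>2 - (b - f)\<^sup>2\<close> is \<open>(a + b - 2 f) (a - b)\<close>, whose first factor is bounded.\<close>

lemma cost_Lipschitz:
  assumes K: "0 \<le> K"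
  shows "\<exists>M\<ge>0. \<forall>v \<in> admissible_controls T vmin vmax K C. \<forall>w \<in> admissible_controls T vmin vmax K C.
      \<bar>cost T L \<rho>cr \<rho>max \<rho>0 In fstar v - cost T L \<rho>cr \<rho>max \<rho>0 In fstar w\<bar> \<le> M * L1_norm T (\<lambda>t. v t - w t)"
proof -
  obtain Ki where Ki: "variation_bound Ki inflow" using inflow_variation by blast
  define K' where "K' = 0 + K + (vmax - vmin)"
  define M where "M = \<rho>0max * vmin / vmin + vmax * (4 * vmax / vmin\<^sup>2 * Ki / vmin
    + \<rho>0max * vmin / vmin\<^sup>2 * (vmax / vmin + 4 * vmax / vmin\<^sup>2 * K'))"
  define N where "N = 2 * (\<rho>cr * vmax + fmax)"
  let ?f = "\<lambda>t. fstar (max 0 (min T t))"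
  obtain Kf where "variation_bound Kf ?f"
    using BV_variation_bound[OF fstar] T by auto
  then have [measurable]: "?f \<in> borel_measurable borel" by (rule variation_bound_borel_measurable)
  have N0: "0 \<le> N" using cr vmin f_bounds by (auto simp: N_def)
  have est: "\<bar>cost T L \<rho>cr \<rho>max \<rho>0 In fstar v - cost T L \<rho>cr \<rho>max \<rho>0 In fstar w\<bar> \<le> N * \<bar>M\<bar> * L1_norm T (\<lambda>t. v t - w t)"
    if v: "v \<in> admissible_controls T vmin vmax K C" and w: "w \<in> admissible_controls T vmin vmax K C" for v w
  proof -
    interpret speed_pair "speed v" "speed w" vmin vmax K' T L
      unfolding K'_def speed_pair_def speed_pair_axioms_def
      using bv_speed_extended[OF v K] bv_speed_extended[OF w K] T L by (auto simp: extended_speed_def)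
    let ?a = "outflow_formula v" and ?b = "outflow_formula w"
    note [measurable] = outflow_formula_measurable[OF v K] outflow_formula_measurable[OF w K]
    note bd = outflow_formula_bounded[OF v K] outflow_formula_bounded[OF w K]
    have sq: "set_integrable lborel {0..T} (\<lambda>t. (g t - ?f t)\<^sup>2)"
      if [measurable]: "g \<in> borel_measurable borel" and g: "\<And>t. \<bar>g t\<bar> \<le> \<rho>cr * vmax" for g
    proof (rule bounded_set_integrable_Icc[where B="(\<rho>cr * vmax + fmax)\<^sup>2"])
      fix t
      have "\<bar>g t - ?f t\<bar> \<le> \<rho>cr * vmax + fmax" using g[of t] fstar_mem[of t] by linarith
      then show "\<bar>(g t - ?f t)\<^sup>2\<bar> \<le> (\<rho>cr * vmax + fmax)\<^sup>2" by (simp add: power2_le_iff_abs_le)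
    qed measurable
    have ab: "set_integrable lborel {0..T} (\<lambda>t. \<bar>?a t - ?b t\<bar>)"
    proof (rule bounded_set_integrable_Icc[where B="\<rho>cr * vmax + \<rho>cr * vmax"])
      show "\<bar>\<bar>?a t - ?b t\<bar>\<bar> \<le> \<rho>cr * vmax + \<rho>cr * vmax" for t using bd[of t] by linarith
    qed measurable
    have "\<bar>cost T L \<rho>cr \<rho>max \<rho>0 In fstar v - cost T L \<rho>cr \<rho>max \<rho>0 In fstar w\<bar>
        = \<bar>LBINT t:{0..T}. (?a t - ?f t)\<^sup>2 - (?b t - ?f t)\<^sup>2\<bar>"
      unfolding cost_formula[OF v K] cost_formula[OF w K]
      using set_integral_diff(2)[OF sq[OF _ bd(1)] sq[OF _ bd(2)]] by simp
    moreover have "\<bar>LBINT t:{0..T}. (?a t - ?f t)\<^sup>2 - (?b t - ?f t)\<^sup>2\<bar> \<le> (LBINT t:{0..T}. N * \<bar>?a t - ?b t\<bar>)"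
      unfolding set_lebesgue_integral_def
    proof (rule order_trans[OF integral_abs_bound], rule integral_mono')
      show "integrable lborel (\<lambda>t. indicator {0..T} t *\<^sub>R (N * \<bar>?a t - ?b t\<bar>))"
        using set_integrable_mult_right[OF ab, of N] unfolding set_integrable_def by simp
      fix t
      have "(?a t - ?f t)\<^sup>2 - (?b t - ?f t)\<^sup>2 = (?a t + ?b t - 2 * ?f t) * (?a t - ?b t)"
        by (simp add: power2_eq_square algebra_simps)
      moreover have "\<bar>?a t + ?b t - 2 * ?f t\<bar> \<le> N"
      proof -
        have "\<bar>a + b - 2 * c\<bar> \<le> 2 * (x + y)" if "\<bar>a\<bar> \<le> x" "\<bar>b\<bar> \<le> x" "\<bar>c\<bar> \<le> y" for a b c x y :: real
          using that by (auto simp: abs_le_iff)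
        then show ?thesis unfolding N_def using bd fstar_mem by blast
      qed
      ultimately have "\<bar>(?a t - ?f t)\<^sup>2 - (?b t - ?f t)\<^sup>2\<bar> \<le> N * \<bar>?a t - ?b t\<bar>"
        by (simp add: abs_mult mult_right_mono)
      then show "\<bar>indicator {0..T} t *\<^sub>R ((?a t - ?f t)\<^sup>2 - (?b t - ?f t)\<^sup>2)\<bar> \<le> indicator {0..T} t *\<^sub>R (N * \<bar>?a t - ?b t\<bar>)"
        by (auto simp: indicator_def)
      show "0 \<le> indicator {0..T} t *\<^sub>R (N * \<bar>?a t - ?b t\<bar>)" using N0 by simp
    qed
    moreover have "(LBINT t:{0..T}. \<bar>?a t - ?b t\<bar>) \<le> M * D"
      using outflow_difference_integral[OF Ki inflow_range] by (simp only: outflow_formula_def M_def)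
    then have "(LBINT t:{0..T}. \<bar>?a t - ?b t\<bar>) \<le> \<bar>M\<bar> * D"
      by (rule order_trans) (intro mult_right_mono D_nonneg abs_ge_self)
    then have "(LBINT t:{0..T}. N * \<bar>?a t - ?b t\<bar>) \<le> N * (\<bar>M\<bar> * D)"
      unfolding set_integral_mult_right by (rule mult_left_mono[OF _ N0])
    moreover have "D = L1_norm T (\<lambda>t. v t - w t)"
      unfolding D_def L1_norm_def by (rule set_lebesgue_integral_cong) (auto simp: speed_eq)
    ultimately show ?thesis by (simp add: mult.assoc)
  qed
  show ?thesis
    by (intro exI[of _ "N * \<bar>M\<bar>"] conjI ballI est) (use N0 in auto)
qed

end

theorem proposition3:
  fixes T L vmin vmax \<rho>cr \<rho>max \<rho>0min \<rho>0max fmin fmax :: real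
    and \<rho>0 In fstar :: "real \<Rightarrow> real"
  assumes "0 < L" and "0 < T"
    and "0 < vmin" and "vmin \<le> vmax"
    and "0 < \<rho>cr" and "\<rho>cr < \<rho>max"
    and "0 < \<rho>0min" and "\<rho>0min \<le> \<rho>0max" and "\<rho>0max \<le> \<rho>cr"
    and "0 < fmin" and "fmin \<le> fmax"
    and "\<rho>0min \<le> fmin / vmax" and "\<rho>0max \<ge> fmax / vmin"
    and "\<rho>0 \<in> BV 0 L {\<rho>0min..\<rho>0max}"
    and "In \<in> BV 0 T {fmin..fmax}"
    and "fstar \<in> BV 0 T {fmin..fmax}"
  shows "\<forall>K>0. \<forall>C>0. \<exists>M\<ge>0.
    \<forall>v \<in> admissible_controls T vmin vmax K C. \<forall>w \<in> admissible_controls T vmin vmax K C.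
      \<bar>cost T L \<rho>cr \<rho>max \<rho>0 In fstar v - cost T L \<rho>cr \<rho>max \<rho>0 In fstar w\<bar>
        \<le> M * L1_norm T (\<lambda>t. v t - w t)"
proof -
  interpret control_problem T L vmin vmax \<rho>cr \<rho>max \<rho>0min \<rho>0max fmin fmax \<rho>0 In fstar
    using assms by unfold_locales auto
  show ?thesis using cost_Lipschitz less_imp_le by blast
qed

end
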